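(* Let $X=C([0,\omega_1])$ be the Banach space of scalar-valued, continuous functions on the compact Hausdorff space $[0,\omega_1]$ of ordinals not exceeding the first uncountable ordinal $\omega_1$, endowed with the order topology. Then $$K_0(\mathscr{B}(C([0,\omega_1])))\cong\mathbb{Z}$$ as abelian groups.
   Context: The scalar field is $\mathbb{K}=\mathbb{R}$ or $\mathbb{K}=\mathbb{C}$. $C(K)$, for a compact Hausdorff space $K$, carries the supremum norm. $\mathscr{B}(X)$ is the Banach algebra of all bounded linear operators on $X$. $K_0$-group of a unital ring $\mathscr{A}$: let $M_{m,n}(\mathscr{A})$ be the $(m\times n)$-matrices over $\mathscr{A}$, $M_n(\mathscr{A})=M_{n,n}(\mathscr{A})$, $\operatorname{IP}_n(\mathscr{A})=\{P\in M_n(\mathscr{A}):P^2=P\}$ and $\operatorname{IP}_\infty(\mathscr{A})=\bigcup_{n\in\mathbb{N}}\operatorname{IP}_n(\mathscr{A})$. For $P\in\operatorname{IP}_m(\mathscr{A})$ and $Q\in\operatorname{IP}_n(\mathscr{A})$, write $P\sim_0 Q$ if $P=AB$ and $Q=BA$ for some $A\in M_{m,n}(\mathscr{A})$, $B\in M_{n,m}(\mathscr{A})$. Then $V(\mathscr{A})=\operatorname{IP}_\infty(\mathscr{A})/{\sim_0}$ is an abelian semigroup under $[P]_V+[Q]_V=\left[\begin{pmatrix}P&0\\0&Q\end{pmatrix}\right]_V$, and $K_0(\mathscr{A})$ is the Grothendieck group of $V(\mathscr{A})$. *)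

theory Defs
  imports
    "HOL-Analysis.Analysis"
    "Jordan_Normal_Form.Matrix"
begin

section \<open>The ordinal interval from 0 to the first uncountable ordinal\<close>

text \<open>
  \<^term>\<open>cardSuc natLeq\<close> is a well-order of type \<open>\<omega>\<^sub>1\<close>. An ordinal \<open>\<alpha> \<le> \<omega>\<^sub>1\<close> is represented by the
  initial segment of order type \<open>\<alpha>\<close> of this well-order; the order is inclusion and the largest
  element, the whole field, represents \<open>\<omega>\<^sub>1\<close> itself.
\<close>

typedef omega1_interval = "{A. ofilter (cardSuc natLeq) A}"
  morphisms segment_of Segment
  by (rule exI[of _ "{}"]) (simp add: ofilter_def)

setup_lifting type_definition_omega1_interval

lemma Well_order_omega1: "Well_order (cardSuc natLeq)"
  using cardSuc_Card_order[OF natLeq_Card_order] unfolding card_order_on_def by (rule conjunct1)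

lemma wo_rel_omega1: "wo_rel (cardSuc natLeq)"
  using Well_order_omega1 by (simp add: wo_rel_def)

instantiation omega1_interval :: linorder
begin

lift_definition less_eq_omega1_interval :: "omega1_interval \<Rightarrow> omega1_interval \<Rightarrow> bool"
  is "(\<subseteq>)" .

lift_definition less_omega1_interval :: "omega1_interval \<Rightarrow> omega1_interval \<Rightarrow> bool"
  is "(\<subset>)" .

instance
proof
  fix x y z :: omega1_interval
  show "x < y \<longleftrightarrow> x \<le> y \<and> \<not> y \<le> x"
    unfolding less_omega1_interval.rep_eq less_eq_omega1_interval.rep_eq by blast
  show "x \<le> x"
    unfolding less_eq_omega1_interval.rep_eq by blast
  show "x \<le> y \<Longrightarrow> y \<le> z \<Longrightarrow> x \<le> z"
    unfolding less_eq_omega1_interval.rep_eq by blast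
  show "x \<le> y \<Longrightarrow> y \<le> x \<Longrightarrow> x = y"
    unfolding less_eq_omega1_interval.rep_eq segment_of_inject[symmetric] by blast
  show "x \<le> y \<or> y \<le> x"
    using wo_rel.ofilter_linord[OF wo_rel_omega1] segment_of[of x] segment_of[of y]
    unfolding less_eq_omega1_interval.rep_eq by simp
qed

end

instance omega1_interval :: wellorder
proof
  fix P :: "omega1_interval \<Rightarrow> bool" and a
  assume step: "\<And>x. (\<And>y. y < x \<Longrightarrow> P y) \<Longrightarrow> P x"
  let ?r = "cardSuc natLeq"
  have "wf (ofilterIncl ?r)"
    by (rule wf_ofilterIncl[OF Well_order_omega1])
  then have wf: "wf (inv_image (ofilterIncl ?r) segment_of)"
    by (rule wf_inv_image)
  have sub: "(y, x) \<in> inv_image (ofilterIncl ?r) segment_of" "segment_of y \<noteq> Field ?r"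
    if "y < x" "segment_of x \<noteq> Field ?r" for x y
    using that segment_of[of x] segment_of[of y]
    by (auto simp: ofilterIncl_def less_omega1_interval.rep_eq ofilter_def)
  have proper: "segment_of x \<noteq> Field ?r \<Longrightarrow> P x" for x
    using wf
  proof (induction x rule: wf_induct_rule)
    case (less x)
    show ?case
    proof (rule step)
      fix y assume "y < x"
      then show "P y" using less.IH[of y] sub[of y x] less.prems by blast
    qed
  qed
  have "segment_of y \<noteq> Field ?r" if "y < a" for y
    using that segment_of[of a]
    by (auto simp: less_omega1_interval.rep_eq ofilter_def)
  then show "P a"
    by (rule step[OF proper])
qed

instantiation omega1_interval :: linorder_topology
begin

definition open_omega1_interval :: "omega1_interval set \<Rightarrow> bool"
  where "open_omega1_interval =
    generate_topology (range (\<lambda>a. {..<a}) \<union> range (\<lambda>a. {a<..}))"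

instance
  by standard (rule open_omega1_interval_def)

end

lemma compact_omega1_interval_atMost: "compact {..x :: omega1_interval}"
proof (induction x rule: less_induct)
  case (less x)
  show ?case
  proof (rule compactI)
    fix C :: "omega1_interval set set"
    assume op: "\<forall>c\<in>C. open c" and cov: "{..x} \<subseteq> \<Union>C"
    have "x \<in> \<Union>C" using cov by (rule subsetD) simp
    then obtain U where U: "U \<in> C" "x \<in> U" by (rule UnionE)
    then have "open U" using op by blast
    show "\<exists>C'\<subseteq>C. finite C' \<and> {..x} \<subseteq> \<Union>C'"
    proof (cases "\<exists>y. y < x")
      case False
      then have "{..x} = {x}" by (auto simp: order_le_less)
      then have "{..x} \<subseteq> \<Union>{U}" using U(2) by simp
      moreover have "{U} \<subseteq> C" "finite {U}" using U(1) by simp_all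
      ultimately show ?thesis by (intro exI[of _ "{U}"] conjI)
    next
      case True
      then obtain z where "z < x" by (elim exE)
      then obtain y where y: "y < x" "{y<..x} \<subseteq> U"
        using open_left[OF \<open>open U\<close> U(2)] by metis
      have cy: "{..y} \<subseteq> \<Union>C"
        using y(1) by (intro subset_trans[OF _ cov]) simp
      from op have opC: "\<And>B. B \<in> C \<Longrightarrow> open B" by (rule bspec)
      obtain D where D: "D \<subseteq> C" "finite D" "{..y} \<subseteq> \<Union>D"
        by (rule compactE[OF less.IH[OF y(1)] cy opC])
      have "{..x} \<subseteq> {..y} \<union> {y<..x}" by (auto simp: not_less)
      also have "\<dots> \<subseteq> \<Union>D \<union> U" using D(3) y(2) by (rule Un_mono)
      also have "\<dots> = \<Union>(insert U D)" by (simp add: Un_commute)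
      finally have "{..x} \<subseteq> \<Union>(insert U D)" .
      moreover have "insert U D \<subseteq> C" "finite (insert U D)" using D(1,2) U(1) by simp_all
      ultimately show ?thesis by (intro exI[of _ "insert U D"] conjI)
    qed
  qed
qed

lemma Field_omega1_max: "x \<le> Segment (Field (cardSuc natLeq))"
proof -
  have "ofilter (cardSuc natLeq) (Field (cardSuc natLeq))"
    by (rule wo_rel.Field_ofilter[OF wo_rel_omega1])
  then show ?thesis
    using segment_of[of x]
    by (auto simp: less_eq_omega1_interval.rep_eq Segment_inverse ofilter_def)
qed

text \<open>
  By compactness every continuous scalar function on the interval is bounded, so the type
  \<open>omega1_interval \<Rightarrow>\<^sub>C 'k\<close> of bounded continuous functions with the supremum norm is the space of
  all continuous functions.
\<close>

lemma compact_omega1_interval: "compact (UNIV :: omega1_interval set)"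
proof -
  have "compact {..Segment (Field (cardSuc natLeq))}"
    by (rule compact_omega1_interval_atMost)
  moreover have "{..Segment (Field (cardSuc natLeq))} = UNIV"
    using Field_omega1_max by auto
  ultimately show ?thesis
    by (rule back_subst)
qed

lemma bcontfun_omega1_interval:
  "(bcontfun :: (omega1_interval \<Rightarrow> 'k::metric_space) set) = {f. continuous_on UNIV f}"
proof -
  have "bounded (range f)" if "continuous_on UNIV f" for f :: "omega1_interval \<Rightarrow> 'k"
    by (rule compact_imp_bounded[OF compact_continuous_image[OF that compact_omega1_interval]])
  then show ?thesis unfolding bcontfun_def by blast
qed


section \<open>Bounded scalar-linear operators on a space of continuous functions\<close>

text \<open>
  The type \<open>_ \<Rightarrow>\<^sub>L _\<close> of bounded linear operators only requires real-linearity, so linearity over the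
  scalar field \<open>'k\<close> (the reals or the complex numbers) is imposed in addition.
\<close>

definition scale_bcontfun ::
  "'k::real_normed_field \<Rightarrow> ('x::topological_space \<Rightarrow>\<^sub>C 'k) \<Rightarrow> ('x \<Rightarrow>\<^sub>C 'k)"
  where "scale_bcontfun c f = Bcontfun (\<lambda>x. c * f x)"

lemma scale_bcontfun_rep_eq:
  fixes f :: "'x::topological_space \<Rightarrow>\<^sub>C 'k::real_normed_field"
  shows "apply_bcontfun (scale_bcontfun c f) x = c * f x"
proof -
  have "bounded ((\<lambda>y. c * y) ` range f)"
    by (intro bounded_linear_image bounded_linear_mult_right) simp
  then have "(\<lambda>x. c * f x) \<in> bcontfun"
    by (auto simp: bcontfun_def image_image intro!: continuous_intros)
  then show ?thesis by (simp add: scale_bcontfun_def Bcontfun_inverse)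
qed

typedef (overloaded) ('x, 'k) bounded_op =
  "{T :: ('x::topological_space \<Rightarrow>\<^sub>C 'k::real_normed_field) \<Rightarrow>\<^sub>L ('x \<Rightarrow>\<^sub>C 'k).
      \<forall>c f. T (scale_bcontfun c f) = scale_bcontfun c (T f)}"
  morphisms blinfun_of Bounded_op
  by (rule exI[of _ id_blinfun]) simp

setup_lifting type_definition_bounded_op

lemma scale_bcontfun_0: "scale_bcontfun c 0 = 0"
  by (rule bcontfun_eqI) (simp add: scale_bcontfun_rep_eq)

lemma scale_bcontfun_add:
  "scale_bcontfun c (f + g) = scale_bcontfun c f + scale_bcontfun c g"
  by (rule bcontfun_eqI) (simp add: scale_bcontfun_rep_eq algebra_simps)

lemma scale_bcontfun_diff:
  "scale_bcontfun c (f - g) = scale_bcontfun c f - scale_bcontfun c g"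
  by (rule bcontfun_eqI) (simp add: scale_bcontfun_rep_eq algebra_simps)

lemma scale_bcontfun_minus: "scale_bcontfun c (- f) = - scale_bcontfun c f"
  by (rule bcontfun_eqI) (simp add: scale_bcontfun_rep_eq)

instantiation bounded_op :: (topological_space, real_normed_field) ring_1
begin

lift_definition zero_bounded_op :: "('a, 'b) bounded_op" is 0
  by (simp add: scale_bcontfun_0)

lift_definition one_bounded_op :: "('a, 'b) bounded_op" is id_blinfun
  by simp

lift_definition plus_bounded_op ::
  "('a, 'b) bounded_op \<Rightarrow> ('a, 'b) bounded_op \<Rightarrow> ('a, 'b) bounded_op" is "(+)"
  by (simp add: blinfun.add_left scale_bcontfun_add)

lift_definition minus_bounded_op ::
  "('a, 'b) bounded_op \<Rightarrow> ('a, 'b) bounded_op \<Rightarrow> ('a, 'b) bounded_op" is "(-)"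
  by (simp add: blinfun.diff_left scale_bcontfun_diff)

lift_definition uminus_bounded_op :: "('a, 'b) bounded_op \<Rightarrow> ('a, 'b) bounded_op" is uminus
  by (simp add: blinfun.minus_left scale_bcontfun_minus)

lift_definition times_bounded_op ::
  "('a, 'b) bounded_op \<Rightarrow> ('a, 'b) bounded_op \<Rightarrow> ('a, 'b) bounded_op" is blinfun_compose
  by simp

instance
proof
  show "(0 :: ('a, 'b) bounded_op) \<noteq> 1"
  proof transfer
    let ?u = "const_bcontfun 1 :: 'a \<Rightarrow>\<^sub>C 'b"
    have "apply_bcontfun ?u x \<noteq> apply_bcontfun 0 x" for x
      by (simp add: const_bcontfun.rep_eq)
    then have "?u \<noteq> 0" by metis
    then have "blinfun_apply 0 ?u \<noteq> blinfun_apply id_blinfun ?u" by simp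
    then show "(0 :: ('a \<Rightarrow>\<^sub>C 'b) \<Rightarrow>\<^sub>L ('a \<Rightarrow>\<^sub>C 'b)) \<noteq> id_blinfun" by metis
  qed
qed (transfer; auto intro!: blinfun_eqI simp: blinfun.bilinear_simps)+

end


section \<open>The semigroup of classes of idempotent matrices\<close>

text \<open>
  Elements of \<open>'a mat\<close> carry their dimensions, so the following type is the disjoint union of the sets of idempotent \<open>n \<times> n\<close> matrices over all \<open>n \<ge> 1\<close>.
\<close>

typedef (overloaded) 'a idem_mat =
  "{P :: 'a::ring_1 mat. \<exists>n\<ge>1. P \<in> carrier_mat n n \<and> P * P = P}"
  morphisms mat_of Idem
  by (rule exI[of _ "1\<^sub>m 1"]) auto

setup_lifting type_definition_idem_mat

definition sim0 :: "'a::ring_1 idem_mat \<Rightarrow> 'a idem_mat \<Rightarrow> bool"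
  where "sim0 P Q \<longleftrightarrow>
    (\<exists>A B. A \<in> carrier_mat (dim_row (mat_of P)) (dim_row (mat_of Q)) \<and>
           B \<in> carrier_mat (dim_row (mat_of Q)) (dim_row (mat_of P)) \<and>
           mat_of P = A * B \<and> mat_of Q = B * A)"

lemma mat_of_carrier: "mat_of P \<in> carrier_mat (dim_row (mat_of P)) (dim_row (mat_of P))"
  and mat_of_idem: "mat_of P * mat_of P = mat_of P"
  and mat_of_dim_pos: "dim_row (mat_of P) \<ge> 1"
  using mat_of[of P] by auto

lemma sim0I:
  assumes "mat_of P \<in> carrier_mat m m" "mat_of Q \<in> carrier_mat n n"
    and "A \<in> carrier_mat m n" "B \<in> carrier_mat n m" "mat_of P = A * B" "mat_of Q = B * A"
  shows "sim0 P Q"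
  using assms unfolding sim0_def by auto

lemma sim0E:
  assumes "sim0 P Q"
  obtains m n A B where "mat_of P \<in> carrier_mat m m" "mat_of Q \<in> carrier_mat n n"
    "A \<in> carrier_mat m n" "B \<in> carrier_mat n m" "mat_of P = A * B" "mat_of Q = B * A"
  using assms mat_of_carrier[of P] mat_of_carrier[of Q] unfolding sim0_def by metis

lemma sim0_refl: "sim0 P P"
  using sim0I[OF mat_of_carrier mat_of_carrier mat_of_carrier mat_of_carrier] mat_of_idem by metis

lemma sim0_sym: "sim0 P Q \<Longrightarrow> sim0 Q P"
  by (erule sim0E) (rule sim0I)

lemma four_factors:
  assumes "A \<in> carrier_mat m n" "B \<in> carrier_mat n m" "C \<in> carrier_mat n k" "D \<in> carrier_mat k n"
    and "(B :: 'a::ring_1 mat) * A = C * D" "(A * B) * (A * B) = A * B"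
  shows "(A * C) * (D * B) = A * B"
proof -
  note c = assms(1-4) mult_carrier_mat[OF assms(4,2)] mult_carrier_mat[OF assms(1,2)]
  have "(A * C) * (D * B) = A * (C * (D * B))"
    by (rule assoc_mult_mat[OF c(1,3,5)])
  also have "C * (D * B) = (B * A) * B"
    using assoc_mult_mat[OF c(3,4,2)] assms(5) by simp
  also have "(B * A) * B = B * (A * B)"
    by (rule assoc_mult_mat[OF c(2,1,2)])
  also have "A * (B * (A * B)) = (A * B) * (A * B)"
    by (rule assoc_mult_mat[OF c(1,2,6), symmetric])
  finally show ?thesis using assms(6) by simp
qed

lemma sim0_trans:
  assumes "sim0 P Q" "sim0 Q R"
  shows "sim0 P R"
proof -
  obtain m n A B where 1: "mat_of P \<in> carrier_mat m m" "mat_of Q \<in> carrier_mat n n"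
    "A \<in> carrier_mat m n" "B \<in> carrier_mat n m" "mat_of P = A * B" "mat_of Q = B * A"
    using assms(1) by (rule sim0E)
  obtain n' k C D where 2: "mat_of Q \<in> carrier_mat n' n'" "mat_of R \<in> carrier_mat k k"
    "C \<in> carrier_mat n' k" "D \<in> carrier_mat k n'" "mat_of Q = C * D" "mat_of R = D * C"
    using assms(2) by (rule sim0E)
  have n': "n' = n" using 1(2) 2(1) by auto
  have "(A * C) * (D * B) = A * B"
    using four_factors[of A m n B C k D] 1 2 n' mat_of_idem[of P] by simp
  moreover have "(D * B) * (A * C) = D * C"
    using four_factors[of D k n C B m A] 1 2 n' mat_of_idem[of R] by simp
  ultimately show ?thesis
    using 1 2 n' by (intro sim0I[of P m R k "A * C" "D * B"]) auto
qed

quotient_type (overloaded) 'a V_semigroup = "'a::ring_1 idem_mat" / sim0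
  by (intro equivpI reflpI sympI transpI) (blast intro: sim0_refl sim0_sym sim0_trans)+

definition diag2 :: "'a::zero mat \<Rightarrow> 'a mat \<Rightarrow> 'a mat"
  where "diag2 P Q =
    four_block_mat P (0\<^sub>m (dim_row P) (dim_col Q)) (0\<^sub>m (dim_row Q) (dim_col P)) Q"

lemma diag2_carrier:
  "A \<in> carrier_mat m n \<Longrightarrow> B \<in> carrier_mat k l \<Longrightarrow> diag2 A B \<in> carrier_mat (m + k) (n + l)"
  by (auto simp: diag2_def)

lemma diag2_mult:
  fixes A B C D :: "'a::ring_1 mat"
  assumes "A \<in> carrier_mat m n" "B \<in> carrier_mat n p" "C \<in> carrier_mat k l" "D \<in> carrier_mat l q"
  shows "diag2 A C * diag2 B D = diag2 (A * B) (C * D)"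
  using assms mult_four_block_mat[of A m n "0\<^sub>m m l" l "0\<^sub>m k n" k C B p "0\<^sub>m n q" q "0\<^sub>m l p" D]
  by (simp add: diag2_def)

lift_definition idem_sum :: "'a::ring_1 idem_mat \<Rightarrow> 'a idem_mat \<Rightarrow> 'a idem_mat" is diag2
proof -
  fix P Q :: "'a mat"
  assume "\<exists>n\<ge>1. P \<in> carrier_mat n n \<and> P * P = P" "\<exists>n\<ge>1. Q \<in> carrier_mat n n \<and> Q * Q = Q"
  then obtain m n where *: "m \<ge> 1" "P \<in> carrier_mat m m" "P * P = P"
    "n \<ge> 1" "Q \<in> carrier_mat n n" "Q * Q = Q" by auto
  show "\<exists>n\<ge>1. diag2 P Q \<in> carrier_mat n n \<and> diag2 P Q * diag2 P Q = diag2 P Q"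
    using * diag2_carrier[OF *(2,5)] diag2_mult[OF *(2,2,5,5)]
    by (intro exI[of _ "m + n"]) auto
qed

lemma sim0_idem_sum:
  assumes "sim0 P P'" "sim0 Q Q'"
  shows "sim0 (idem_sum P Q) (idem_sum P' Q')"
proof -
  obtain m n A B where 1: "mat_of P \<in> carrier_mat m m" "mat_of P' \<in> carrier_mat n n"
    "A \<in> carrier_mat m n" "B \<in> carrier_mat n m" "mat_of P = A * B" "mat_of P' = B * A"
    using assms(1) by (rule sim0E)
  obtain k l C D where 2: "mat_of Q \<in> carrier_mat k k" "mat_of Q' \<in> carrier_mat l l"
    "C \<in> carrier_mat k l" "D \<in> carrier_mat l k" "mat_of Q = C * D" "mat_of Q' = D * C"
    using assms(2) by (rule sim0E)
  show ?thesis
    using diag2_carrier[OF 1(1) 2(1)] diag2_carrier[OF 1(2) 2(2)]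
      diag2_carrier[OF 1(3) 2(3)] diag2_carrier[OF 1(4) 2(4)]
      diag2_mult[OF 1(3,4) 2(3,4)] diag2_mult[OF 1(4,3) 2(4,3)] 1(5,6) 2(5,6)
    by (intro sim0I[of _ "m + k" _ "n + l" "diag2 A C" "diag2 B D"])
       (simp_all add: idem_sum.rep_eq)
qed

lemma sim0_idem_sum_commute: "sim0 (idem_sum P Q) (idem_sum Q P)"
proof -
  obtain m where P: "mat_of P \<in> carrier_mat m m" using mat_of_carrier by blast
  obtain n where Q: "mat_of Q \<in> carrier_mat n n" using mat_of_carrier by blast
  let ?A = "four_block_mat (0\<^sub>m m n) (mat_of P) (mat_of Q) (0\<^sub>m n m)"
  let ?B = "four_block_mat (0\<^sub>m n m) (mat_of Q) (mat_of P) (0\<^sub>m m n)"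
  have z: "0\<^sub>m m n \<in> carrier_mat m n" "0\<^sub>m n m \<in> carrier_mat n m" by auto
  have "?A * ?B = diag2 (mat_of P) (mat_of Q)"
    using mult_four_block_mat[OF z(1) P Q z(2) z(2) Q P z(1)] P Q
    by (simp add: diag2_def mat_of_idem)
  moreover have "?B * ?A = diag2 (mat_of Q) (mat_of P)"
    using mult_four_block_mat[OF z(2) Q P z(1) z(1) P Q z(2)] P Q
    by (simp add: diag2_def mat_of_idem)
  moreover have "?A \<in> carrier_mat (m + n) (n + m)" "?B \<in> carrier_mat (n + m) (m + n)"
    using P Q by auto
  ultimately show ?thesis
    using diag2_carrier[OF P Q] diag2_carrier[OF Q P]
    by (intro sim0I[of _ "m + n" _ "n + m" ?A ?B]) (simp_all add: idem_sum.rep_eq)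
qed

lemma idem_sum_assoc: "idem_sum (idem_sum P Q) R = idem_sum P (idem_sum Q R)"
  unfolding mat_of_inject[symmetric] idem_sum.rep_eq diag2_def
  by (rule assoc_four_block_mat[symmetric])

instantiation V_semigroup :: (ring_1) ab_semigroup_add
begin

lift_definition plus_V_semigroup :: "'a V_semigroup \<Rightarrow> 'a V_semigroup \<Rightarrow> 'a V_semigroup"
  is idem_sum
  by (rule sim0_idem_sum)

instance
proof
  fix a b c :: "'a V_semigroup"
  show "a + b + c = a + (b + c)"
    by transfer (simp add: idem_sum_assoc sim0_refl)
  show "a + b = b + a"
    by transfer (rule sim0_idem_sum_commute)
qed

end


section \<open>The Grothendieck group of an abelian semigroup\<close>

text \<open>
  The pair \<open>(a, b)\<close> represents the formal difference of \<open>a\<close> and \<open>b\<close>. The additional summand \<open>e\<close> is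
  needed because the semigroup need not be cancellative.
\<close>

definition groth_rel :: "'a::ab_semigroup_add \<times> 'a \<Rightarrow> 'a \<times> 'a \<Rightarrow> bool"
  where "groth_rel x y \<longleftrightarrow> (\<exists>e. fst x + snd y + e = fst y + snd x + e)"

lemma groth_rel_trans:
  assumes "groth_rel x y" "groth_rel y z"
  shows "groth_rel x z"
proof -
  obtain e where e: "fst x + snd y + e = fst y + snd x + e"
    using assms(1) by (auto simp: groth_rel_def)
  obtain f where f: "fst y + snd z + f = fst z + snd y + f"
    using assms(2) by (auto simp: groth_rel_def)
  have "fst x + snd z + (fst y + snd y + e + f)
      = (fst x + snd y + e) + (fst y + snd z + f)" by (simp add: ac_simps)
  also have "\<dots> = (fst y + snd x + e) + (fst z + snd y + f)" using e f by simp
  also have "\<dots> = fst z + snd x + (fst y + snd y + e + f)" by (simp add: ac_simps)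
  finally show ?thesis unfolding groth_rel_def by blast
qed

quotient_type (overloaded) 'a grothendieck = "'a::ab_semigroup_add \<times> 'a" / groth_rel
proof (intro equivpI reflpI sympI transpI)
  fix x y :: "'a \<times> 'a"
  show "groth_rel x x" by (simp add: groth_rel_def)
  show "groth_rel x y \<Longrightarrow> groth_rel y x" by (auto simp: groth_rel_def intro: sym)
qed (rule groth_rel_trans)

instantiation grothendieck :: (ab_semigroup_add) ab_group_add
begin

text \<open>The class of \<open>(a, a)\<close> does not depend on \<open>a\<close>.\<close>

lift_definition zero_grothendieck :: "'a grothendieck" is "(undefined, undefined)" .

lift_definition plus_grothendieck :: "'a grothendieck \<Rightarrow> 'a grothendieck \<Rightarrow> 'a grothendieck"
  is "\<lambda>x y. (fst x + fst y, snd x + snd y)"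
proof -
  fix x x' y y' :: "'a \<times> 'a"
  assume "groth_rel x x'" "groth_rel y y'"
  then obtain e f where e: "fst x + snd x' + e = fst x' + snd x + e"
    and f: "fst y + snd y' + f = fst y' + snd y + f" by (auto simp: groth_rel_def)
  have "fst x + fst y + (snd x' + snd y') + (e + f)
      = (fst x + snd x' + e) + (fst y + snd y' + f)" by (simp add: ac_simps)
  also have "\<dots> = fst x' + fst y' + (snd x + snd y) + (e + f)"
    unfolding e f by (simp add: ac_simps)
  finally show "groth_rel (fst x + fst y, snd x + snd y) (fst x' + fst y', snd x' + snd y')"
    unfolding groth_rel_def by auto
qed

lift_definition uminus_grothendieck :: "'a grothendieck \<Rightarrow> 'a grothendieck"
  is "\<lambda>x. (snd x, fst x)"
  by (auto simp: groth_rel_def ac_simps) (metis add.assoc add.commute)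

definition minus_grothendieck :: "'a grothendieck \<Rightarrow> 'a grothendieck \<Rightarrow> 'a grothendieck"
  where "minus_grothendieck a b = a + (- b)"

instance
proof
  fix a b c :: "'a grothendieck"
  show "a + b + c = a + (b + c)"
    by transfer (simp add: groth_rel_def ac_simps)
  show "a + b = b + a"
    by transfer (simp add: groth_rel_def ac_simps)
  show "0 + a = a"
    by transfer (auto simp: groth_rel_def ac_simps)
  show "- a + a = 0"
    by transfer (auto simp: groth_rel_def ac_simps)
  show "a - b = a + - b"
    by (rule minus_grothendieck_def)
qed

end

type_synonym 'a K0 = "'a V_semigroup grothendieck"

definition add_iso :: "('a::ab_group_add \<Rightarrow> 'b::ab_group_add) \<Rightarrow> bool"
  where "add_iso \<phi> \<longleftrightarrow> bij \<phi> \<and> (\<forall>x y. \<phi> (x + y) = \<phi> x + \<phi> y)"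

end

(*
  Write X for C([0,w1]). For every operator T on X there are a scalar c and a club D such that
  (Tf)(a) - (Tf)(w1) = c (f(a) - f(w1)) for all f and all a in D, and T |-> c is a unital character
  phi of B(X). After conjugating with an isomorphism of X onto {f. f(0) = f(w1) = 0}, finitely
  many operators in the kernel of phi take their values in the functions vanishing on one common
  club D, which is the range of the idempotent e f = f - f o r with r(x) = min {d : D. x <= d}.

  The range of e is the c_0-sum of the spaces C_0 of the gaps of D. Rearranging [0,w1] so that
  every gap is repeated infinitely often gives an Eilenberg swindle, so idempotent matrices over
  e B(X) e vanish in K_0. An idempotent matrix P over B(X) and its scalar matrix phi(P) agree up
  to the kernel of phi; with respect to such an e both are triangular with the same lower
  diagonal block, hence [P] = [phi(P)] is a multiple of [1], and the trace of phi(P) shows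
  that [1] has infinite order.
*)
theory Submission
  imports Defs "HOL-Library.Countable_Set_Type" "Jordan_Normal_Form.Determinant"
begin

section \<open>The ordinal interval\<close>

text \<open>The kernel of the character has no unit, so no single idempotent can absorb it. A matrix
  has only finitely many entries, however, and clubs are stable under finite intersections; hence
  one \<open>e\<close> serves a whole matrix, although it changes from matrix to matrix. Acting as
  the scalar 0 on a club only makes \<open>T f\<close> there equal to its value at
  \<open>omega1\<close>, not to 0. The change to functions vanishing at \<open>omega1\<close>
  repairs this. They also vanish at the least point so that this point can be put into the club,
  without which rounding down to the club would not always be possible. The swindle needs infinitely
  many copies of the gaps within one interval of the same type. Repeating each block \<omega> times
  on the spot keeps initial segments countable, so the new order again has type
  \<open>omega1\<close>. A continuous function oscillates noticeably on finitely many copies only,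
  which is why the infinite sums of operators converge. Idempotents need not commute with
  \<open>e\<close>; triangularity is enough, and it passes from scalar matrices to all others
  because multiplying by \<open>1 - e\<close> removes the difference.\<close>

abbreviation omega1 :: omega1_interval
  where "omega1 \<equiv> Segment (Field (cardSuc natLeq))"

lemma segment_of_omega1: "segment_of omega1 = Field (cardSuc natLeq)"
  by (rule Segment_inverse) (simp add: wo_rel.Field_ofilter[OF wo_rel_omega1])

lemma not_less_omega1_iff [simp]: "\<not> x < omega1 \<longleftrightarrow> x = omega1"
  using Field_omega1_max[of x] by auto

lemma omega1_le_iff [simp]: "omega1 \<le> x \<longleftrightarrow> x = omega1"
  using Field_omega1_max[of x] by auto

lemma uncountable_Field_omega1:
  includes cardinal_syntax
  shows "uncountable (Field (cardSuc natLeq))"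
proof
  assume "countable (Field (cardSuc natLeq))"
  then have "|Field (cardSuc natLeq)| \<le>o natLeq"
    by (simp add: countable_card_le_natLeq)
  moreover have "|Field (cardSuc natLeq)| =o cardSuc natLeq"
    by (rule card_of_Field_ordIso[OF cardSuc_Card_order[OF natLeq_Card_order]])
  ultimately have "cardSuc natLeq \<le>o natLeq"
    using ordIso_ordLeq_trans ordIso_symmetric by blast
  then show False
    using cardSuc_greater[OF natLeq_Card_order] not_ordLess_ordLeq by blast
qed

lemma countable_underS_omega1:
  includes cardinal_syntax
  shows "countable (underS (cardSuc natLeq) a)"
proof (cases "a \<in> Field (cardSuc natLeq)")
  case True
  have "|underS (cardSuc natLeq) a| <o cardSuc natLeq"
    by (rule card_of_underS[OF cardSuc_Card_order[OF natLeq_Card_order] True])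
  then have "|underS (cardSuc natLeq) a| \<le>o natLeq"
    using cardSuc_ordLeq_ordLess[OF natLeq_Card_order card_of_Card_order] by blast
  then show ?thesis
    by (simp add: countable_card_le_natLeq)
next
  case False
  then have "underS (cardSuc natLeq) a = {}"
    unfolding underS_def Field_def by blast
  then show ?thesis by simp
qed

lemma total_omega1:
  "\<lbrakk>a \<in> Field (cardSuc natLeq); b \<in> Field (cardSuc natLeq)\<rbrakk> \<Longrightarrow>
    (a, b) \<in> cardSuc natLeq \<or> (b, a) \<in> cardSuc natLeq"
  using wo_rel.TOTALS[OF wo_rel_omega1] by simp

lemma segment_cases:
  obtains "x = omega1" | a where "a \<in> Field (cardSuc natLeq)" "segment_of x = underS (cardSuc natLeq) a"
proof -
  have "ofilter (cardSuc natLeq) (segment_of x)" using segment_of by auto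
  then have "segment_of x = Field (cardSuc natLeq) \<or> (\<exists>a\<in>Field (cardSuc natLeq). segment_of x = underS (cardSuc natLeq) a)"
    using wo_rel.ofilter_underS_Field[OF wo_rel_omega1] by auto
  then show ?thesis
    using that segment_of_omega1 segment_of_inject by metis
qed

text \<open>A point below \<open>x\<close> is itself \<open>underS\<close> of some \<open>b\<close>,
  and inclusion of the segments forces \<open>b\<close> into the countable set
  \<open>segment_of x\<close>.\<close>

lemma countable_atMost_omega1:
  assumes "x < omega1" shows "countable {..x}"
proof -
  let ?r = "cardSuc natLeq"
  obtain a where a: "segment_of x = underS ?r a"
    using assms by (cases x rule: segment_cases) auto
  have "{..<x} \<subseteq> (\<lambda>b. Segment (underS ?r b)) ` segment_of x"
  proof
    fix y assume y: "y \<in> {..<x}"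
    then have sub: "segment_of y \<subset> segment_of x" by (simp add: less_omega1_interval.rep_eq)
    have "y < omega1" using y assms by auto
    then obtain b where b: "b \<in> Field ?r" "segment_of y = underS ?r b"
      by (cases y rule: segment_cases) auto
    have "b \<in> segment_of x"
    proof (rule ccontr)
      assume nb: "b \<notin> segment_of x"
      obtain c where c: "c \<in> segment_of x" "c \<notin> segment_of y" using sub by auto
      have of: "ofilter ?r (segment_of x)" using segment_of by auto
      have "c \<in> Field ?r" using of c by (auto simp: ofilter_def)
      then have "(b, c) \<in> ?r"
        using c(2) b total_omega1[of b c] unfolding underS_def by auto
      then have "b \<in> segment_of x" using of c(1) by (auto simp: ofilter_def under_def)
      then show False using nb by simp
    qed
    then show "y \<in> (\<lambda>b. Segment (underS ?r b)) ` segment_of x"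
      using b(2) segment_of_inverse[of y] by (auto simp: image_iff intro!: bexI[of _ b])
  qed
  then have "countable {..<x}"
    by (rule countable_subset) (simp add: a countable_underS_omega1)
  moreover have "{..x} = insert x {..<x}" by auto
  ultimately show ?thesis by simp
qed

lemma uncountable_lessThan_omega1: "uncountable {..<omega1}"
proof
  assume *: "countable {..<omega1}"
  define r where "r = cardSuc natLeq"
  define f where "f a = Segment (underS r a)" for a
  have seg: "segment_of (f a) = underS r a" for a
    unfolding f_def r_def
    by (rule Segment_inverse) (simp add: wo_rel.underS_ofilter[OF wo_rel_omega1])
  have "f ` Field r \<subseteq> {..<omega1}"
  proof
    fix y assume "y \<in> f ` Field r"
    then obtain a where a: "a \<in> Field r" "y = f a" by blast
    have "a \<notin> segment_of y" unfolding a(2) seg by (simp add: underS_def)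
    then have "y \<noteq> omega1"
      using a(1) segment_of_omega1 unfolding r_def by metis
    then show "y \<in> {..<omega1}" using not_less_omega1_iff[of y] by blast
  qed
  then have c: "countable (f ` Field r)" using * countable_subset by blast
  have inj: "inj_on f (Field r)"
  proof (rule inj_onI)
    fix a b assume ab: "a \<in> Field r" "b \<in> Field r" "f a = f b"
    then have "underS r a = underS r b" using seg[of a] seg[of b] by simp
    then have 1: "a \<notin> underS r b" and 2: "b \<notin> underS r a" by (auto simp: underS_def)
    have 3: "(a, b) \<in> r \<or> (b, a) \<in> r" using ab(1,2) unfolding r_def by (rule total_omega1)
    show "a = b"
    proof (rule ccontr)
      assume "a \<noteq> b"
      then have "(a, b) \<notin> r" "(b, a) \<notin> r" using 1 2 by (simp_all add: underS_def)
      then show False using 3 by simp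
    qed
  qed
  have "countable (Field r)" by (rule countable_image_inj_on[OF c inj])
  then show False using uncountable_Field_omega1 by (simp add: r_def)
qed

text \<open>Uncountable cofinality of \<open>omega1\<close>: countably many countable initial
  segments cannot cover the uncountable set below it. Every passage from countably many bounds to a
  single one rests on this.\<close>

lemma countable_bound_omega1:
  assumes "countable S" "\<And>x. x \<in> S \<Longrightarrow> x < omega1"
  obtains b where "b < omega1" "\<And>x. x \<in> S \<Longrightarrow> x < b"
proof -
  have "countable (\<Union>x\<in>S. {..x})"
    using assms countable_atMost_omega1 by (intro countable_UN) auto
  then have "\<not> {..<omega1} \<subseteq> (\<Union>x\<in>S. {..x})"
    using uncountable_lessThan_omega1 countable_subset by blast
  then obtain b where "b < omega1" "b \<notin> (\<Union>x\<in>S. {..x})" by blast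
  then have "\<And>x. x \<in> S \<Longrightarrow> x < b" by (meson UN_I atMost_iff not_le)
  with \<open>b < omega1\<close> show ?thesis by (rule that)
qed

lemma bound_omega1:
  assumes "x < omega1" obtains b where "b < omega1" "x < b"
proof -
  obtain b where "b < omega1" "\<And>y. y \<in> {x} \<Longrightarrow> y < b"
    by (rule countable_bound_omega1[of "{x}"]) (use assms in auto)
  then show ?thesis by (intro that[of b]) auto
qed

lemma bound2_omega1:
  assumes "x < omega1" "y < omega1" obtains b where "b < omega1" "x < b" "y < b"
proof -
  obtain b where "b < omega1" "\<And>z. z \<in> {x, y} \<Longrightarrow> z < b"
    by (rule countable_bound_omega1[of "{x, y}"]) (use assms in auto)
  then show ?thesis by (intro that[of b]) auto
qed

section \<open>Topology of a well-ordered interval\<close>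

lemma downward_closed_cases:
  fixes S :: "'a::wellorder set"
  assumes "\<And>x y. x \<in> S \<Longrightarrow> y \<le> x \<Longrightarrow> y \<in> S"
  obtains "S = UNIV" | z where "S = {..<z}"
proof (cases "S = UNIV")
  case False
  then obtain w where w: "w \<notin> S" by auto
  define z where "z = (LEAST z. z \<notin> S)"
  have "z \<notin> S" unfolding z_def using w by (rule LeastI)
  moreover have "y < z \<Longrightarrow> y \<in> S" for y unfolding z_def using not_less_Least by blast
  ultimately have "y \<in> S \<longleftrightarrow> y < z" for y using assms[of y z] by (meson not_le)
  then have "S = {..<z}" by blast
  then show thesis by (rule that(2))
qed

text \<open>A proper initial segment is the ray below its least missing point. In particular
  \<open>{..x}\<close> is clopen, the source of the continuous step functions.\<close>

lemma open_downward_closed: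
  fixes S :: "'a::{wellorder,linorder_topology} set"
  assumes "\<And>x y. x \<in> S \<Longrightarrow> y \<le> x \<Longrightarrow> y \<in> S"
  shows "open S"
  using assms by (cases rule: downward_closed_cases[of S]) auto

lemma open_atMost_wellorder: "open {..x :: 'a::{wellorder,linorder_topology}}"
  by (rule open_downward_closed) auto

text \<open>Preimages of lower rays under a monotone map are initial segments, hence open, so only
  upper rays need checking. In most applications these are read off from an adjunction between two
  monotone maps.\<close>

lemma mono_continuous_wellorder:
  fixes f :: "'a::{wellorder,linorder_topology} \<Rightarrow> 'b::linorder_topology"
  assumes mono: "\<And>x y. x \<le> y \<Longrightarrow> f x \<le> f y" and "\<And>a. open {y. a < f y}"
  shows "continuous_on UNIV f"
proof -
  have 1: "open (f -` {..<a})" for a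
    using mono by (intro open_downward_closed) (auto dest: le_less_trans)
  have 2: "open (f -` {a<..})" for a
    using assms(2)[of a] by (simp add: vimage_def)
  have "open (f -` B)" if "open B" for B
  proof -
    have "generate_topology (range (\<lambda>a. {..<a}) \<union> range (\<lambda>a. {a<..})) B"
      using that by (simp add: open_generated_order)
    then show ?thesis
    proof induction
      case UNIV show ?case by simp
    next
      case (Int a b) then show ?case by (auto simp: vimage_Int)
    next
      case (UN K)
      have "f -` \<Union>K = (\<Union>k\<in>K. f -` k)" by auto
      then show ?case using UN by auto
    next
      case (Basis s) then show ?case using 1 2 by auto
    qed
  qed
  then show ?thesis by (simp add: continuous_on_open_vimage)
qed

text \<open>The supremum exists by well-foundedness and is the limit; it stays below
  \<open>omega1\<close> by uncountable cofinality.\<close>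

lemma strict_mono_seq_limit_omega1:
  fixes x :: "nat \<Rightarrow> omega1_interval"
  assumes mono: "\<And>n. x n < x (Suc n)"
  shows "\<exists>z. x \<longlonglongrightarrow> z \<and> (\<forall>n. x n < z) \<and> (\<forall>b. (\<forall>n. x n \<le> b) \<longrightarrow> z \<le> b) \<and>
    ((\<forall>n. x n < omega1) \<longrightarrow> z < omega1)"
proof -
  define z where "z = (LEAST z. \<forall>n. x n \<le> z)"
  have "\<exists>z. \<forall>n. x n \<le> z" using Field_omega1_max by blast
  then have ub: "\<forall>n. x n \<le> z" unfolding z_def by (rule LeastI_ex)
  have least: "z \<le> b" if "\<And>n. x n \<le> b" for b unfolding z_def using that by (intro Least_le) auto
  have lt: "x n < z" for n using mono[of n] ub by (meson less_le_trans)
  have sm: "strict_mono x" using mono by (rule strict_mono_Suc_iff[THEN iffD2, rule_format])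
  have "x \<longlonglongrightarrow> z"
  proof (rule order_tendstoI)
    fix a assume "a < z"
    then obtain N where "a < x N" using least[of a] by (meson not_le)
    then have "a < x n" if "n \<ge> N" for n
      using that sm by (meson less_le_trans strict_mono_less_eq)
    then show "\<forall>\<^sub>F n in sequentially. a < x n" by (auto simp: eventually_sequentially)
  next
    fix a assume "z < a"
    then have "x n < a" for n using lt[of n] by (rule less_trans[rotated])
    then show "\<forall>\<^sub>F n in sequentially. x n < a" by simp
  qed
  moreover have "z < omega1" if *: "\<forall>n. x n < omega1"
  proof -
    obtain b where "b < omega1" "\<And>y. y \<in> range x \<Longrightarrow> y < b"
      by (rule countable_bound_omega1[of "range x"]) (use * in auto)
    then show ?thesis using least[of b] le_less_trans[of z b omega1] by (simp add: less_imp_le)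
  qed
  ultimately show ?thesis using lt least by blast
qed

text \<open>A case distinction, because the least point has no left neighbourhood.\<close>

lemma continuous_left:
  fixes f :: "omega1_interval \<Rightarrow> 'b::metric_space"
  assumes "continuous_on UNIV f" "0 < e"
  obtains "\<And>y. x \<le> y" | y where "y < x" "\<And>z. y < z \<Longrightarrow> z \<le> x \<Longrightarrow> dist (f z) (f x) < e"
proof (cases "\<exists>y. y < x")
  case True
  then obtain w where w: "w < x" by blast
  let ?S = "f -` ball (f x) e"
  have "open ?S" using assms(1) by (auto simp: continuous_on_open_vimage)
  moreover have "x \<in> ?S" using assms(2) by simp
  ultimately obtain y where "y < x" "{y<..x} \<subseteq> ?S" using open_left[of ?S x w] w by blast
  then show ?thesis by (intro that(2)[of y]) (auto simp: subset_iff dist_commute)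
qed (intro that(1), meson not_less)

section \<open>Operators and step functions\<close>

lemma scale_bcontfun_of_real:
  "scale_bcontfun (of_real r) (f :: 'x::topological_space \<Rightarrow>\<^sub>C 'k::real_normed_field) = r *\<^sub>R f"
  by (rule bcontfun_eqI) (simp add: scale_bcontfun_rep_eq scaleR_conv_of_real)

lemma norm_scale_bcontfun_le:
  "norm (scale_bcontfun c (f :: 'x::topological_space \<Rightarrow>\<^sub>C 'k::real_normed_field)) \<le> norm c * norm f"
  by (rule norm_bound) (auto simp: scale_bcontfun_rep_eq norm_mult intro!: mult_left_mono norm_bounded)

abbreviation app :: "('x::topological_space, 'k::real_normed_field) bounded_op \<Rightarrow> ('x \<Rightarrow>\<^sub>C 'k) \<Rightarrow> 'x \<Rightarrow>\<^sub>C 'k"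
  where "app T f \<equiv> blinfun_apply (blinfun_of T) f"

lemma app_scale: "app T (scale_bcontfun c f) = scale_bcontfun c (app T f)"
  using blinfun_of[of T] by simp

lemma app_times [simp]: "app (S * T) f = app S (app T f)"
  by (simp add: times_bounded_op.rep_eq)

lemma app_plus [simp]: "app (S + T) f = app S f + app T f"
  by (simp add: plus_bounded_op.rep_eq blinfun.add_left)

lemma app_minus [simp]: "app (S - T) f = app S f - app T f"
  by (simp add: minus_bounded_op.rep_eq blinfun.diff_left)

lemma app_one [simp]: "app 1 f = f"
  by (simp add: one_bounded_op.rep_eq)

lemma app_zero [simp]: "app 0 f = 0"
  by (simp add: zero_bounded_op.rep_eq)

lemma bounded_op_eqI: "(\<And>f. app S f = app T f) \<Longrightarrow> S = T"
  unfolding blinfun_of_inject[symmetric] by (rule blinfun_eqI)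

lemma norm_app: "norm (app T f) \<le> norm (blinfun_of T) * norm f"
  by (rule norm_blinfun)

text \<open>Meaningful only for bounded scalar-linear \<open>F\<close>; \<open>app_Op\<close>
  settles this once for each operator.\<close>

definition Op :: "(('x::topological_space \<Rightarrow>\<^sub>C 'k::real_normed_field) \<Rightarrow> ('x \<Rightarrow>\<^sub>C 'k)) \<Rightarrow> ('x, 'k) bounded_op"
  where "Op F = Bounded_op (Blinfun F)"

lemma app_Op:
  fixes F :: "('x::topological_space \<Rightarrow>\<^sub>C 'k::real_normed_field) \<Rightarrow> ('x \<Rightarrow>\<^sub>C 'k)"
  assumes add: "\<And>f g. F (f + g) = F f + F g"
    and scale: "\<And>c f. F (scale_bcontfun c f) = scale_bcontfun c (F f)"
    and bound: "\<And>f. norm (F f) \<le> norm f * C"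
  shows "app (Op F) f = F f"
proof -
  have "bounded_linear F"
    using add scale[of "of_real _"] bound
    by (intro bounded_linear_intro[where K = C]) (simp_all add: scale_bcontfun_of_real)
  then have F: "blinfun_apply (Blinfun F) = F" by (rule bounded_linear_Blinfun_apply)
  then have "blinfun_of (Op F) = Blinfun F"
    unfolding Op_def using scale by (intro Bounded_op_inverse) simp
  then show ?thesis by (simp add: F)
qed

definition comp_op :: "('x \<Rightarrow> 'x) \<Rightarrow> ('x::topological_space, 'k::real_normed_field) bounded_op"
  where "comp_op b = Op (\<lambda>f. Bcontfun (\<lambda>x. f (b x)))"

lemma app_comp_op [simp]:
  fixes f :: "'x::topological_space \<Rightarrow>\<^sub>C 'k::real_normed_field"
  assumes "continuous_on UNIV b"
  shows "apply_bcontfun (app (comp_op b) f) x = f (b x)"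
proof -
  have "(\<lambda>x. g (b x)) \<in> bcontfun" for g :: "'x \<Rightarrow>\<^sub>C 'k"
  proof (rule bcontfun_normI)
    show "continuous_on UNIV (\<lambda>x. g (b x))"
      using assms by (rule continuous_on_compose2[OF continuous_on_apply_bcontfun[of UNIV]]) simp
    show "norm (g (b x)) \<le> norm g" for x by (rule norm_bounded)
  qed
  then have eq: "apply_bcontfun (Bcontfun (\<lambda>x. g (b x))) = (\<lambda>x. g (b x))" for g :: "'x \<Rightarrow>\<^sub>C 'k"
    by (rule Bcontfun_inverse)
  define G where "G g = Bcontfun (\<lambda>x. g (b x))" for g :: "'x \<Rightarrow>\<^sub>C 'k"
  have G: "apply_bcontfun (G g) x = g (b x)" for g x
    unfolding G_def eq ..
  have "app (Op G) f = G f"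
  proof (rule app_Op[where C = 1])
    show "norm (G g) \<le> norm g * 1" for g
      by (rule norm_bound) (simp add: G norm_bounded)
  qed (auto intro!: bcontfun_eqI simp: G scale_bcontfun_rep_eq)
  moreover have "comp_op b = Op G"
    unfolding comp_op_def G_def ..
  ultimately show ?thesis by (simp add: G)
qed

definition rank1_op :: "'x \<Rightarrow> ('x \<Rightarrow>\<^sub>C 'k) \<Rightarrow> ('x::topological_space, 'k::real_normed_field) bounded_op"
  where "rank1_op x g = Op (\<lambda>f. scale_bcontfun (f x) g)"

lemma app_rank1_op [simp]: "app (rank1_op x g) f = scale_bcontfun (f x) g"
  unfolding rank1_op_def
proof (rule app_Op[where C = "norm g"])
  show "norm (scale_bcontfun (h x) g) \<le> norm h * norm g" for h :: "'a \<Rightarrow>\<^sub>C 'b"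
    using mult_right_mono[OF norm_bounded[of h x] norm_ge_zero[of g]]
    by (rule order_trans[OF norm_scale_bcontfun_le])
qed (auto intro!: bcontfun_eqI simp: scale_bcontfun_rep_eq algebra_simps)

definition scalar_op :: "'k \<Rightarrow> ('x::topological_space, 'k::real_normed_field) bounded_op"
  where "scalar_op c = Op (scale_bcontfun c)"

lemma app_scalar_op [simp]: "app (scalar_op c) f = scale_bcontfun c f"
  unfolding scalar_op_def
  by (rule app_Op[where C = "norm c"])
    (auto intro!: bcontfun_eqI norm_scale_bcontfun_le[THEN order_trans]
      simp: scale_bcontfun_rep_eq algebra_simps)

lemma bounded_op_eqI': "(\<And>f x. apply_bcontfun (app S f) x = apply_bcontfun (app T f) x) \<Longrightarrow> S = T"
  by (intro bounded_op_eqI bcontfun_eqI)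

lemma scalar_op_simps:
  "scalar_op 0 = 0" "scalar_op 1 = 1" "scalar_op (c + d) = scalar_op c + scalar_op d"
  "scalar_op (c * d) = scalar_op c * scalar_op d"
  by (auto intro!: bounded_op_eqI' simp: scale_bcontfun_rep_eq algebra_simps)

definition step :: "omega1_interval \<Rightarrow> omega1_interval \<Rightarrow>\<^sub>C 'k::real_normed_field"
  where "step b = Bcontfun (indicator {..b})"

lemma step_apply: "apply_bcontfun (step b) x = (if x \<le> b then 1 else 0 :: 'k::real_normed_field)"
proof -
  have "continuous_on UNIV (indicator {..b} :: _ \<Rightarrow> 'k)"
  proof -
    have "(indicator {..b} :: _ \<Rightarrow> 'k) -` B =
      (if 1 \<in> B then {..b} else {}) \<union> (if 0 \<in> B then {b<..} else {})" for B
      by (auto simp: indicator_def of_bool_def split: if_splits)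
    then show ?thesis by (simp add: continuous_on_open_vimage open_Un open_atMost_wellorder)
  qed
  then have "indicator {..b} \<in> (bcontfun :: (omega1_interval \<Rightarrow> 'k) set)"
    by (simp add: bcontfun_omega1_interval)
  then show ?thesis by (simp add: step_def Bcontfun_inverse indicator_def)
qed

text \<open>
  By transfinite induction on \<open>x\<close>, the product of \<open>f\<close> and the indicator of \<open>{..x}\<close> has the property:
  left of \<open>x\<close>, \<open>f\<close> is nearly constant on some \<open>{y<..x}\<close>.
\<close>
lemma step_induct [case_names step add scale limit]:
  fixes f :: "omega1_interval \<Rightarrow>\<^sub>C 'k::real_normed_field"
  assumes step: "\<And>b. P (step b)"
    and add: "\<And>f g. P f \<Longrightarrow> P g \<Longrightarrow> P (f + g)"
    and scale: "\<And>c f. P f \<Longrightarrow> P (scale_bcontfun c f)"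
    and limit: "\<And>f. (\<And>e. e > 0 \<Longrightarrow> \<exists>g. P g \<and> norm (f - g) \<le> e) \<Longrightarrow> P f"
  shows "P f"
proof -
  have bcf: "(\<lambda>z. f z * step x z) \<in> bcontfun" for x
    unfolding bcontfun_omega1_interval by (auto intro!: continuous_intros)
  define cut where "cut x = Bcontfun (\<lambda>z. f z * step x z)" for x
  have "cut x z = f z * step x z" for x z
    unfolding cut_def Bcontfun_inverse[OF bcf] ..
  then have cut: "cut x z = (if z \<le> x then f z else 0)" for x z
    by (simp add: step_apply)
  have "P (cut x)" for x
  proof (induction x rule: less_induct)
    case (less x)
    show ?case
    proof (rule limit)
      fix e :: real assume e: "e > 0"
      show "\<exists>g. P g \<and> norm (cut x - g) \<le> e"
      proof (rule continuous_left[of "apply_bcontfun f" e x])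
        assume x: "\<And>y. x \<le> y"
        have "cut x = scale_bcontfun (f x) (step x)"
        proof (rule bcontfun_eqI)
          fix z show "cut x z = scale_bcontfun (f x) (step x) z"
            using x[of z] by (cases "z = x") (auto simp: cut scale_bcontfun_rep_eq step_apply)
        qed
        then show ?thesis using scale[OF step, of "f x" x] e by (intro exI[of _ "cut x"]) simp
      next
        fix y assume y: "y < x" "\<And>z. y < z \<Longrightarrow> z \<le> x \<Longrightarrow> dist (f z) (f x) < e"
        \<comment> \<open>\<open>?g\<close> equals \<open>f\<close> up to \<open>y\<close>, the
          constant \<open>f x\<close> on \<open>{y<..x}\<close> and 0 above; the last summand
          removes the constant from \<open>{..y}\<close>.\<close>
        let ?g = "cut y + scale_bcontfun (f x) (step x) + scale_bcontfun (- f x) (step y)"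
        have "norm ((cut x - ?g) z) \<le> e" for z
          using y(1) y(2)[of z] e
          by (cases "z \<le> y"; cases "z \<le> x") (auto simp: not_le less_imp_le cut scale_bcontfun_rep_eq step_apply dist_norm)
        then have "norm (cut x - ?g) \<le> e" by (rule norm_bound)
        moreover have "P ?g" using less.IH[OF y(1)] by (intro add scale step)
        ultimately show ?thesis by blast
      qed (use e in auto)
    qed
  qed
  moreover have "cut omega1 = f"
    by (rule bcontfun_eqI) (simp add: cut Field_omega1_max)
  ultimately show ?thesis by metis
qed

section \<open>Eventual constancy below \<open>omega1\<close>\<close>

lemma exists_less_omega1: "\<exists>x. x < omega1"
  using uncountable_lessThan_omega1 by (metis countable_empty lessThan_iff subset_empty subsetI)

text \<open>Both sequences converge to the same supremum, so continuity makes the distances tend to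
  0.\<close>

lemma interleaved_dist_small:
  fixes f :: "omega1_interval \<Rightarrow> 'b::metric_space"
  assumes f: "continuous_on UNIV f" and xy: "\<And>n. x n < y n \<and> y n < x (Suc n)" and e: "e > 0"
  shows "\<exists>n::nat. dist (f (x n)) (f (y n)) < e"
proof -
  have "x n < x (Suc n)" for n using xy[of n] by (auto intro: less_trans)
  then obtain z where z: "x \<longlonglongrightarrow> z" using strict_mono_seq_limit_omega1 by blast
  have "y \<longlonglongrightarrow> z"
  proof (rule tendsto_sandwich[OF _ _ z])
    show "(\<lambda>n. x (Suc n)) \<longlonglongrightarrow> z" using z by (rule LIMSEQ_Suc)
  qed (use xy in \<open>auto simp: less_imp_le\<close>)
  then have "(\<lambda>n. dist (f (x n)) (f (y n))) \<longlonglongrightarrow> dist (f z) (f z)"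
    using z f by (intro tendsto_dist continuous_on_tendsto_compose[OF f]) auto
  then have "\<forall>\<^sub>F n in sequentially. dist (f (x n)) (f (y n)) < e"
    using e by (intro order_tendstoD) auto
  then show ?thesis using eventually_happens' sequentially_bot by blast
qed

text \<open>If the claim fails beyond every \<open>g\<close>, restarting each time at the larger
  point of the previous bad pair gives interleaved sequences with all distances at least
  \<open>e\<close>.\<close>

lemma eventually_small_oscillation:
  fixes h :: "omega1_interval \<Rightarrow> 'b::metric_space"
  assumes below: "\<And>d. d \<in> D \<Longrightarrow> d < omega1" and e: "e > 0"
    and osc: "\<And>x y. (\<And>n::nat. x n \<in> D \<and> y n \<in> D \<and> x n < y n \<and> y n < x (Suc n)) \<Longrightarrow>
      \<exists>n. dist (h (x n)) (h (y n)) < (e::real)"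
  shows "\<exists>g<omega1. \<forall>x\<in>D. \<forall>y\<in>D. g < x \<longrightarrow> x < y \<longrightarrow> dist (h x) (h y) < e"
proof (rule ccontr)
  assume neg: "\<not> ?thesis"
  define Q where "Q g x y \<longleftrightarrow> x \<in> D \<and> y \<in> D \<and> g < x \<and> x < y \<and> \<not> dist (h x) (h y) < e" for g x y
  have "\<exists>x y. Q g x y" if "g < omega1" for g
    unfolding Q_def using neg that by blast
  then obtain x y where p: "\<And>g. g < omega1 \<Longrightarrow> Q g (x g) (y g)"
    by metis
  obtain g0 where g0: "g0 < omega1" using exists_less_omega1 by blast
  define s where "s n = (y ^^ n) g0" for n
  have lt: "s n < omega1" for n
  proof (induction n)
    case (Suc n)
    have "y (s n) \<in> D" using p[OF Suc.IH] unfolding Q_def by blast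
    then show ?case using below by (simp add: s_def)
  qed (simp add: s_def g0)
  have "\<exists>n. dist (h (x (s n))) (h (y (s n))) < e"
  proof (rule osc[where x = "\<lambda>n. x (s n)" and y = "\<lambda>n. y (s n)"])
    fix n
    have "s (Suc n) = y (s n)" by (simp add: s_def)
    then show "x (s n) \<in> D \<and> y (s n) \<in> D \<and> x (s n) < y (s n) \<and> y (s n) < x (s (Suc n))"
      using p[OF lt[of n]] p[OF lt[of "Suc n"]] unfolding Q_def by simp
  qed
  then show False using p[OF lt] unfolding Q_def by blast
qed

text \<open>The bounds for the tolerances \<open>1 / (k + 1)\<close> are countably many, so one
  \<open>g\<close> exceeds them all and beyond it the distances vanish. The oscillation hypothesis
  is abstract because it is verified in three ways: for continuous functions, for the rows of an
  operator and for its diagonal.\<close>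

lemma eventually_constant_on:
  fixes h :: "omega1_interval \<Rightarrow> 'b::metric_space"
  assumes below: "\<And>d. d \<in> D \<Longrightarrow> d < omega1"
    and osc: "\<And>e x y. e > 0 \<Longrightarrow> (\<And>n::nat. x n \<in> D \<and> y n \<in> D \<and> x n < y n \<and> y n < x (Suc n)) \<Longrightarrow>
      \<exists>n. dist (h (x n)) (h (y n)) < (e::real)"
  shows "\<exists>g<omega1. \<forall>x\<in>D. \<forall>y\<in>D. g < x \<longrightarrow> g < y \<longrightarrow> h x = h y"
proof -
  define R where "R k g \<longleftrightarrow> g < omega1 \<and>
    (\<forall>x\<in>D. \<forall>y\<in>D. g < x \<longrightarrow> x < y \<longrightarrow> dist (h x) (h y) < inverse (real (Suc k)))" for k g
  have "\<exists>g. R k g" for k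
    unfolding R_def
  proof (rule eventually_small_oscillation[OF below])
    show *: "0 < inverse (real (Suc k))" by simp
    show "\<exists>n. dist (h (x n)) (h (y n)) < inverse (real (Suc k))"
      if "\<And>n. x n \<in> D \<and> y n \<in> D \<and> x n < y n \<and> y n < x (Suc n)" for x y
      using * that by (rule osc)
  qed
  then obtain G where RG: "\<And>k. R k (G k)" by metis
  have G1: "G k < omega1" for k using RG[of k] unfolding R_def by blast
  have G2: "dist (h x) (h y) < inverse (real (Suc k))"
    if "x \<in> D" "y \<in> D" "G k < x" "x < y" for k x y
    using RG[of k] that unfolding R_def by blast
  obtain g where g: "g < omega1" "\<And>x. x \<in> range G \<Longrightarrow> x < g"
    by (rule countable_bound_omega1[of "range G"]) (use G1 in auto)
  have eq: "h x = h y" if "x \<in> D" "y \<in> D" "g < x" "x < y" for x y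
  proof (rule ccontr)
    assume "h x \<noteq> h y"
    then obtain k where k: "inverse (real (Suc k)) < dist (h x) (h y)"
      using reals_Archimedean[of "dist (h x) (h y)"] by auto
    have "G k < x" using g(2)[of "G k"] that(3) by (auto intro: less_trans)
    then show False using G2[OF that(1,2) _ that(4), of k] k by simp
  qed
  have "h x = h y" if "x \<in> D" "y \<in> D" "g < x" "g < y" for x y
    using eq[OF that(1,2,3)] eq[OF that(2,1,4), symmetric] by (cases x y rule: linorder_cases) blast+
  then show ?thesis using g(1) by blast
qed

text \<open>The general principle gives a constant value on a tail below \<open>omega1\<close>; left
  continuity at \<open>omega1\<close> identifies it.\<close>

lemma continuous_eventually_constant:
  fixes f :: "omega1_interval \<Rightarrow> 'b::metric_space"
  assumes f: "continuous_on UNIV f"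
  shows "\<exists>g<omega1. \<forall>x>g. f x = f omega1"
proof -
  have "\<exists>g<omega1. \<forall>x\<in>{..<omega1}. \<forall>y\<in>{..<omega1}. g < x \<longrightarrow> g < y \<longrightarrow> f x = f y"
  proof (rule eventually_constant_on)
    fix e :: real and x y :: "nat \<Rightarrow> omega1_interval"
    assume e: "0 < e" and "\<And>n. x n \<in> {..<omega1} \<and> y n \<in> {..<omega1} \<and> x n < y n \<and> y n < x (Suc n)"
    then have "\<And>n. x n < y n \<and> y n < x (Suc n)" by blast
    then show "\<exists>n. dist (f (x n)) (f (y n)) < e" using e by (rule interleaved_dist_small[OF f])
  qed simp
  then obtain g where g: "g < omega1"
    "\<And>x y. x < omega1 \<Longrightarrow> y < omega1 \<Longrightarrow> g < x \<Longrightarrow> g < y \<Longrightarrow> f x = f y"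
    unfolding Ball_def lessThan_iff by blast
  have "f x = f omega1" if "g < x" "x < omega1" for x
  proof (rule ccontr)
    assume "f x \<noteq> f omega1"
    then have "dist (f x) (f omega1) > 0" by simp
    then show False
    proof (rule continuous_left[OF f, where x = omega1])
      fix w assume w: "w < omega1" "\<And>z. w < z \<Longrightarrow> z \<le> omega1 \<Longrightarrow> dist (f z) (f omega1) < dist (f x) (f omega1)"
      obtain b where b: "b < omega1" "w < b" "g < b" by (rule bound2_omega1[OF w(1) g(1)])
      have "f x = f b" using that b by (intro g(2))
      then show False using w(2)[of b] b by (simp add: less_imp_le)
    next
      assume "\<And>y. omega1 \<le> y"
      then show False using g(1) not_le by blast
    qed
  qed
  then have "f x = f omega1" if "g < x" for x
    using that not_less_omega1_iff[of x] by blast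
  then show ?thesis using g(1) by blast
qed

text \<open>At most one summand is nonzero. For functions with disjoint supports this bounds sums in
  the supremum norm independently of their length.\<close>

lemma norm_sum_disjoint_le:
  fixes t :: "'i \<Rightarrow> 'b::real_normed_vector"
  assumes "\<And>i j. i \<in> A \<Longrightarrow> j \<in> A \<Longrightarrow> t i \<noteq> 0 \<Longrightarrow> t j \<noteq> 0 \<Longrightarrow> i = j"
    and "\<And>i. i \<in> A \<Longrightarrow> norm (t i) \<le> C" "0 \<le> C"
  shows "norm (sum t A) \<le> C"
proof (cases "\<exists>i\<in>A. t i \<noteq> 0")
  case True
  then obtain i where i: "i \<in> A" "t i \<noteq> 0" by blast
  show ?thesis
  proof (cases "finite A")
    case True
    have "sum t A = sum t {i}"
      by (rule sum.mono_neutral_right) (use True i assms(1) in auto)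
    then show ?thesis using assms(2) i by simp
  qed (use assms(3) in simp)
next
  case False
  then show ?thesis using assms(3) by simp
qed

text \<open>
  If all distances were at least \<open>e\<close>, then the disjointly supported differences of the step functions,
  multiplied by suitable scalars of modulus one, would add up to a function of norm at most one whose
  image under \<open>T\<close> is arbitrarily large.
\<close>
lemma bounded_variation_step:
  fixes T :: "(omega1_interval, 'k::real_normed_field) bounded_op"
  assumes xy: "\<And>n. x n < y n \<and> y n < x (Suc n)" and e: "e > 0"
  shows "\<exists>n::nat. dist (app T (step (x n)) a - app T (step (x n)) b) (app T (step (y n)) a - app T (step (y n)) b) < e"
proof (rule ccontr)
  assume neg: "\<not> ?thesis"
  define m where "m n = app T (step (y n) - step (x n)) a - app T (step (y n) - step (x n)) b" for n
  have "norm (m n) \<ge> e" for n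
    using neg by (auto simp: m_def blinfun.diff_right dist_norm norm_minus_commute not_less algebra_simps)
  then have m: "norm (m n) \<ge> e" "m n \<noteq> 0" for n using e by (auto, metis norm_zero not_less)
  define w where "w n = of_real (norm (m n)) / m n" for n
  have w: "norm (w n) = 1" "w n * m n = of_real (norm (m n))" for n
    using m(2) by (simp_all add: w_def norm_divide)
  \<comment> \<open>The factor 2 pays for comparing \<open>app T F\<close> at the two points
    \<open>a\<close> and \<open>b\<close>.\<close>
  obtain N :: nat where N: "of_nat N * e > 2 * norm (blinfun_of T)"
    using ex_less_of_nat_mult[OF e] by blast
  define F where "F = (\<Sum>n<N. scale_bcontfun (w n) (step (y n) - step (x n)))"
  have sm: "strict_mono x"
    using xy by (intro strict_monoI_Suc) (auto intro: less_trans)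
  have F: "apply_bcontfun F z = (\<Sum>n<N. w n * (step (y n) z - step (x n) z))" for z
    unfolding F_def by (induction N) (simp_all add: scale_bcontfun_rep_eq)
  have "norm F \<le> 1"
  proof (rule norm_bound)
    fix z show "norm (F z) \<le> 1" unfolding F
    proof (rule norm_sum_disjoint_le)
      have nz: "x n < z \<and> z \<le> y n" if "w n * (step (y n) z - step (x n) z) \<noteq> 0" for n
      proof -
        have "x n < y n" using xy by blast
        then show ?thesis using that by (auto simp: step_apply split: if_splits)
      qed
      \<comment> \<open>The intervals \<open>{x n<..y n}\<close> are pairwise disjoint.\<close>
      have lt: "i < j \<Longrightarrow> x i < z \<and> z \<le> y i \<Longrightarrow> x j < z \<and> z \<le> y j \<Longrightarrow> False" for i j
      proof -
        assume ij: "i < j" "x i < z \<and> z \<le> y i" "x j < z \<and> z \<le> y j"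
        have "y i < x (Suc i)" using xy by blast
        also have "x (Suc i) \<le> x j" using ij(1) strict_mono_less_eq[OF sm] by auto
        finally show False using ij by auto
      qed
      fix i j assume "w i * (step (y i) z - step (x i) z) \<noteq> 0" "w j * (step (y j) z - step (x j) z) \<noteq> 0"
      then show "i = j" using nz lt by (cases i j rule: linorder_cases) blast+
    next
      fix i
      show "norm (w i * (step (y i) z - step (x i) z)) \<le> 1"
        by (simp add: norm_mult w(1) step_apply)
    qed simp
  qed
  then have TF: "norm (app T F) \<le> norm (blinfun_of T)"
    using norm_app[of T F] mult_left_le[of "norm F" "norm (blinfun_of T)"] by simp
  have lin: "app T F c = (\<Sum>n<N. w n * app T (step (y n) - step (x n)) c)" for c
    unfolding F_def by (induction N) (simp_all add: blinfun.add_right blinfun.zero_right app_scale scale_bcontfun_rep_eq)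
  have "app T F a - app T F b = (\<Sum>n<N. w n * m n)"
    unfolding lin m_def by (simp add: sum_subtractf algebra_simps)
  also have "\<dots> = of_real (\<Sum>n<N. norm (m n))"
    by (simp add: w(2))
  finally have "norm (app T F a - app T F b) = (\<Sum>n<N. norm (m n))"
    by (simp add: sum_nonneg del: of_real_sum)
  moreover have "(\<Sum>n<N. norm (m n)) \<ge> of_nat N * e"
    using sum_mono[of "{..<N}" "\<lambda>_. e" "\<lambda>n. norm (m n)"] m(1) by simp
  moreover have "norm (app T F a - app T F b) \<le> norm (app T F) + norm (app T F)"
    by (rule order_trans[OF norm_triangle_ineq4]) (intro add_mono norm_bounded)
  ultimately show False using N TF by linarith
qed

section \<open>Every operator is scalar on a club\<close>

text \<open>Closedness refers to the whole interval with its last point, so \<open>omega1\<close>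
  belongs to every club (\<open>top_in_club\<close>), while unboundedness is asked below it.\<close>

definition club :: "omega1_interval set \<Rightarrow> bool"
  where "club D \<longleftrightarrow> closed D \<and> (\<forall>g<omega1. \<exists>d\<in>D. g < d \<and> d < omega1)"

lemma clubE:
  assumes "club D" "g < omega1"
  obtains d where "d \<in> D" "g < d" "d < omega1"
  using assms unfolding club_def by blast

lemma club_greaterThan: "g < omega1 \<Longrightarrow> club {g<..}"
  unfolding club_def
proof (intro conjI allI impI)
  have "closed (- {..g})" by (rule closed_Compl[OF open_atMost_wellorder])
  moreover have "- {..g} = {g<..}" by auto
  ultimately show "closed {g<..}" by metis
  fix x assume "g < omega1" "x < omega1"
  then obtain b where "b < omega1" "g < b" "x < b" by (rule bound2_omega1)
  then show "\<exists>d\<in>{g<..}. x < d \<and> d < omega1" by auto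
qed

lemma top_in_club:
  assumes "club D" shows "omega1 \<in> D"
proof (rule ccontr)
  assume n: "omega1 \<notin> D"
  have o: "open (- D)" using assms unfolding club_def by (intro open_Compl) blast
  obtain x where x: "x < omega1" using exists_less_omega1 by blast
  obtain y where y: "y < omega1" "{y<..omega1} \<subseteq> - D" using open_left[OF o _ x] n by blast
  obtain d where d: "d \<in> D" "y < d" "d < omega1" using assms y(1) by (rule clubE)
  have "d \<in> {y<..omega1}" using d by simp
  then show False using d(1) y(2) by blast
qed

text \<open>Choosing points of \<open>D\<close> and \<open>E\<close> alternately produces
  interleaved sequences; their common limit lies in both sets and, by uncountable cofinality, below
  \<open>omega1\<close>.\<close>

lemma club_Int:
  assumes D: "club D" and E: "club E"
  shows "club (D \<inter> E)"
  unfolding club_def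
proof (intro conjI allI impI)
  show "closed (D \<inter> E)" using assms by (simp add: club_def closed_Int)
  fix g assume g: "g < omega1"
  obtain p where p: "\<And>x. x < omega1 \<Longrightarrow> p x \<in> D \<and> x < p x \<and> p x < omega1"
    using D unfolding club_def by metis
  obtain q where q: "\<And>x. x < omega1 \<Longrightarrow> q x \<in> E \<and> x < q x \<and> q x < omega1"
    using E unfolding club_def by metis
  define s where "s n = ((\<lambda>x. q (p x)) ^^ n) g" for n
  have Suc: "s (Suc n) = q (p (s n))" for n by (simp add: s_def)
  have lt: "s n < omega1" for n
  proof (induction n)
    case (Suc n) then show ?case using p q by (simp add: s_def)
  qed (simp add: s_def g)
  have ps: "p (s n) \<in> D" "s n < p (s n)" "p (s n) < omega1" for n using p[OF lt[of n]] by auto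
  have qs: "s (Suc n) \<in> E" "p (s n) < s (Suc n)" for n using q[OF ps(3)[of n]] Suc by auto
  have inc: "s n < s (Suc n)" for n using ps(2) qs(2) by (rule less_trans)
  obtain z where z: "s \<longlonglongrightarrow> z" "\<And>n. s n < z" "\<And>b. (\<And>n. s n \<le> b) \<Longrightarrow> z \<le> b" "(\<forall>n. s n < omega1) \<longrightarrow> z < omega1"
    using strict_mono_seq_limit_omega1[of s] inc by blast
  have "z \<in> E"
    using E qs(1) LIMSEQ_Suc[OF z(1)] unfolding club_def by (meson closed_sequentially)
  moreover have "(\<lambda>n. p (s n)) \<longlonglongrightarrow> z"
    by (rule tendsto_sandwich[OF _ _ z(1) LIMSEQ_Suc[OF z(1)]]) (use ps(2) qs(2) in \<open>simp_all add: less_imp_le\<close>)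
  then have "z \<in> D"
    using D ps(1) unfolding club_def by (meson closed_sequentially)
  moreover have "g < z" using z(2)[of 0] by (simp add: s_def)
  moreover have "z < omega1" using z(4) lt by blast
  ultimately show "\<exists>d\<in>D \<inter> E. g < d \<and> d < omega1" by blast
qed

text \<open>A witness \<open>b < a \<le> F b\<close> against \<open>a\<close> is a witness against
  all of \<open>{b<..a}\<close>, which gives closedness. Closure points arise cofinally as limits of
  an \<omega>-iteration, each step of which exceeds the countably many values of \<open>F\<close>
  reached so far.\<close>

lemma club_closing_off:
  assumes F: "\<And>b. b < omega1 \<Longrightarrow> F b < omega1"
  shows "club {a. \<forall>b<a. F b < a}"
  unfolding club_def
proof (intro conjI allI impI)
  let ?D = "{a. \<forall>b<a. F b < a}"
  have "open (- ?D)"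
  proof (subst open_subopen, intro ballI)
    fix a assume "a \<in> - ?D"
    then obtain b where b: "b < a" "a \<le> F b" by (auto simp: not_less)
    have "{b<..} \<inter> {..a} \<subseteq> - ?D" using b by force
    moreover have "open ({b<..} \<inter> {..a})" by (intro open_Int open_atMost_wellorder) simp
    ultimately show "\<exists>T. open T \<and> a \<in> T \<and> T \<subseteq> - ?D"
      using b(1) by (intro exI[of _ "{b<..} \<inter> {..a}"]) auto
  qed
  then show "closed ?D" by (simp add: closed_def)
  fix g assume g: "g < omega1"
  have "\<exists>y<omega1. x < y \<and> (\<forall>b\<le>x. F b < y)" if x: "x < omega1" for x
  proof -
    have c: "countable (insert x (F ` {..x}))"
      using countable_atMost_omega1[OF x] by simp
    have l: "z < omega1" if "z \<in> insert x (F ` {..x})" for z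
      using that x F by (auto intro: le_less_trans)
    obtain y where y: "y < omega1" "\<And>z. z \<in> insert x (F ` {..x}) \<Longrightarrow> z < y"
      using c l by (rule countable_bound_omega1) auto
    then show ?thesis by (intro exI[of _ y]) auto
  qed
  then obtain N where N: "\<And>x. x < omega1 \<Longrightarrow> N x < omega1 \<and> x < N x \<and> (\<forall>b\<le>x. F b < N x)"
    by metis
  define s where "s n = (N ^^ n) g" for n
  have Suc: "s (Suc n) = N (s n)" for n by (simp add: s_def)
  have lt: "s n < omega1" for n
  proof (induction n)
    case (Suc n) then show ?case using N by (simp add: s_def)
  qed (simp add: s_def g)
  have inc: "s n < s (Suc n)" for n using N[OF lt[of n]] Suc by simp
  obtain z where z: "s \<longlonglongrightarrow> z" "\<And>n. s n < z" "\<And>b. (\<And>n. s n \<le> b) \<Longrightarrow> z \<le> b" "(\<forall>n. s n < omega1) \<longrightarrow> z < omega1"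
    using strict_mono_seq_limit_omega1[of s] inc by blast
  have "F b < z" if "b < z" for b
  proof -
    obtain n where "b \<le> s n" using z(3)[of b] \<open>b < z\<close> by (meson not_le less_imp_le)
    then have "F b < s (Suc n)" using N[OF lt[of n]] Suc by simp
    then show ?thesis using z(2)[of "Suc n"] by (rule less_trans)
  qed
  moreover have "g < z" using z(2)[of 0] by (simp add: s_def)
  moreover have "z < omega1" using z(4) lt by blast
  ultimately show "\<exists>d\<in>?D. g < d \<and> d < omega1" by blast
qed

text \<open>Subtracting the values at \<open>omega1\<close> makes rank-one operators act as 0: the
  functions in their range are eventually constant but need not vanish.\<close>

definition acts_as_scalar_on :: "(omega1_interval, 'k::real_normed_field) bounded_op \<Rightarrow> 'k \<Rightarrow> omega1_interval set \<Rightarrow> bool"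
  where "acts_as_scalar_on T c D \<longleftrightarrow>
    (\<forall>a\<in>D. \<forall>f. app T f a - app T f omega1 = c * (f a - f omega1))"

text \<open>For fixed \<open>a\<close> the difference of both sides is a bounded linear functional
  \<open>H\<close> of \<open>f\<close>, and the span of the step functions is dense by
  \<open>step_induct\<close>.\<close>

lemma acts_as_scalar_onI:
  fixes T :: "(omega1_interval, 'k::real_normed_field) bounded_op"
  assumes "\<And>a b. a \<in> D \<Longrightarrow> app T (step b) a - app T (step b) omega1 = c * (step b a - step b omega1)"
  shows "acts_as_scalar_on T c D"
  unfolding acts_as_scalar_on_def
proof (intro ballI allI)
  fix a and f :: "omega1_interval \<Rightarrow>\<^sub>C 'k" assume a: "a \<in> D"
  define H where "H f = app T f a - app T f omega1 - c * (f a - f omega1)" for f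
  have H: "H (f - g) = H f - H g" "H (f + g) = H f + H g" "H (scale_bcontfun d f) = d * H f" for f g d
    by (simp_all add: H_def blinfun.add_right blinfun.diff_right app_scale scale_bcontfun_rep_eq algebra_simps)
  define C where "C = norm (blinfun_of T) + norm (blinfun_of T) + norm c * (1 + 1)"
  have C: "norm (H f) \<le> C * norm f" for f
  proof -
    have "norm (H f) \<le> (norm (app T f a) + norm (app T f omega1)) + norm c * (norm (f a) + norm (f omega1))"
      unfolding H_def by (intro order_trans[OF norm_triangle_ineq4] add_mono norm_triangle_ineq4)
        (auto simp: norm_mult intro!: mult_left_mono norm_triangle_ineq4)
    also have "\<dots> \<le> (norm (blinfun_of T) * norm f + norm (blinfun_of T) * norm f) + norm c * (norm f + norm f)"
      by (intro add_mono mult_left_mono norm_bounded order_trans[OF norm_bounded norm_app]) auto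
    also have "\<dots> = C * norm f" by (simp add: C_def algebra_simps)
    finally show ?thesis .
  qed
  have C0: "0 \<le> C" unfolding C_def by simp
  have "H f = 0"
  proof (induction f rule: step_induct)
    case (limit f)
    have "norm (H f) \<le> e" if e: "e > 0" for e
    proof -
      \<comment> \<open>Division by \<open>C + 1\<close> covers the case that \<open>C\<close>
        vanishes.\<close>
      have "e / (C + 1) > 0" using e C0 by simp
      then obtain g where g: "H g = 0" "norm (f - g) \<le> e / (C + 1)" using limit by blast
      have "norm (H f) = norm (H (f - g))" using g(1) by (simp add: H(1))
      also have "\<dots> \<le> C * norm (f - g)" by (rule C)
      also have "\<dots> \<le> C * (e / (C + 1))" using g(2) C0 by (rule mult_left_mono)
      also have "\<dots> \<le> e" using C0 e by (simp add: field_simps)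
      finally show ?thesis .
    qed
    then show ?case by (metis norm_le_zero_iff dense_ge)
  qed (use assms[OF a] H in \<open>simp_all add: H_def\<close>)
  then show "app T f a - app T f omega1 = c * (f a - f omega1)" by (simp add: H_def)
qed

text \<open>The row of \<open>T\<close> at \<open>a\<close>, taken relative to
  \<open>omega1\<close>, has bounded variation along step functions.\<close>

lemma step_rows_constant:
  fixes T :: "(omega1_interval, 'k::real_normed_field) bounded_op"
  shows "\<exists>g<omega1. \<forall>x\<in>{..<omega1}. \<forall>y\<in>{..<omega1}. g < x \<longrightarrow> g < y \<longrightarrow>
    app T (step x) a - app T (step x) omega1 = app T (step y) a - app T (step y) omega1"
proof (rule eventually_constant_on)
  fix e :: real and x y :: "nat \<Rightarrow> omega1_interval"
  assume e: "0 < e" and "\<And>n. x n \<in> {..<omega1} \<and> y n \<in> {..<omega1} \<and> x n < y n \<and> y n < x (Suc n)"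
  then have "\<And>n. x n < y n \<and> y n < x (Suc n)" by blast
  then show "\<exists>n. dist (app T (step (x n)) a - app T (step (x n)) omega1)
      (app T (step (y n)) a - app T (step (y n)) omega1) < e"
    using e by (rule bounded_variation_step)
qed simp

text \<open>
  Below, \<open>s a b\<close> is the matrix of \<open>T\<close> with respect to the step functions. Its columns vanish
  eventually and its rows are eventually constant, so on a club \<open>D1\<close> of points closed under the
  corresponding bounds \<open>s a b\<close> is \<open>0\<close> for \<open>b < a\<close> and \<open>s a a\<close> for \<open>a \<le> b\<close>. The diagonal
  is locally the restriction of a continuous function, hence eventually constant.
\<close>
lemma exists_acts_as_scalar_on:
  fixes T :: "(omega1_interval, 'k::real_normed_field) bounded_op"
  shows "\<exists>c D. club D \<and> acts_as_scalar_on T c D"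
proof -
  define s where "s a b = app T (step b) a - app T (step b) omega1" for a b
  have s_cont: "continuous_on UNIV (\<lambda>a. s a b)" for b
    unfolding s_def by (intro continuous_on_diff continuous_on_const continuous_on_apply_bcontfun)
  \<comment> \<open>The clause \<open>b < g\<close> will turn closure points into limit points; the
    other two control the column and the row of \<open>b\<close>.\<close>
  define R where "R b g \<longleftrightarrow> g < omega1 \<and> b < g \<and> (\<forall>a>g. s a b = 0) \<and>
      (\<forall>x y. g < x \<longrightarrow> x < omega1 \<longrightarrow> g < y \<longrightarrow> y < omega1 \<longrightarrow> s b x = s b y)" for b g
  have "\<exists>g. R b g"
    if b: "b < omega1" for b
  proof -
    obtain g1 where g1: "g1 < omega1" "\<forall>a>g1. app T (step b) a = app T (step b) omega1"
      using continuous_eventually_constant[of "apply_bcontfun (app T (step b))"] by auto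
    obtain g2 where g2: "g2 < omega1" "\<forall>x y. g2 < x \<longrightarrow> x < omega1 \<longrightarrow> g2 < y \<longrightarrow> y < omega1 \<longrightarrow> s b x = s b y"
      using step_rows_constant[of T b] unfolding s_def Ball_def lessThan_iff by blast
    obtain g3 where g3: "g3 < omega1" "g1 < g3" "g2 < g3" using g1(1) g2(1) by (rule bound2_omega1)
    obtain g where g: "g < omega1" "b < g" "g3 < g" using b g3(1) by (rule bound2_omega1)
    have lt: "g1 < g" "g2 < g" using g3 g by order+
    have "s a b = 0" if "g < a" for a
      using g1(2) less_trans[OF lt(1) that] unfolding s_def by simp
    moreover have "s b x = s b y" if "g < x" "x < omega1" "g < y" "y < omega1" for x y
      using g2(2) less_trans[OF lt(2) that(1)] less_trans[OF lt(2) that(3)] that(2,4) by blast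
    ultimately show ?thesis unfolding R_def using g(1,2) by blast
  qed
  then obtain F where F: "\<And>b. b < omega1 \<Longrightarrow> R b (F b)" by metis
  have F1: "F b < omega1" and F2: "b < F b" if "b < omega1" for b
    using F[OF that] unfolding R_def by blast+
  have F3: "s a b = 0" if "b < omega1" "F b < a" for a b
    using F[OF that(1)] that(2) unfolding R_def by blast
  have F4: "s b x = s b y" if "b < omega1" "F b < x" "x < omega1" "F b < y" "y < omega1" for b x y
    using F[OF that(1)] that(2-) unfolding R_def by blast
  define D1 where "D1 = {a. \<forall>b<a. F b < a}"
  have D1: "club D1" unfolding D1_def using F1 by (rule club_closing_off)
  obtain m where m: "m < omega1" using exists_less_omega1 by blast
  \<comment> \<open>For \<open>x < a\<close> the bound \<open>F x\<close> is below \<open>a\<close>,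
    so the columns \<open>a\<close> and \<open>b\<close> agree at \<open>x\<close>. Both are
    continuous and \<open>a\<close> is a limit point, so they agree at \<open>a\<close> too;
    \<open>m < a\<close> excludes the least point.\<close>
  have diag: "s a b = s a a" if a: "a \<in> D1" "m < a" "a \<le> b" "b < omega1" for a b
  proof (rule ccontr)
    assume ne: "s a b \<noteq> s a a"
    let ?G = "\<lambda>x. s x b - s x a"
    have G0: "?G x = 0" if "x < a" for x
    proof -
      have "F x < a" using that a(1) by (simp add: D1_def)
      moreover have "x < omega1" "a < omega1" using that a(3,4) by order+
      moreover have "F x < b" using \<open>F x < a\<close> a(3) by order
      ultimately have "s x b = s x a" using a(4) by (intro F4)
      then show ?thesis by simp
    qed
    have cont: "continuous_on UNIV ?G" by (intro continuous_intros s_cont)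
    show False
    proof (rule continuous_left[OF cont, of "norm (?G a)" a])
      show "0 < norm (?G a)" using ne by simp
    next
      assume "\<And>y. a \<le> y"
      then show False using a(2) not_le by blast
    next
      fix y assume y: "y < a" "\<And>z. y < z \<Longrightarrow> z \<le> a \<Longrightarrow> dist (?G z) (?G a) < norm (?G a)"
      have "y < omega1" using y(1) a by order
      then have z: "y < F y" "F y < a" using F2 a(1) y(1) by (simp_all add: D1_def)
      then show False using y(2)[OF z(1) less_imp_le[OF z(2)]] G0[OF z(2)] by simp
    qed
  qed
  let ?D = "D1 \<inter> {m<..<omega1}"
  have "\<exists>g<omega1. \<forall>x\<in>?D. \<forall>y\<in>?D. g < x \<longrightarrow> g < y \<longrightarrow> s x x = s y y"
  proof (rule eventually_constant_on)
    fix e :: real and x y :: "nat \<Rightarrow> omega1_interval"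
    assume e: "0 < e" and xy: "\<And>n. x n \<in> ?D \<and> y n \<in> ?D \<and> x n < y n \<and> y n < x (Suc n)"
    have xD: "x n \<in> D1" "m < x n" "x n < omega1" and yD: "y n \<in> D1" "m < y n" "y n < omega1"
      and lt: "x n < y n" "y n < x (Suc n)" for n
      using xy[of n] by simp_all
    have inc: "x n < x (Suc n)" for n using lt[of n] by order
    \<comment> \<open>With one \<open>z\<close> above both sequences, all diagonal entries involved
      are values of the single continuous function \<open>\<lambda>a. s a z\<close>.\<close>
    obtain z where z: "\<And>n. x n < z" "z < omega1"
      using strict_mono_seq_limit_omega1[of x, OF inc] xD(3) by blast
    have zy: "y n < z" for n using lt[of n] z(1)[of "Suc n"] by order
    have lt': "x n < y n \<and> y n < x (Suc n)" for n using lt by blast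
    obtain n where n: "dist (s (x n) z) (s (y n) z) < e"
      using interleaved_dist_small[of "\<lambda>a. s a z" x y e, OF s_cont lt' e] by blast
    have "s (x n) z = s (x n) (x n)"
      using xD z by (intro diag less_imp_le)
    moreover have "s (y n) z = s (y n) (y n)"
      using yD z(2) zy by (intro diag less_imp_le)
    ultimately show "\<exists>n. dist (s (x n) (x n)) (s (y n) (y n)) < e" using n by metis
  qed simp
  then obtain g where g: "g < omega1" "\<And>x y. x \<in> ?D \<Longrightarrow> y \<in> ?D \<Longrightarrow> g < x \<Longrightarrow> g < y \<Longrightarrow> s x x = s y y"
    by blast
  \<comment> \<open>\<open>step omega1\<close> is the constant 1, to which the bounds for
    \<open>b < omega1\<close> do not apply.\<close>
  obtain g2 where g2: "g2 < omega1" "\<And>a. g2 < a \<Longrightarrow> app T (step omega1) a = app T (step omega1) omega1"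
    using continuous_eventually_constant[of "apply_bcontfun (app T (step omega1))"] by auto
  obtain g3 where g3: "g3 < omega1" "g < g3" "g2 < g3" using g(1) g2(1) by (rule bound2_omega1)
  obtain g4 where g4: "g4 < omega1" "m < g4" "g3 < g4" using m g3(1) by (rule bound2_omega1)
  define D where "D = D1 \<inter> {g4<..}"
  have D: "club D" unfolding D_def by (intro club_Int D1 club_greaterThan g4)
  obtain d where d: "d \<in> D" "d < omega1" using D g4(1) by (rule clubE)
  have "d \<in> D1" "g4 < d" using d(1) by (simp_all add: D_def)
  then have dD: "d \<in> D1" "m < d" "g < d" "d < omega1"
    using d(2) g3 g4 by (blast, order+)
  have "acts_as_scalar_on T (s d d) D"
  proof (rule acts_as_scalar_onI)
    fix a b assume a: "a \<in> D"
    then have a1: "a \<in> D1" "g4 < a" by (simp_all add: D_def)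
    then have aD: "a \<in> D1" "m < a" "g < a" "g2 < a"
      using g3 g4 by (blast, order+)
    show "app T (step b) a - app T (step b) omega1 = s d d * (step b a - step b omega1)"
    proof (cases "a = omega1 \<or> b = omega1")
      case True
      then show ?thesis using g2(2)[OF aD(4)] by (elim disjE) (simp_all add: step_apply Field_omega1_max)
    next
      case False
      then have lt: "a < omega1" "b < omega1" using not_less_omega1_iff by blast+
      have "s a b = (if a \<le> b then s d d else 0)"
      proof (cases "a \<le> b")
        case True
        have "s a b = s a a" using aD True lt by (intro diag)
        also have "s a a = s d d"
          using aD lt(1) dD by (intro g(2)) simp_all
        finally show ?thesis using True by simp
      next
        case False
        then have "F b < a" using aD(1) by (auto simp: D1_def)
        then show ?thesis using F3[OF lt(2)] False by simp
      qed
      moreover have "b \<noteq> omega1" using lt(2) by blast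
      ultimately show ?thesis by (simp add: s_def step_apply)
    qed
  qed
  then show ?thesis using D by blast
qed

lemma acts_as_scalar_on_subset: "acts_as_scalar_on T c D \<Longrightarrow> E \<subseteq> D \<Longrightarrow> acts_as_scalar_on T c E"
  unfolding acts_as_scalar_on_def by blast

text \<open>At a common point \<open>a < omega1\<close> the function \<open>step a\<close> satisfies
  \<open>f a - f omega1 = 1\<close> and so reads off the scalar.\<close>

lemma acts_as_scalar_on_unique:
  fixes T :: "(omega1_interval, 'k::real_normed_field) bounded_op"
  assumes "club D" "acts_as_scalar_on T c D" "club E" "acts_as_scalar_on T d E"
  shows "c = d"
proof -
  obtain m where m: "m < omega1" using exists_less_omega1 by blast
  obtain a where a: "a \<in> D \<inter> E" "a < omega1"
    using club_Int[OF assms(1,3)] m by (rule clubE)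
  have ne: "a \<noteq> omega1" using a(2) by blast
  have "app T (step a) a - app T (step a) omega1 = c * (step a a - step a omega1)"
    using assms(2) a(1) unfolding acts_as_scalar_on_def by blast
  moreover have "app T (step a) a - app T (step a) omega1 = d * (step a a - step a omega1)"
    using assms(4) a(1) unfolding acts_as_scalar_on_def by blast
  ultimately show ?thesis using ne by (simp add: step_apply)
qed

text \<open>For real or complex scalars the kernel of this functional is the Loy-Willis
  ideal.\<close>

definition character :: "(omega1_interval, 'k::real_normed_field) bounded_op \<Rightarrow> 'k"
  where "character T = (THE c. \<exists>D. club D \<and> acts_as_scalar_on T c D)"

lemma character_eqI: "club D \<Longrightarrow> acts_as_scalar_on T c D \<Longrightarrow> character T = c"
  unfolding character_def using acts_as_scalar_on_unique by (intro the_equality) blast+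

lemma character_club: "\<exists>D. club D \<and> acts_as_scalar_on T (character T) D"
  using exists_acts_as_scalar_on[of T] character_eqI by metis

lemma character_common_club:
  assumes "finite F"
  shows "\<exists>D. club D \<and> (\<forall>T\<in>F. acts_as_scalar_on T (character T) D)"
  using assms
proof (induction F)
  case empty
  show ?case using exists_less_omega1 club_greaterThan by blast
next
  case (insert T F)
  then obtain D where D: "club D" "\<forall>T\<in>F. acts_as_scalar_on T (character T) D" by blast
  obtain E where E: "club E" "acts_as_scalar_on T (character T) E" using character_club by blast
  have "\<forall>S\<in>insert T F. acts_as_scalar_on S (character S) (D \<inter> E)"
    using D(2) E(2) acts_as_scalar_on_subset[OF _ Int_lower1] acts_as_scalar_on_subset[OF _ Int_lower2]
    by blast
  then show ?case using club_Int[OF D(1) E(1)] by blast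
qed

lemma character_pair:
  fixes S T :: "(omega1_interval, 'k::real_normed_field) bounded_op"
  shows "\<exists>D. club D \<and> acts_as_scalar_on S (character S) D \<and> acts_as_scalar_on T (character T) D"
  using character_common_club[of "{S, T}"] by auto

lemma character_add: "character (S + T) = character S + character T"
proof -
  obtain D where D: "club D" "acts_as_scalar_on S (character S) D" "acts_as_scalar_on T (character T) D"
    using character_pair[of S T] by blast
  have "acts_as_scalar_on (S + T) (character S + character T) D"
    using D(2,3) unfolding acts_as_scalar_on_def by (simp add: algebra_simps)
  then show ?thesis by (rule character_eqI[OF D(1)])
qed

text \<open>The relation for \<open>S\<close> is applied to the function \<open>app T f\<close>,
  which requires one club for both operators.\<close>

lemma character_mult: "character (S * T) = character S * character T"
proof -
  obtain D where D: "club D" "acts_as_scalar_on S (character S) D" "acts_as_scalar_on T (character T) D"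
    using character_pair[of S T] by blast
  have "acts_as_scalar_on (S * T) (character S * character T) D"
    using D(2,3) unfolding acts_as_scalar_on_def by (simp add: mult.assoc)
  then show ?thesis by (rule character_eqI[OF D(1)])
qed

lemma character_scalar: "character (scalar_op c) = c"
proof -
  obtain m where m: "m < omega1" using exists_less_omega1 by blast
  have "acts_as_scalar_on (scalar_op c) c {m<..}"
    unfolding acts_as_scalar_on_def by (simp add: scale_bcontfun_rep_eq algebra_simps)
  then show ?thesis by (rule character_eqI[OF club_greaterThan[OF m]])
qed

text \<open>\<open>h\<close> is the transitive collapse of \<open>R\<close> on \<open>S\<close>.
  Countable initial segments keep its values below \<open>omega1\<close>, minimality makes its image
  an initial segment, and uncountability of \<open>S\<close> makes that image everything below
  \<open>omega1\<close>. Both rearrangements of the interval come from this.\<close>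

lemma order_iso_omega1:
  assumes wf: "wf R" and trans: "trans R"
    and total: "\<And>s t. s \<in> S \<Longrightarrow> t \<in> S \<Longrightarrow> s \<noteq> t \<Longrightarrow> (s, t) \<in> R \<or> (t, s) \<in> R"
    and unc: "uncountable S" and seg: "\<And>s. s \<in> S \<Longrightarrow> countable {t \<in> S. (t, s) \<in> R}"
  shows "\<exists>h. bij_betw h S {..<omega1} \<and> (\<forall>s\<in>S. \<forall>t\<in>S. (s, t) \<in> R \<longleftrightarrow> h s < h t)"
proof -
  define h where "h = wfrec R (\<lambda>f w. LEAST z :: omega1_interval. \<forall>t\<in>S. (t, w) \<in> R \<longrightarrow> f t < z)"
  have h: "h w = (LEAST z. \<forall>t\<in>S. (t, w) \<in> R \<longrightarrow> h t < z)" for w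
    unfolding h_def by (subst wfrec[OF wf]) (simp add: cut_apply cong: imp_cong)
  have bound: "\<exists>z<omega1. \<forall>t\<in>S. (t, w) \<in> R \<longrightarrow> h t < z"
    if w: "w \<in> S" and below: "\<And>t. t \<in> S \<Longrightarrow> (t, w) \<in> R \<Longrightarrow> h t < omega1" for w
  proof -
    have "countable (h ` {t \<in> S. (t, w) \<in> R})" using seg[OF w] by simp
    then obtain b where "b < omega1" "\<And>x. x \<in> h ` {t \<in> S. (t, w) \<in> R} \<Longrightarrow> x < b"
      by (rule countable_bound_omega1) (use below in blast)+
    then show ?thesis by blast
  qed
  have lt: "h w < omega1" if "w \<in> S" for w
    using wf that
  proof (induction w rule: wf_induct_rule)
    case (less w)
    obtain z where z: "z < omega1" "\<forall>t\<in>S. (t, w) \<in> R \<longrightarrow> h t < z"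
      using bound[OF less.prems] less.IH by blast
    have "h w \<le> z" unfolding h[of w] using z(2) by (rule Least_le)
    then show ?case using z(1) by order
  qed
  have mono: "h t < h w" if "t \<in> S" "w \<in> S" "(t, w) \<in> R" for t w
  proof -
    have "\<exists>z. \<forall>t\<in>S. (t, w) \<in> R \<longrightarrow> h t < z" using bound[OF that(2)] lt by blast
    then have "\<forall>t\<in>S. (t, w) \<in> R \<longrightarrow> h t < h w" unfolding h[of w] by (rule LeastI_ex)
    then show ?thesis using that by blast
  qed
  have iff: "(s, t) \<in> R \<longleftrightarrow> h s < h t" if "s \<in> S" "t \<in> S" for s t
  proof
    assume "h s < h t"
    then have "s \<noteq> t" and "\<not> h t < h s" by auto
    then show "(s, t) \<in> R" using total[OF that] mono[OF that(2,1)] by blast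
  qed (rule mono[OF that])
  have inj: "inj_on h S"
  proof (rule inj_onI)
    fix s t assume st: "s \<in> S" "t \<in> S" "h s = h t"
    then have "\<not> h s < h t" "\<not> h t < h s" by simp_all
    then show "s = t" using total[OF st(1,2)] mono[OF st(1,2)] mono[OF st(2,1)] by blast
  qed
  have down: "\<exists>t\<in>S. h t = z" if "w \<in> S" "z < h w" for w z
    using wf that
  proof (induction w rule: wf_induct_rule)
    case (less w)
    have "\<not> (\<forall>t\<in>S. (t, w) \<in> R \<longrightarrow> h t < z)"
      using less.prems(2) unfolding h[of w] by (rule not_less_Least)
    then obtain t where t: "t \<in> S" "(t, w) \<in> R" "\<not> h t < z" by blast
    then have "z = h t \<or> z < h t" by auto
    then show ?case using t(1) less.IH[OF t(2,1)] by blast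
  qed
  have "z \<in> h ` S" if "z < omega1" for z
  proof -
    have "\<not> h ` S \<subseteq> {..z}"
    proof
      assume "h ` S \<subseteq> {..z}"
      then have "countable (h ` S)" using countable_atMost_omega1[OF that] by (rule countable_subset)
      then show False using unc countable_image_inj_on[OF _ inj] by blast
    qed
    then obtain w where "w \<in> S" "z < h w" unfolding image_subset_iff atMost_iff not_le[symmetric] by blast
    then show ?thesis using down by blast
  qed
  then have "h ` S = {..<omega1}" using lt by auto
  then show ?thesis using inj iff by (intro exI[of _ h]) (simp add: bij_betw_def)
qed

section \<open>A subspace of codimension two isomorphic to the whole space\<close>

lemma two_least_points:
  "\<exists>x0 x1 :: omega1_interval. x0 < x1 \<and> x1 < omega1 \<and> (\<forall>x. x0 \<le> x) \<and> (\<forall>x. x < x1 \<longrightarrow> x = x0)"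
proof -
  obtain m where m: "m < omega1" using exists_less_omega1 by blast
  define x0 :: omega1_interval where "x0 = (LEAST x. True)"
  have x0: "x0 \<le> x" for x unfolding x0_def by (rule Least_le) simp
  then have "x0 < omega1" using m by (rule le_less_trans)
  then obtain b where b: "b < omega1" "x0 < b" by (rule bound_omega1)
  define x1 where "x1 = (LEAST x. x0 < x)"
  have "x0 < x1" unfolding x1_def using b(2) by (rule LeastI)
  moreover have "x1 \<le> b" unfolding x1_def using b(2) by (rule Least_le)
  then have "x1 < omega1" using b(1) by (rule le_less_trans)
  moreover have "x = x0" if "x < x1" for x
  proof -
    have "\<not> x0 < x" using that unfolding x1_def by (rule not_less_Least)
    then show ?thesis using x0[of x] by auto
  qed
  ultimately show ?thesis using x0 by blast
qed

text \<open>\<open>s\<close> is the order isomorphism \<open>\<alpha> \<mapsto> 2 + \<alpha>\<close> onto the points above \<open>x1\<close>, the second point.\<close>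
lemma shift_by_two:
  fixes x0 x1 :: omega1_interval
  assumes x: "x0 < x1" "x1 < omega1" "\<And>x. x0 \<le> x"
  shows "\<exists>s l. continuous_on UNIV s \<and> continuous_on UNIV l \<and> (\<forall>a. l (s a) = a) \<and> (\<forall>a. x1 < s a) \<and>
    (\<forall>x>x1. s (l x) = x) \<and> (\<forall>x\<le>x1. l x = x0) \<and> s omega1 = omega1 \<and> l omega1 = omega1"
proof -
  define S where "S = {x1<..<omega1}"
  have unc: "uncountable S"
  proof
    assume "countable S"
    then have "countable (S \<union> {..x1})" using countable_atMost_omega1[OF x(2)] by simp
    moreover have "{..<omega1} \<subseteq> S \<union> {..x1}" unfolding S_def by auto
    ultimately show False using uncountable_lessThan_omega1 countable_subset by blast
  qed
  let ?R = "{(a, b :: omega1_interval). a < b}"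
  have seg: "countable {t \<in> S. (t, s) \<in> ?R}" if "s \<in> S" for s
  proof -
    have "s < omega1" using that by (simp add: S_def)
    then have "countable {..s}" by (rule countable_atMost_omega1)
    then show ?thesis by (rule countable_subset[rotated]) auto
  qed
  have tr: "trans ?R" by (rule transI) auto
  have "\<exists>h. bij_betw h S {..<omega1} \<and> (\<forall>s\<in>S. \<forall>t\<in>S. (s, t) \<in> ?R \<longleftrightarrow> h s < h t)"
    by (rule order_iso_omega1[OF wf tr _ unc seg]) auto
  then obtain h where bij: "bij_betw h S {..<omega1}"
    and "\<forall>s\<in>S. \<forall>t\<in>S. (s, t) \<in> ?R \<longleftrightarrow> h s < h t" by blast
  then have h: "s < t \<longleftrightarrow> h s < h t" if "s \<in> S" "t \<in> S" for s t
    using that by simp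
  define g where "g = inv_into S h"
  have hS: "h x < omega1" if "x \<in> S" for x
    using bij_betwE[OF bij] that by auto
  have gS: "g a \<in> S" "h (g a) = a" if "a < omega1" for a
    unfolding g_def using bij that
    by (auto simp: bij_betw_def inv_into_into f_inv_into_f)
  have gh: "g (h x) = x" if "x \<in> S" for x
    unfolding g_def using bij that by (auto simp: bij_betw_def)
  define s where "s a = (if a = omega1 then omega1 else g a)" for a
  define l where "l x = (if x = omega1 then omega1 else if x \<le> x1 then x0 else h x)" for x
  have inS: "x \<in> S" if "x \<noteq> omega1" "\<not> x \<le> x1" for x
    using that unfolding S_def by (metis greaterThanLessThan_iff not_le not_less_omega1_iff)
  have s1: "x1 < s a" for a
  proof (cases "a = omega1")
    case False
    then have "a < omega1" using not_less_omega1_iff by blast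
    then show ?thesis using gS(1)[of a] False by (simp add: s_def S_def)
  qed (simp add: s_def x(2))
  have sne: "s a < omega1" if "a < omega1" for a
    using gS(1)[OF that] that unfolding s_def S_def by (cases "a = omega1") simp_all
  have ls: "l (s a) = a" for a
  proof (cases "a = omega1")
    case False
    then have a: "a < omega1" using not_less_omega1_iff by blast
    have "s a \<noteq> omega1" "\<not> s a \<le> x1" using sne[OF a] s1[of a] by auto
    then show ?thesis using gS(2)[OF a] False by (simp add: l_def s_def)
  qed (simp add: s_def l_def)
  have sl: "s (l x) = x" if "x1 < x" for x
  proof (cases "x = omega1")
    case False
    then have "x \<in> S" using that by (intro inS) auto
    then show ?thesis using gh[of x] hS[of x] that False by (auto simp: l_def s_def)
  qed (simp add: s_def l_def)
  have l0: "l x = x0" if "x \<le> x1" for x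
    using that x(2) by (auto simp: l_def)
  have mono: "s a < s b" if "a < b" for a b
  proof -
    have a: "a < omega1" using that Field_omega1_max[of b] by (rule less_le_trans)
    show ?thesis
    proof (cases "b = omega1")
      case True
      then show ?thesis using sne[OF a] by (simp add: s_def)
    next
      case False
      then have b: "b < omega1" using not_less_omega1_iff by blast
      have "a \<noteq> omega1" using a by blast
      then show ?thesis
        using gS[OF a] gS[OF b] h[of "g a" "g b"] that False by (simp add: s_def)
    qed
  qed
  have mono_iff: "s a < s b \<longleftrightarrow> a < b" for a b
    using mono[of a b] mono[of b a] by (cases a b rule: linorder_cases) auto
  \<comment> \<open>This adjunction turns preimages of upper rays under \<open>l\<close> into upper
    rays, as continuity of \<open>l\<close> requires.\<close>
  have gal: "a < l x \<longleftrightarrow> s a < x" for a x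
  proof (cases "x1 < x")
    case True
    then show ?thesis using mono_iff[of a "l x"] sl[of x] by simp
  next
    case False
    then have "l x = x0" "x < s a" using l0[of x] s1[of a] by (simp, order)
    then have "\<not> a < l x" "\<not> s a < x" using x(3)[of a] by auto
    then show ?thesis by blast
  qed
  have lmono: "l a \<le> l b" if "a \<le> b" for a b
  proof (rule ccontr)
    assume "\<not> l a \<le> l b"
    then have "s (l b) < a" using gal[of "l b" a] by (simp add: not_le)
    then have "s (l b) < b" using that by (rule less_le_trans)
    then show False using gal[of "l b" b] by simp
  qed
  have "continuous_on UNIV l"
  proof (rule mono_continuous_wellorder[OF lmono])
    have "{y. a < l y} = {s a<..}" for a using gal by auto
    then show "open {y. a < l y}" for a by simp
  qed
  moreover have "continuous_on UNIV s"
  proof (rule mono_continuous_wellorder)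
    show "s a \<le> s b" if "a \<le> b" for a b
      using that mono[of a b] by (cases "a = b") (simp_all add: order_le_less)
    show "open {b. a < s b}" for a
    proof (cases "x1 < a")
      case True
      then have "{b. a < s b} = {l a<..}" using mono_iff[of "l a"] sl[of a] by auto
      then show ?thesis by simp
    next
      case False
      then have "a < s b" for b using s1[of b] by (simp add: not_less)
      then have "{b. a < s b} = UNIV" by simp
      then show ?thesis by simp
    qed
  qed
  ultimately show ?thesis using ls s1 sl l0 by (intro exI[of _ s] exI[of _ l]) (simp add: s_def l_def)
qed

text \<open>\<open>p f\<close> is 0 at the least point \<open>x0\<close>, stores
  \<open>f omega1\<close> at the second point \<open>x1\<close> and is the shifted function
  \<open>f - f omega1\<close> above; \<open>q\<close> adds the stored value back. The rank-one terms
  are the corrections that \<open>comp_op l\<close> and \<open>comp_op s\<close> need for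
  this.\<close>

lemma hyperplane_isomorphism:
  "\<exists>(p :: (omega1_interval, 'k::real_normed_field) bounded_op) q x0. q * p = 1 \<and> (\<forall>x. x0 \<le> x) \<and> x0 < omega1 \<and>
    (\<forall>f. app p f x0 = 0 \<and> app p f omega1 = 0) \<and>
    (\<forall>g. apply_bcontfun g x0 = 0 \<longrightarrow> apply_bcontfun g omega1 = 0 \<longrightarrow> app (p * q) g = g)"
proof -
  obtain x0 x1 :: omega1_interval where x: "x0 < x1" "x1 < omega1" "\<And>x. x0 \<le> x" "\<And>x. x < x1 \<Longrightarrow> x = x0"
    using two_least_points by blast
  have ord: "x0 \<le> x1" "x0 \<noteq> x1" "\<not> x1 < x0" "\<not> x1 \<le> x0" using x(1) by auto
  obtain s l where c: "continuous_on UNIV s" "continuous_on UNIV l" and ls: "\<And>a. l (s a) = a"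
    and s1: "\<And>a. x1 < s a" and sl: "\<And>x. x1 < x \<Longrightarrow> s (l x) = x" and l0: "\<And>x. x \<le> x1 \<Longrightarrow> l x = x0"
    and top: "s omega1 = omega1" "l omega1 = omega1"
    using shift_by_two[OF x(1-3)] by blast
  define p :: "(omega1_interval, 'k) bounded_op" where
    "p = comp_op l - rank1_op omega1 (step omega1 - step x1) + rank1_op omega1 (step x1 - step x0)
      - rank1_op x0 (step x1)"
  define q :: "(omega1_interval, 'k) bounded_op" where "q = comp_op s + rank1_op x1 (step omega1)"
  have q: "app q f a = f (s a) + f x1" for f a
    by (simp add: q_def c scale_bcontfun_rep_eq step_apply Field_omega1_max)
  have p: "app p f x = (if x1 < x then f (l x) - f omega1 else if x = x1 then f omega1 else 0)" for f x
  proof (cases x x1 rule: linorder_cases)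
    case less
    then have "x = x0" by (rule x(4))
    then show ?thesis using less l0[of x] ord
      by (simp add: p_def c scale_bcontfun_rep_eq step_apply Field_omega1_max)
  next
    case equal
    then show ?thesis using l0[of x] x(1)
      by (simp add: p_def c scale_bcontfun_rep_eq step_apply Field_omega1_max)
  next
    case greater
    have "\<not> x \<le> x0" "\<not> x \<le> x1" using greater x(1) by auto
    then show ?thesis using greater
      by (simp add: p_def c scale_bcontfun_rep_eq step_apply Field_omega1_max)
  qed
  have "q * p = 1"
    using s1 by (intro bounded_op_eqI') (simp add: p q ls)
  moreover have "app p f x0 = 0" for f using ord by (simp add: p)
  moreover have "app p f omega1 = 0" for f using x(2) by (simp add: p top)
  moreover have "app (p * q) g = g" if g: "g x0 = 0" "g omega1 = 0" for g :: "omega1_interval \<Rightarrow>\<^sub>C 'k"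
  proof (rule bcontfun_eqI)
    fix a
    show "app (p * q) g a = g a"
    proof (cases a x1 rule: linorder_cases)
      case less
      then have "a = x0" by (rule x(4))
      then show ?thesis using less g ord by (simp add: p)
    next
      case equal
      then show ?thesis using g by (simp add: p q top)
    next
      case greater
      then show ?thesis using g sl[OF greater] by (simp add: p q top)
    qed
  qed
  moreover have "x0 < omega1" using x(1,2) by (rule less_trans)
  ultimately show ?thesis using x(3) by blast
qed

section \<open>Repeating the gaps of a club\<close>

text \<open>Beyond some \<open>y < x\<close> the values up to \<open>x\<close> stay within
  \<open>e / 2\<close> of \<open>f x\<close>. Adding the cut \<open>y\<close> to the set obtained
  for \<open>y\<close> excludes \<open>a \<le> y < b\<close>, so both points lie on the same side of
  the cut.\<close>

lemma finite_oscillation_points_aux: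
  fixes f :: "omega1_interval \<Rightarrow> 'b::metric_space"
  assumes f: "continuous_on UNIV f" and e: "e > 0"
  shows "\<exists>F. finite F \<and> (\<forall>a b. a \<le> b \<longrightarrow> b \<le> x \<longrightarrow> (\<forall>z\<in>F. \<not> (a \<le> z \<and> z < b)) \<longrightarrow> dist (f a) (f b) < e)"
proof (induction x rule: less_induct)
  case (less x)
  have e2: "0 < e / 2" using e by simp
  show ?case
  proof (rule continuous_left[OF f e2, of x])
    assume x: "\<And>y. x \<le> y"
    have eq: "dist (f a) (f b) < e" if "a \<le> b" "b \<le> x" for a b
    proof -
      have "a = b" using that x[of a] by order
      then show ?thesis using e by simp
    qed
    show ?thesis
      by (intro exI[of _ "{}"] conjI allI impI eq) simp_all
  next
    fix y assume y: "y < x" "\<And>z. y < z \<Longrightarrow> z \<le> x \<Longrightarrow> dist (f z) (f x) < e / 2"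
    obtain F where F: "finite F"
      "\<And>a b. a \<le> b \<Longrightarrow> b \<le> y \<Longrightarrow> (\<forall>z\<in>F. \<not> (a \<le> z \<and> z < b)) \<Longrightarrow> dist (f a) (f b) < e"
      using less.IH[OF y(1)] by blast
    show ?thesis
    proof (intro exI[of _ "insert y F"] conjI allI impI)
      show "finite (insert y F)" using F(1) by simp
      fix a b assume ab: "a \<le> b" "b \<le> x" "\<forall>z\<in>insert y F. \<not> (a \<le> z \<and> z < b)"
      show "dist (f a) (f b) < e"
      proof (cases "b \<le> y")
        case True
        show ?thesis by (rule F(2)[OF ab(1) True]) (use ab(3) in simp)
      next
        case False
        then have b: "y < b" by simp
        have "\<not> (a \<le> y \<and> y < b)" using ab(3) by simp
        then have "y < a" using b by simp
        then have "dist (f a) (f x) < e / 2" using ab(1,2) by (intro y(2)) simp_all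
        moreover have "dist (f b) (f x) < e / 2" using b ab(2) by (intro y(2))
        ultimately show ?thesis by (rule dist_triangle_half_l)
      qed
    qed
  qed
qed

lemma finite_oscillation_points:
  fixes f :: "omega1_interval \<Rightarrow> 'b::metric_space"
  assumes f: "continuous_on UNIV f" and e: "e > 0"
  shows "\<exists>F. finite F \<and> (\<forall>a b. a \<le> b \<longrightarrow> (\<forall>z\<in>F. \<not> (a \<le> z \<and> z < b)) \<longrightarrow> dist (f a) (f b) < e)"
  using finite_oscillation_points_aux[OF f e, of omega1] by (simp add: Field_omega1_max)

text \<open>The least point belongs to \<open>D\<close> so that every point can be rounded down to
  \<open>D\<close>.\<close>

locale based_club =
  fixes D :: "omega1_interval set" and x0 :: omega1_interval
  assumes club: "club D" and x0: "x0 \<in> D" "\<And>x. x0 \<le> x"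
begin

definition up :: "omega1_interval \<Rightarrow> omega1_interval"
  where "up x = (LEAST d. d \<in> D \<and> x \<le> d)"

definition low :: "omega1_interval \<Rightarrow> omega1_interval"
  where "low x = (GREATEST d. d \<in> D \<and> d \<le> x)"

text \<open>Unspecified at \<open>omega1\<close>, above which there is no point.\<close>

definition succ :: "omega1_interval \<Rightarrow> omega1_interval"
  where "succ x = (LEAST d. d \<in> D \<and> x < d)"

lemma top_in: "omega1 \<in> D"
  by (rule top_in_club[OF club])

lemma up_in: "up x \<in> D" and up_ge: "x \<le> up x"
  and up_le: "d \<in> D \<Longrightarrow> x \<le> d \<Longrightarrow> up x \<le> d"
proof -
  have "up x \<in> D \<and> x \<le> up x"
    unfolding up_def by (rule LeastI[of _ omega1]) (simp add: top_in Field_omega1_max)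
  then show "up x \<in> D" "x \<le> up x" by auto
  show "d \<in> D \<Longrightarrow> x \<le> d \<Longrightarrow> up x \<le> d" unfolding up_def by (rule Least_le) simp
qed

lemma up_id: "d \<in> D \<Longrightarrow> up d = d"
  using up_le[of d d] up_ge[of d] by auto

text \<open>Unlike a least element, a greatest one needs the closedness of \<open>D\<close>: the set
  \<open>D \<inter> {..x}\<close> is compact and attains its supremum.\<close>

lemma low_in: "low x \<in> D" and low_le: "low x \<le> x"
  and low_ge: "d \<in> D \<Longrightarrow> d \<le> x \<Longrightarrow> d \<le> low x"
proof -
  have "closed (D \<inter> {..x})" using club unfolding club_def by (intro closed_Int) auto
  then have "compact (D \<inter> {..x})"
    using compact_Int_closed[OF compact_omega1_interval, of "D \<inter> {..x}"] by simp
  moreover have "D \<inter> {..x} \<noteq> {}" using x0 by auto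
  ultimately obtain m where m: "m \<in> D \<inter> {..x}" "\<And>d. d \<in> D \<inter> {..x} \<Longrightarrow> d \<le> m"
    using compact_attains_sup[of "D \<inter> {..x}"] by blast
  have "low x = m" unfolding low_def using m by (intro Greatest_equality) auto
  then show "low x \<in> D" "low x \<le> x" "d \<in> D \<Longrightarrow> d \<le> x \<Longrightarrow> d \<le> low x" using m by auto
qed

lemma low_id: "d \<in> D \<Longrightarrow> low d = d"
  using low_ge[of d d] low_le[of d] by auto

lemma less_low: "low a < low b \<Longrightarrow> a < low b"
  using low_ge[OF low_in, of b a] by (meson not_le)

lemma succ_in: "a < omega1 \<Longrightarrow> succ a \<in> D" and succ_gt: "a < omega1 \<Longrightarrow> a < succ a"
  and succ_le: "d \<in> D \<Longrightarrow> a < d \<Longrightarrow> succ a \<le> d"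
proof -
  show *: "d \<in> D \<Longrightarrow> a < d \<Longrightarrow> succ a \<le> d" for d unfolding succ_def by (rule Least_le) simp
  assume a: "a < omega1"
  have "succ a \<in> D \<and> a < succ a"
    unfolding succ_def by (rule LeastI[of _ omega1]) (simp add: top_in a)
  then show "succ a \<in> D" "a < succ a" by auto
qed

lemma succ_less: assumes "a < omega1" shows "succ a < omega1"
proof -
  obtain d where "d \<in> D" "a < d" "d < omega1" using club assms by (rule clubE)
  then show ?thesis using succ_le[of d a] le_less_trans by blast
qed

lemma less_succ_iff: "a < omega1 \<Longrightarrow> b < succ a \<longleftrightarrow> low b \<le> low a"
proof
  assume a: "a < omega1"
  show "low b \<le> low a" if "b < succ a"
  proof (rule low_ge[OF low_in])
    have "\<not> a < low b" using succ_le[OF low_in, of a b] low_le[of b] that by auto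
    then show "low b \<le> a" by simp
  qed
  show "b < succ a" if "low b \<le> low a"
  proof (rule ccontr)
    assume "\<not> b < succ a"
    then have "succ a \<le> low b" using succ_in[OF a] by (intro low_ge) auto
    then show False using that low_le[of a] succ_gt[OF a] by order
  qed
qed

lemma succ_eq: assumes "a < omega1" "b < omega1" "low a = low b" shows "succ a = succ b"
proof (rule antisym)
  show "succ a \<le> succ b" using less_succ_iff[of b a] assms by (intro succ_le succ_in) auto
  show "succ b \<le> succ a" using less_succ_iff[of a b] assms by (intro succ_le succ_in) auto
qed

lemma succ_le_low: "low a < low b \<Longrightarrow> succ a \<le> low b"
  using less_low low_in by (intro succ_le)

lemma up_continuous: "continuous_on UNIV up"
proof (rule mono_continuous_wellorder)
  show "up x \<le> up y" if "x \<le> y" for x y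
    using that up_ge[of y] by (intro up_le up_in) order
  \<comment> \<open>Rounding up and rounding down are adjoint, so preimages of upper rays under
    \<open>up\<close> are upper rays.\<close>
  have "a < up y \<longleftrightarrow> low a < y" for a y
  proof
    show "low a < y" if "a < up y"
      using up_le[OF low_in, of y a] low_le[of a] that by (meson leD le_less_trans not_le)
    show "a < up y" if "low a < y"
      using low_ge[OF up_in, of y a] up_ge[of y] that by (meson leD le_less_trans not_le)
  qed
  then have "{y. a < up y} = {low a<..}" for a by auto
  then show "open {y. a < up y}" for a by simp
qed

text \<open>
  The blocks \<open>{d..<succ d}\<close>, \<open>d \<in> D\<close>, are each repeated \<open>\<omega>\<close> times: \<open>code (a, m)\<close> is the position of
  the \<open>m\<close>-th copy of \<open>a\<close> in the resulting well-order, which again has type \<open>\<omega>\<^sub>1\<close>.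
\<close>
definition lexrel :: "((omega1_interval \<times> nat) \<times> (omega1_interval \<times> nat)) set"
  where "lexrel = {((a, m), (b, n)). low a < low b \<or> low a = low b \<and> (m < n \<or> m = n \<and> a < b)}"

lemma lexrel_iff:
  "((a, m), (b, n)) \<in> lexrel \<longleftrightarrow> low a < low b \<or> low a = low b \<and> (m < n \<or> m = n \<and> a < b)"
  by (simp add: lexrel_def)

lemma wf_lexrel: "wf lexrel"
proof (rule wf_subset)
  let ?R = "inv_image ({(a, b). a < b} <*lex*> ({(a, b). a < b} <*lex*> {(a, b). a < b}))
    (\<lambda>(a :: omega1_interval, m :: nat). (low a, m, a))"
  show "wf ?R" by (rule wf_inv_image[OF wf_lex_prod[OF wf wf_lex_prod[OF wf wf]]])
  show "lexrel \<subseteq> ?R"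
  proof (rule subrelI)
    fix p q :: "omega1_interval \<times> nat" assume "(p, q) \<in> lexrel"
    moreover obtain a m where "p = (a, m)" by (rule prod.exhaust)
    moreover obtain b n where "q = (b, n)" by (rule prod.exhaust)
    ultimately show "(p, q) \<in> ?R" by (simp add: lexrel_iff)
  qed
qed

lemma trans_lexrel: "trans lexrel"
proof (rule transI)
  fix p q r assume "(p, q) \<in> lexrel" "(q, r) \<in> lexrel"
  moreover obtain a k where "p = (a, k)" by (rule prod.exhaust)
  moreover obtain b m where "q = (b, m)" by (rule prod.exhaust)
  moreover obtain c n where "r = (c, n)" by (rule prod.exhaust)
  ultimately show "(p, r) \<in> lexrel" by (auto simp: lexrel_iff)
qed

lemma total_lexrel: "s \<noteq> t \<Longrightarrow> (s, t) \<in> lexrel \<or> (t, s) \<in> lexrel"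
  by (cases s; cases t) (simp only: lexrel_iff prod.inject, metis linorder_neqE)

lemma uncountable_codes: "uncountable ({..<omega1} \<times> (UNIV :: nat set))"
proof
  assume "countable ({..<omega1} \<times> (UNIV :: nat set))"
  then have "countable (fst ` ({..<omega1} \<times> (UNIV :: nat set)))" by (rule countable_image)
  then show False using uncountable_lessThan_omega1 by simp
qed

text \<open>Predecessors lie in blocks up to that of \<open>a\<close>, hence below
  \<open>succ a\<close>, which is a countable ordinal because \<open>D\<close> is unbounded below
  \<open>omega1\<close>; taking \<omega> copies keeps this countable.\<close>

lemma countable_lexrel_below:
  assumes "s \<in> {..<omega1} \<times> UNIV" shows "countable {t \<in> {..<omega1} \<times> UNIV. (t, s) \<in> lexrel}"
proof -
  obtain a m where s: "s = (a, m)" "a < omega1" using assms by (cases s) simp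
  have "{t \<in> {..<omega1} \<times> UNIV. (t, s) \<in> lexrel} \<subseteq> {..succ a} \<times> UNIV"
  proof
    fix t assume "t \<in> {t \<in> {..<omega1} \<times> UNIV. (t, s) \<in> lexrel}"
    then have "(t, s) \<in> lexrel" by simp
    then have "low (fst t) \<le> low a" unfolding s by (cases t) (auto simp: lexrel_iff)
    then have "fst t < succ a" using less_succ_iff[OF s(2)] by blast
    then show "t \<in> {..succ a} \<times> UNIV" by (cases t) simp
  qed
  moreover have "countable ({..succ a} \<times> (UNIV :: nat set))"
    using countable_atMost_omega1[OF succ_less[OF s(2)]] by simp
  ultimately show ?thesis by (rule countable_subset)
qed

lemma coding_exists:
  "\<exists>h. bij_betw h ({..<omega1} \<times> UNIV) {..<omega1} \<and>
    (\<forall>s\<in>{..<omega1} \<times> UNIV. \<forall>t\<in>{..<omega1} \<times> UNIV. (s, t) \<in> lexrel \<longleftrightarrow> h s < h t)"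
  by (rule order_iso_omega1[OF wf_lexrel trans_lexrel total_lexrel uncountable_codes countable_lexrel_below])

definition code :: "omega1_interval \<times> nat \<Rightarrow> omega1_interval"
  where "code = (SOME h. bij_betw h ({..<omega1} \<times> UNIV) {..<omega1} \<and>
    (\<forall>s\<in>{..<omega1} \<times> UNIV. \<forall>t\<in>{..<omega1} \<times> UNIV. (s, t) \<in> lexrel \<longleftrightarrow> h s < h t))"

lemma code_bij: "bij_betw code ({..<omega1} \<times> UNIV) {..<omega1}"
  and code_less: "a < omega1 \<Longrightarrow> b < omega1 \<Longrightarrow> code (a, m) < code (b, n) \<longleftrightarrow>
    low a < low b \<or> low a = low b \<and> (m < n \<or> m = n \<and> a < b)"
proof -
  have *: "bij_betw code ({..<omega1} \<times> UNIV) {..<omega1} \<and>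
    (\<forall>s\<in>{..<omega1} \<times> UNIV. \<forall>t\<in>{..<omega1} \<times> UNIV. (s, t) \<in> lexrel \<longleftrightarrow> code s < code t)"
    unfolding code_def by (rule someI_ex[OF coding_exists])
  then show "bij_betw code ({..<omega1} \<times> UNIV) {..<omega1}" by blast
  assume "a < omega1" "b < omega1"
  then have "((a, m), (b, n)) \<in> lexrel \<longleftrightarrow> code (a, m) < code (b, n)" using * by blast
  then show "code (a, m) < code (b, n) \<longleftrightarrow> low a < low b \<or> low a = low b \<and> (m < n \<or> m = n \<and> a < b)"
    by (simp add: lexrel_def)
qed

lemma code_lt: "a < omega1 \<Longrightarrow> code (a, m) < omega1"
  using bij_betwE[OF code_bij] by auto

lemma code_cases:
  assumes "y < omega1" shows "\<exists>a m. a < omega1 \<and> y = code (a, m)"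
proof -
  have "y \<in> code ` ({..<omega1} \<times> UNIV)" using bij_betw_imp_surj_on[OF code_bij] assms by simp
  then show ?thesis by auto
qed

text \<open>\<open>project n\<close> collapses all copies but the \<open>n\<close>-th one to points of \<open>D\<close>.\<close>
definition project :: "nat \<Rightarrow> omega1_interval \<Rightarrow> omega1_interval"
  where "project n y = (if y = omega1 then omega1 else
    case inv_into ({..<omega1} \<times> UNIV) code y of (a, m) \<Rightarrow>
      if m < n then low a else if m = n then a else succ a)"

lemma project_top: "project n omega1 = omega1"
  by (simp add: project_def)

lemma project_code:
  assumes "a < omega1"
  shows "project n (code (a, m)) = (if m < n then low a else if m = n then a else succ a)"
proof -
  have "inv_into ({..<omega1} \<times> UNIV) code (code (a, m)) = (a, m)"
    using code_bij assms by (intro inv_into_f_f) (auto simp: bij_betw_def)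
  moreover have "code (a, m) \<noteq> omega1" using code_lt[OF assms, of m] by (metis order_less_irrefl)
  ultimately show ?thesis by (simp add: project_def)
qed

lemma project_bounds:
  assumes "a < omega1"
  shows "low a \<le> project n (code (a, m))" "project n (code (a, m)) \<le> succ a"
  using low_le[of a] succ_gt[OF assms] project_code[OF assms, of n m] by auto

text \<open>Across blocks, the block of \<open>a\<close> is sent to at most
  \<open>succ a \<le> low b\<close>. Within a block, the values rise from \<open>low\<close> through
  the chosen copy to \<open>succ\<close>, and both ends are constant on the block.\<close>

lemma project_mono: assumes "y \<le> z" shows "project n y \<le> project n z"
proof (cases "z = omega1")
  case True
  then show ?thesis by (simp add: project_top Field_omega1_max)
next
  case False
  then have z: "z < omega1" using not_less_omega1_iff by blast
  then have "y < omega1" using assms by (rule le_less_trans[rotated])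
  then obtain a m where a: "a < omega1" "y = code (a, m)" using code_cases by blast
  obtain b k where b: "b < omega1" "z = code (b, k)" using code_cases[OF z] by blast
  show ?thesis
  proof (cases "y = z")
    case False
    then have "code (a, m) < code (b, k)" using assms a b by auto
    then consider "low a < low b" | "low a = low b" "m < k" | "low a = low b" "m = k" "a < b"
      using code_less[OF a(1) b(1)] by auto
    then show ?thesis
    proof cases
      case 1
      have "project n y \<le> succ a" unfolding a(2) by (rule project_bounds[OF a(1)])
      also have "\<dots> \<le> low b" using 1 by (rule succ_le_low)
      also have "\<dots> \<le> project n z" unfolding b(2) by (rule project_bounds[OF b(1)])
      finally show ?thesis .
    next
      case 2
      have "succ a = succ b" using a b 2 by (intro succ_eq)
      then show ?thesis using 2 low_le[of a] low_le[of b] succ_gt[OF a(1)] succ_gt[OF b(1)] a b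
        by (auto simp: project_code less_imp_le)
    next
      case 3
      have "succ a = succ b" using a b 3 by (intro succ_eq)
      then show ?thesis using 3 a b by (simp add: project_code less_imp_le)
    qed
  qed simp
qed

lemma less_project_iff: assumes a: "a < omega1" shows "a < project n y \<longleftrightarrow> code (a, n) < y"
proof
  show "code (a, n) < y" if "a < project n y"
  proof (rule ccontr)
    assume "\<not> code (a, n) < y"
    then have "project n y \<le> project n (code (a, n))" by (intro project_mono) simp
    then show False using that project_code[OF a, of n n] by simp
  qed
  assume y: "code (a, n) < y"
  show "a < project n y"
  proof (cases "y = omega1")
    case True
    then show ?thesis using a by (simp add: project_top)
  next
    case False
    then have "y < omega1" using not_less_omega1_iff by blast
    then obtain b m where b: "b < omega1" "y = code (b, m)" using code_cases by blast
    consider "low a < low b" | "low a = low b" "n < m" | "low a = low b" "n = m" "a < b"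
      using code_less[OF a b(1)] y b(2) by auto
    then show ?thesis
    proof cases
      case 1
      show ?thesis using less_low[OF 1] project_bounds(1)[OF b(1), of n m] unfolding b(2) by order
    next
      case 2
      have "succ a = succ b" using a b 2 by (intro succ_eq)
      then show ?thesis using 2 b succ_gt[OF a] by (simp add: project_code)
    next
      case 3
      then show ?thesis using b by (simp add: project_code)
    qed
  qed
qed

lemma project_continuous: "continuous_on UNIV (project n)"
proof (rule mono_continuous_wellorder[OF project_mono])
  fix a
  show "open {y. a < project n y}"
  proof (cases "a = omega1")
    case True
    then have "{y. a < project n y} = {}" using Field_omega1_max leD by blast
    then show ?thesis by simp
  next
    case False
    then have "{y. a < project n y} = {code (a, n)<..}" using less_project_iff not_less_omega1_iff by blast
    then show ?thesis by simp
  qed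
qed

lemma project_code_in: "a < omega1 \<Longrightarrow> m \<noteq> n \<Longrightarrow> project n (code (a, m)) \<in> D"
  by (simp add: project_code low_in succ_in)

text \<open>A point below \<open>omega1\<close> belongs to exactly one copy, and all other
  projections send it into \<open>D\<close>. This makes the supports belonging to different copies
  disjoint.\<close>

lemma project_notin_unique: assumes "project m y \<notin> D" "project n y \<notin> D" shows "m = n"
proof (rule ccontr)
  assume ne: "m \<noteq> n"
  have "y \<noteq> omega1" using assms(1) top_in by (auto simp: project_top)
  then have "y < omega1" using not_less_omega1_iff by blast
  then obtain a k where a: "a < omega1" "y = code (a, k)" using code_cases by blast
  have "k = m" "k = n" using assms project_code_in[OF a(1)] unfolding a(2) by blast+
  then show False using ne by simp
qed

text \<open>The lower adjoint of \<open>project n\<close>. The more obvious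
  \<open>code (a, n)\<close> may jump at points of \<open>D\<close>; the least preimage places the
  right end \<open>succ a\<close> of a gap directly after the \<open>n\<close>-th copy of that
  gap.\<close>

definition embed :: "nat \<Rightarrow> omega1_interval \<Rightarrow> omega1_interval"
  where "embed n a = (LEAST y. a \<le> project n y)"

lemma embed_le_iff: "embed n a \<le> y \<longleftrightarrow> a \<le> project n y"
proof
  show "embed n a \<le> y" if "a \<le> project n y" using that unfolding embed_def by (rule Least_le)
  have "a \<le> project n (embed n a)"
    unfolding embed_def by (rule LeastI[of _ omega1]) (simp add: project_top Field_omega1_max)
  then show "a \<le> project n y" if "embed n a \<le> y" using project_mono[OF that, of n] by order
qed

lemma less_embed_iff: "y < embed n a \<longleftrightarrow> project n y < a"
  using embed_le_iff[of n a y] by (simp add: linorder_not_le[symmetric] del: linorder_not_le)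

lemma embed_continuous: "continuous_on UNIV (embed n)"
proof (rule mono_continuous_wellorder)
  show "embed n a \<le> embed n b" if "a \<le> b" for a b
    using embed_le_iff[of n b "embed n b"] that by (auto simp: embed_le_iff)
  have "{a. y < embed n a} = {project n y<..}" for y using less_embed_iff by auto
  then show "open {a. y < embed n a}" for y by simp
qed

lemma project_embed: "project n (embed n a) = a"
proof (cases "a = omega1")
  case True
  then show ?thesis using embed_le_iff[of n omega1 "embed n omega1"] by simp
next
  case False
  then have a: "a < omega1" using not_less_omega1_iff by blast
  have c: "project n (code (a, n)) = a" using project_code[OF a, of n n] by simp
  then have "embed n a \<le> code (a, n)" by (simp add: embed_le_iff)
  then have "project n (embed n a) \<le> a" using project_mono[of _ _ n] c by metis
  then show ?thesis using embed_le_iff[of n a "embed n a"] by auto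
qed

text \<open>If \<open>embed n d\<close> were strictly inside a gap of another copy, the start
  \<open>code (low b, m)\<close> of that copy would be a smaller point with the same
  \<open>n\<close>-th projection, contrary to minimality.\<close>

lemma project_embed_in: assumes d: "d \<in> D" shows "project m (embed n d) \<in> D"
proof (cases "embed n d = omega1")
  case True
  then show ?thesis by (simp add: project_top top_in)
next
  case False
  then have "embed n d < omega1" using not_less_omega1_iff by blast
  then obtain b k where b: "b < omega1" "embed n d = code (b, k)" using code_cases by blast
  show ?thesis
  proof (cases "k = m \<and> m \<noteq> n \<and> b \<notin> D")
    case False
    then show ?thesis
      using project_code_in[OF b(1), of k m] project_embed[of n d] d project_code[OF b(1), of m k] b(2) by auto
  next
    case True
    have lb: "low b < omega1" using low_le[of b] b(1) by (rule le_less_trans)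
    have "low b \<noteq> b" using True low_in by metis
    then have "low b < b" using low_le[of b] by order
    then have "code (low b, m) < embed n d"
      using code_less[OF lb b(1)] True b(2) low_id[OF low_in] by simp
    moreover have "project n (code (low b, m)) = project n (code (b, m))"
      using project_code[OF lb, of n m] project_code[OF b(1), of n m] True
        succ_eq[OF lb b(1)] low_id[OF low_in] by simp
    then have "project n (code (low b, m)) = d" using project_embed[of n d] b(2) True by simp
    then have "embed n d \<le> code (low b, m)" by (simp add: embed_le_iff)
    ultimately show ?thesis by order
  qed
qed

text \<open>For \<open>a\<close> in \<open>D\<close> this is the previous fact; otherwise
  \<open>embed n a\<close> is inside the \<open>n\<close>-th copy, which all other projections
  collapse.\<close>

lemma project_embed_in': assumes "m \<noteq> n" shows "project m (embed n a) \<in> D"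
  using project_embed_in[of a m n] project_notin_unique[of n "embed n a" m] assms project_embed[of n a] by metis

text \<open>A large oscillation between \<open>embed n a\<close> and \<open>embed n (up a)\<close>
  traps one of finitely many cuts \<open>z\<close>. Its projection lies in
  \<open>{a..<up a}\<close>, hence outside \<open>D\<close>, and so \<open>z\<close> determines
  \<open>n\<close>.\<close>

lemma finite_large_gaps:
  fixes f :: "omega1_interval \<Rightarrow> 'b::metric_space"
  assumes f: "continuous_on UNIV f" and e: "e > 0"
  shows "finite {n. \<exists>a. \<not> dist (f (embed n a)) (f (embed n (up a))) < e}"
proof -
  obtain F where F: "finite F"
    "\<forall>a b. a \<le> b \<longrightarrow> (\<forall>z\<in>F. \<not> (a \<le> z \<and> z < b)) \<longrightarrow> dist (f a) (f b) < e"
    using finite_oscillation_points[OF f e] by blast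
  have "{n. \<exists>a. \<not> dist (f (embed n a)) (f (embed n (up a))) < e} \<subseteq> (\<Union>z\<in>F. {n. project n z \<notin> D})"
  proof
    fix n assume "n \<in> {n. \<exists>a. \<not> dist (f (embed n a)) (f (embed n (up a))) < e}"
    then obtain a where a: "\<not> dist (f (embed n a)) (f (embed n (up a))) < e" by blast
    have "embed n a \<le> embed n (up a)" unfolding embed_le_iff project_embed by (rule up_ge)
    then have "\<not> (\<forall>z\<in>F. \<not> (embed n a \<le> z \<and> z < embed n (up a)))" using F(2)[rule_format] a by metis
    then obtain z where z: "z \<in> F" "embed n a \<le> z" "z < embed n (up a)" by blast
    have "a \<le> project n z" "project n z < up a" using z(2,3) by (simp_all add: embed_le_iff less_embed_iff)
    then have "project n z \<notin> D" using up_le[of "project n z" a] by auto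
    then show "n \<in> (\<Union>z\<in>F. {n. project n z \<notin> D})" using z(1) by blast
  qed
  moreover have "finite {n. project n z \<notin> D}" for z
  proof (cases "\<exists>n. project n z \<notin> D")
    case True
    then obtain n where "project n z \<notin> D" by blast
    then have "{n. project n z \<notin> D} \<subseteq> {n}" using project_notin_unique by blast
    then show ?thesis by (rule finite_subset) simp
  qed simp
  then have "finite (\<Union>z\<in>F. {n. project n z \<notin> D})" using F(1) by blast
  ultimately show ?thesis by (rule finite_subset)
qed

end

section \<open>Operators acting on the gaps\<close>

lemma Cauchy_bcontfun_convergent:
  fixes f :: "nat \<Rightarrow> 'x::topological_space \<Rightarrow>\<^sub>C 'b::complete_space"
  assumes "Cauchy f"
  shows "convergent f"
proof -
  obtain g where "uniform_limit UNIV (\<lambda>n. apply_bcontfun (f n)) g sequentially"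
    using uniformly_convergent_eq_cauchy[of "\<lambda>_. True" "\<lambda>n. apply_bcontfun (f n)"] assms
    unfolding Cauchy_def uniform_limit_sequentially_iff
    by (metis dist_fun_lt_imp_dist_val_lt)
  from uniform_limit_bcontfunE[OF this sequentially_bot]
  obtain h where "g = apply_bcontfun h" "f \<longlonglongrightarrow> h" by metis
  then show ?thesis by (intro convergentI)
qed

lemma summable_bcontfun_Cauchy:
  fixes f :: "nat \<Rightarrow> 'x::topological_space \<Rightarrow>\<^sub>C 'b::{real_normed_vector, complete_space}"
  assumes f: "\<And>e. e > 0 \<Longrightarrow> \<exists>N. \<forall>m\<ge>N. \<forall>n. norm (sum f {m..<n}) < e"
  shows "summable f"
  unfolding summable_iff_convergent
proof (rule Cauchy_bcontfun_convergent, rule CauchyI)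
  fix e :: real assume "0 < e"
  then obtain N where N: "\<And>m n. m \<ge> N \<Longrightarrow> norm (sum f {m..<n}) < e" using f by blast
  have *: "norm (sum f {..<m} - sum f {..<n}) < e" if "n \<ge> N" "n \<le> m" for m n
    using N[OF that(1), of m] sum_diff_nat_ivl[of 0 n m f] that(2) by (simp add: lessThan_atLeast0)
  have "norm (sum f {..<m} - sum f {..<n}) < e" if "m \<ge> N" "n \<ge> N" for m n
    using *[of n m] *[of m n] that by (cases "n \<le> m") (simp_all add: norm_minus_commute)
  then show "\<exists>M. \<forall>m\<ge>M. \<forall>n\<ge>M. norm (sum f {..<m} - sum f {..<n}) < e" by blast
qed

context based_club begin

text \<open>
  \<open>gap_embed n\<close> places a function vanishing on \<open>D\<close> on the \<open>n\<close>-th copies of the gaps and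
  \<open>gap_restrict n\<close> reads it off again.
\<close>
definition gap_proj :: "(omega1_interval, 'k::real_normed_field) bounded_op"
  where "gap_proj = 1 - comp_op up"

definition gap_embed :: "nat \<Rightarrow> (omega1_interval, 'k::real_normed_field) bounded_op"
  where "gap_embed n = comp_op (project n) - comp_op (\<lambda>x. up (project n x))"

definition gap_restrict :: "nat \<Rightarrow> (omega1_interval, 'k::real_normed_field) bounded_op"
  where "gap_restrict n = comp_op (embed n) - comp_op (\<lambda>x. embed n (up x))"

lemma app_gap_proj: "app gap_proj f x = f x - f (up x)"
  by (simp add: gap_proj_def up_continuous)

lemma app_gap_embed: "app (gap_embed n) f x = f (project n x) - f (up (project n x))"
proof -
  have "continuous_on UNIV (\<lambda>x. up (project n x))"
    by (rule continuous_on_compose2[OF up_continuous project_continuous]) simp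
  then show ?thesis by (simp add: gap_embed_def project_continuous)
qed

lemma app_gap_restrict: "app (gap_restrict n) f x = f (embed n x) - f (embed n (up x))"
proof -
  have "continuous_on UNIV (\<lambda>x. embed n (up x))"
    by (rule continuous_on_compose2[OF embed_continuous up_continuous]) simp
  then show ?thesis by (simp add: gap_restrict_def embed_continuous)
qed

text \<open>For \<open>m \<noteq> n\<close> the points reached by \<open>embed m\<close> project
  into \<open>D\<close>, where the embedded function vanishes. For \<open>m = n\<close> the
  projection inverts the embedding, and only the subtraction of the rounded function, built into
  both operators, remains.\<close>

lemma gap_restrict_embed: "gap_restrict m * gap_embed n = (if m = n then gap_proj else 0)"
proof (intro bounded_op_eqI')
  fix f :: "omega1_interval \<Rightarrow>\<^sub>C 'a" and x
  have "up (project n (embed m (up x))) = project n (embed m (up x))"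
    by (intro up_id project_embed_in up_in)
  moreover have "up (project n (embed m x)) = project n (embed m x)" if "m \<noteq> n"
    using that by (intro up_id project_embed_in') simp
  ultimately show "app (gap_restrict m * gap_embed n) f x = app (if m = n then gap_proj else 0) f x"
    by (simp add: app_gap_restrict app_gap_embed app_gap_proj project_embed)
qed

lemma gap_embed_nonzero: "app (gap_embed n) f x \<noteq> 0 \<Longrightarrow> project n x \<notin> D"
  by (auto simp: app_gap_embed up_id)

lemma gap_proj_idem: "gap_proj * gap_proj = gap_proj"
  by (intro bounded_op_eqI') (simp add: app_gap_proj up_id up_in)

lemma norm_gap_embed: "norm (app (gap_embed n) f) \<le> 2 * norm f"
proof (rule norm_bound)
  fix x
  have "norm (app (gap_embed n) f x) \<le> norm (f (project n x)) + norm (f (up (project n x)))"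
    unfolding app_gap_embed by (rule norm_triangle_ineq4)
  also have "\<dots> \<le> norm f + norm f" by (intro add_mono norm_bounded)
  finally show "norm (app (gap_embed n) f x) \<le> 2 * norm f" by simp
qed

lemma norm_gap_restrict: "norm (app (gap_restrict n) f) \<le> 2 * norm f"
proof (rule norm_bound)
  fix x
  have "norm (app (gap_restrict n) f x) \<le> norm (f (embed n x)) + norm (f (embed n (up x)))"
    unfolding app_gap_restrict by (rule norm_triangle_ineq4)
  also have "\<dots> \<le> norm f + norm f" by (intro add_mono norm_bounded)
  finally show "norm (app (gap_restrict n) f x) \<le> 2 * norm f" by simp
qed

text \<open>Only finitely many copies carry a large oscillation of \<open>f\<close>. This decay
  makes the infinite sums over all copies converge in norm.\<close>

lemma gap_restrict_tendsto: "(\<lambda>n. app (gap_restrict n) f) \<longlonglongrightarrow> 0"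
proof (rule LIMSEQ_I)
  fix e :: real assume e: "0 < e"
  then have "0 < e / 2" by simp
  then have "finite {n. \<exists>a. \<not> dist (f (embed n a)) (f (embed n (up a))) < e / 2}"
    by (rule finite_large_gaps[OF continuous_on_apply_bcontfun])
  then obtain N where N: "\<And>n. n \<in> {n. \<exists>a. \<not> dist (f (embed n a)) (f (embed n (up a))) < e / 2} \<Longrightarrow> n < N"
    unfolding finite_nat_set_iff_bounded by blast
  have "norm (app (gap_restrict n) f - 0) < e" if "n \<ge> N" for n
  proof -
    have "dist (f (embed n a)) (f (embed n (up a))) < e / 2" for a
      using N[of n] that by fastforce
    then have "norm (app (gap_restrict n) f) \<le> e / 2"
      by (intro norm_bound) (simp add: app_gap_restrict dist_norm less_imp_le)
    then show ?thesis using e by simp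
  qed
  then show "\<exists>N. \<forall>n\<ge>N. norm (app (gap_restrict n) f - 0) < e" by blast
qed

text \<open>The supports are disjoint, so the bound does not grow with \<open>A\<close>; the factor
  2 is that of \<open>norm_gap_embed\<close>.\<close>

lemma norm_sum_gap_embed:
  assumes "\<And>n. n \<in> A \<Longrightarrow> norm (g n) \<le> C" "0 \<le> C"
  shows "norm (\<Sum>n\<in>A. app (gap_embed (n + k)) (g n)) \<le> 2 * C"
proof (rule norm_bound)
  fix x
  have ev: "(\<Sum>n\<in>A. app (gap_embed (n + k)) (g n)) x = (\<Sum>n\<in>A. app (gap_embed (n + k)) (g n) x)"
    by (induction A rule: infinite_finite_induct) simp_all
  show "norm ((\<Sum>n\<in>A. app (gap_embed (n + k)) (g n)) x) \<le> 2 * C"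
    unfolding ev
  proof (rule norm_sum_disjoint_le)
    show "i = j" if "app (gap_embed (i + k)) (g i) x \<noteq> 0" "app (gap_embed (j + k)) (g j) x \<noteq> 0" for i j
      using project_notin_unique[OF gap_embed_nonzero[OF that(1)] gap_embed_nonzero[OF that(2)]] by simp
    show "norm (app (gap_embed (i + k)) (g i) x) \<le> 2 * C" if "i \<in> A" for i
    proof -
      have "norm (app (gap_embed (i + k)) (g i) x) \<le> norm (app (gap_embed (i + k)) (g i))" by (rule norm_bounded)
      also have "\<dots> \<le> 2 * norm (g i)" by (rule norm_gap_embed)
      also have "\<dots> \<le> 2 * C" using assms(1)[OF that] by simp
      finally show ?thesis .
    qed
    show "0 \<le> 2 * C" using assms(2) by simp
  qed
qed

lemma summable_gap_embed:
  fixes g :: "nat \<Rightarrow> omega1_interval \<Rightarrow>\<^sub>C 'k::{real_normed_field, banach}"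
  assumes g: "g \<longlonglongrightarrow> 0"
  shows "summable (\<lambda>n. app (gap_embed (n + k)) (g n))"
proof (rule summable_bcontfun_Cauchy)
  fix e :: real assume e: "0 < e"
  \<comment> \<open>The partial sums are bounded by twice the terms, and \<open>e / 3\<close> leaves
    the final inequality strict.\<close>
  then have "0 < e / 3" by simp
  then obtain N where N: "\<And>n. n \<ge> N \<Longrightarrow> norm (g n) < e / 3"
    using LIMSEQ_D[OF g, of "e / 3"] by auto
  have "norm (\<Sum>n = m..<n. app (gap_embed (n + k)) (g n)) < e" if "m \<ge> N" for m n
  proof -
    have "norm (\<Sum>n = m..<n. app (gap_embed (n + k)) (g n)) \<le> 2 * (e / 3)"
      using N that e by (intro norm_sum_gap_embed) (auto simp: less_imp_le)
    also have "\<dots> < e" using e by simp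
    finally show ?thesis .
  qed
  then show "\<exists>N. \<forall>m\<ge>N. \<forall>n. norm (\<Sum>n = m..<n. app (gap_embed (n + k)) (g n)) < e" by blast
qed

text \<open>For \<open>k = l\<close> this is the infinite amplification of \<open>T\<close> over the
  copies from \<open>k\<close> on; different indices shift the copies. The shifts between 0 and 1
  drive the swindle.\<close>

definition replicate_op :: "nat \<Rightarrow> nat \<Rightarrow> (omega1_interval, 'k::{real_normed_field, banach}) bounded_op \<Rightarrow>
    (omega1_interval, 'k) bounded_op"
  where "replicate_op k l T =
    Op (\<lambda>f. \<Sum>n. app (gap_embed (n + k)) (app T (app (gap_restrict (n + l)) f)))"

lemma gap_restrict_tendsto':
  "(\<lambda>n. app T (app (gap_restrict (n + l)) f)) \<longlonglongrightarrow> 0"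
proof -
  have "(\<lambda>n. app (gap_restrict (n + l)) f) \<longlonglongrightarrow> 0"
    by (rule LIMSEQ_ignore_initial_segment[OF gap_restrict_tendsto])
  then have "(\<lambda>n. app T (app (gap_restrict (n + l)) f)) \<longlonglongrightarrow> app T 0"
    by (rule blinfun.tendsto[OF tendsto_const])
  then show ?thesis by (simp add: blinfun.zero_right)
qed

lemma replicate_summable:
  fixes T :: "(omega1_interval, 'k::{real_normed_field, banach}) bounded_op"
  shows "summable (\<lambda>n. app (gap_embed (n + k)) (app T (app (gap_restrict (n + l)) f)))"
  by (rule summable_gap_embed[OF gap_restrict_tendsto'])

lemma app_suminf:
  fixes T :: "('x::topological_space, 'k::{real_normed_field, banach}) bounded_op"
  shows "summable g \<Longrightarrow> app T (\<Sum>n. g n) = (\<Sum>n. app T (g n))"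
  by (rule bounded_linear.suminf[OF blinfun.bounded_linear_right])

lemma app_replicate_op:
  fixes T :: "(omega1_interval, 'k::{real_normed_field, banach}) bounded_op"
  shows "app (replicate_op k l T) f =
    (\<Sum>n. app (gap_embed (n + k)) (app T (app (gap_restrict (n + l)) f)))"
  unfolding replicate_op_def
\<comment> \<open>The constant 4 collects a factor 2 from \<open>gap_embed\<close> and another from
  \<open>gap_restrict\<close>.\<close>
proof (rule app_Op[where C = "4 * norm (blinfun_of T)"])
  let ?t = "\<lambda>f n. app (gap_embed (n + k)) (app T (app (gap_restrict (n + l)) f))"
  show "(\<Sum>n. ?t (f + g) n) = (\<Sum>n. ?t f n) + (\<Sum>n. ?t g n)" for f g
    using suminf_add[OF replicate_summable[of k T l f] replicate_summable[of k T l g]]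
    by (simp add: blinfun.add_right)
  show "(\<Sum>n. ?t (scale_bcontfun c f) n) = scale_bcontfun c (\<Sum>n. ?t f n)" for c f
    \<comment> \<open>Scalars are themselves operators, so they pass through the infinite
      sum.\<close>
    using app_suminf[OF replicate_summable[of k T l f], of "scalar_op c"]
    by (simp add: app_scale)
  show "norm (\<Sum>n. ?t f n) \<le> norm f * (4 * norm (blinfun_of T))" for f
  proof (rule Lim_norm_ubound[OF sequentially_bot])
    show "(\<lambda>N. \<Sum>n<N. ?t f n) \<longlonglongrightarrow> (\<Sum>n. ?t f n)"
      by (rule summable_LIMSEQ[OF replicate_summable])
    have "norm (\<Sum>n<N. ?t f n) \<le> 2 * (norm (blinfun_of T) * (2 * norm f))" for N
      by (intro norm_sum_gap_embed order_trans[OF norm_app] mult_left_mono norm_gap_restrict) auto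
    then show "\<forall>\<^sub>F N in sequentially. norm (\<Sum>n<N. ?t f n) \<le> norm f * (4 * norm (blinfun_of T))"
      by (simp add: mult_ac)
  qed
qed

lemma replicate_op_add:
  fixes S T :: "(omega1_interval, 'k::{real_normed_field, banach}) bounded_op"
  shows "replicate_op k l (S + T) = replicate_op k l S + replicate_op k l T"
proof (rule bounded_op_eqI)
  fix f
  show "app (replicate_op k l (S + T)) f = app (replicate_op k l S + replicate_op k l T) f"
    using suminf_add[OF replicate_summable[of k S l f] replicate_summable[of k T l f]]
    by (simp add: app_replicate_op blinfun.add_right)
qed

lemma gap_restrict_replicate:
  fixes T :: "(omega1_interval, 'k::{real_normed_field, banach}) bounded_op"
  shows "gap_restrict m * replicate_op k l T =
    (if k \<le> m then gap_proj * T * gap_restrict (m - k + l) else 0)"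
proof (rule bounded_op_eqI)
  fix f
  let ?t = "\<lambda>n. app T (app (gap_restrict (n + l)) f)"
  have "app (gap_restrict m * replicate_op k l T) f = (\<Sum>n. app (gap_restrict m * gap_embed (n + k)) (?t n))"
    by (simp add: app_replicate_op app_suminf[OF replicate_summable])
  also have "\<dots> = (\<Sum>n. if n + k = m then app gap_proj (?t n) else 0)"
    unfolding gap_restrict_embed by (intro suminf_cong) auto
  also have "\<dots> = (if k \<le> m then app gap_proj (?t (m - k)) else 0)"
  proof (cases "k \<le> m")
    case True
    then have "(\<lambda>n. if n + k = m then app gap_proj (?t n) else 0) = (\<lambda>n. if n = m - k then app gap_proj (?t n) else 0)"
      by (intro ext) auto
    then show ?thesis using True sums_single[of "m - k" "\<lambda>n. app gap_proj (?t n)"] by (simp add: sums_iff)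
  next
    case False
    then have "(\<lambda>n. if n + k = m then app gap_proj (?t n) else 0) = (\<lambda>n. 0)"
      by (intro ext) auto
    then show ?thesis using False by simp
  qed
  finally show "app (gap_restrict m * replicate_op k l T) f =
      app (if k \<le> m then gap_proj * T * gap_restrict (m - k + l) else 0) f"
    by simp
qed

text \<open>\<open>gap_proj\<close> appears in the middle because each inner copy is embedded and at
  once restricted again.\<close>

lemma replicate_op_mult:
  fixes S T :: "(omega1_interval, 'k::{real_normed_field, banach}) bounded_op"
  shows "replicate_op k l S * replicate_op l m T = replicate_op k m (S * gap_proj * T)"
proof (rule bounded_op_eqI)
  fix f
  have "app (gap_restrict (n + l)) (app (replicate_op l m T) f) =
      app gap_proj (app T (app (gap_restrict (n + m)) f))" for n
    using arg_cong[OF gap_restrict_replicate[of "n + l" l m T], of "\<lambda>U. app U f"] by simp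
  then show "app (replicate_op k l S * replicate_op l m T) f = app (replicate_op k m (S * gap_proj * T)) f"
    by (simp add: app_replicate_op)
qed

lemma replicate_op_embed:
  fixes T :: "(omega1_interval, 'k::{real_normed_field, banach}) bounded_op"
  shows "replicate_op 0 1 T * gap_embed 0 = 0"
proof (rule bounded_op_eqI)
  fix f :: "omega1_interval \<Rightarrow>\<^sub>C 'k"
  have "app (gap_restrict (Suc n)) (app (gap_embed 0) f) = 0" for n
    using arg_cong[OF gap_restrict_embed[of "Suc n" 0], of "\<lambda>U. app U f"] by simp
  then show "app (replicate_op 0 1 T * gap_embed 0) f = app 0 f"
    by (simp add: app_replicate_op blinfun.zero_right)
qed

lemma replicate_op_split:
  fixes T :: "(omega1_interval, 'k::{real_normed_field, banach}) bounded_op"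
  shows "replicate_op 0 0 T = gap_embed 0 * T * gap_restrict 0 + replicate_op 1 1 T"
  using suminf_split_head[OF replicate_summable[of 0 T 0]]
  by (intro bounded_op_eqI) (simp add: app_replicate_op algebra_simps)

end

section \<open>Classes of idempotent matrices\<close>

text \<open>Size 0 is excluded as in the type of idempotent matrices, so factorizations through
  dimension 0 need separate treatment.\<close>

definition idem_carrier :: "nat \<Rightarrow> 'a::ring_1 mat \<Rightarrow> bool"
  where "idem_carrier n P \<longleftrightarrow> n \<ge> 1 \<and> P \<in> carrier_mat n n \<and> P * P = P"

definition V_class :: "'a::ring_1 mat \<Rightarrow> 'a V_semigroup"
  where "V_class P = abs_V_semigroup (Defs.Idem P)"

lemma mat_of_Idem: "idem_carrier n P \<Longrightarrow> mat_of (Defs.Idem P) = P"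
  unfolding idem_carrier_def by (intro Idem_inverse) blast

lemma V_class_eqI:
  assumes "idem_carrier m P" "idem_carrier n Q"
    and "A \<in> carrier_mat m n" "B \<in> carrier_mat n m" "P = A * B" "Q = B * A"
  shows "V_class P = V_class Q"
proof -
  have "sim0 (Defs.Idem P) (Defs.Idem Q)"
    using assms mat_of_Idem[OF assms(1)] mat_of_Idem[OF assms(2)]
    by (intro sim0I[of _ m _ n A B]) (simp_all add: idem_carrier_def)
  then show ?thesis unfolding V_class_def by (simp add: V_semigroup.abs_eq_iff)
qed

lemma idem_carrier_diag2:
  assumes "idem_carrier m P" "idem_carrier n Q"
  shows "idem_carrier (m + n) (diag2 P Q)"
  using assms diag2_carrier[of P m m Q n n] diag2_mult[of P m m P m Q n n Q n]
  unfolding idem_carrier_def by auto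

lemma V_class_add:
  assumes "idem_carrier m P" "idem_carrier n Q"
  shows "V_class P + V_class Q = V_class (diag2 P Q)"
proof -
  have "idem_sum (Defs.Idem P) (Defs.Idem Q) = Defs.Idem (diag2 P Q)"
    unfolding mat_of_inject[symmetric] idem_sum.rep_eq
    using assms idem_carrier_diag2[OF assms] by (simp add: mat_of_Idem)
  then show ?thesis unfolding V_class_def by (simp add: plus_V_semigroup.abs_eq)
qed

lemma V_class_cases: "\<exists>n P. idem_carrier n P \<and> v = V_class P"
proof -
  obtain X where X: "v = abs_V_semigroup X" using V_semigroup.abs_induct[of "\<lambda>v. \<exists>X. v = abs_V_semigroup X"] by blast
  have "idem_carrier (dim_row (mat_of X)) (mat_of X)"
    unfolding idem_carrier_def using mat_of_carrier mat_of_idem mat_of_dim_pos by blast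
  moreover have "v = V_class (mat_of X)" unfolding V_class_def X mat_of_inverse ..
  ultimately show ?thesis by blast
qed

text \<open>The row \<open>[A1 A2]\<close> and the column \<open>[B1; B2]\<close> are written with
  empty blocks so that multiplication of four-block matrices applies.\<close>

lemma block_factorization:
  fixes A1 :: "'a::ring_1 mat"
  assumes c: "A1 \<in> carrier_mat n k" "A2 \<in> carrier_mat n l" "B1 \<in> carrier_mat k n" "B2 \<in> carrier_mat l n"
  shows "\<exists>A B. A \<in> carrier_mat n (k + l) \<and> B \<in> carrier_mat (k + l) n \<and> A * B = A1 * B1 + A2 * B2 \<and>
    B * A = four_block_mat (B1 * A1) (B1 * A2) (B2 * A1) (B2 * A2)"
proof (intro exI conjI)
  let ?A = "four_block_mat A1 A2 (0\<^sub>m 0 k) (0\<^sub>m 0 l)"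
  let ?B = "four_block_mat B1 (0\<^sub>m k 0) B2 (0\<^sub>m l 0)"
  show "?A \<in> carrier_mat n (k + l)" "?B \<in> carrier_mat (k + l) n"
    using four_block_carrier_mat[OF c(1) zero_carrier_mat[of 0 l]] four_block_carrier_mat[OF c(3) zero_carrier_mat[of l 0]] by simp_all
  have "?A * ?B = four_block_mat (A1 * B1 + A2 * B2) (0\<^sub>m n 0) (0\<^sub>m 0 n) (0\<^sub>m 0 0)"
    using mult_four_block_mat[OF c(1,2) zero_carrier_mat zero_carrier_mat c(3) zero_carrier_mat c(4) zero_carrier_mat, of 0 0] c by simp
  also have "\<dots> = A1 * B1 + A2 * B2" using c by (intro eq_matI) auto
  finally show "?A * ?B = A1 * B1 + A2 * B2" .
  show "?B * ?A = four_block_mat (B1 * A1) (B1 * A2) (B2 * A1) (B2 * A2)"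
    using mult_four_block_mat[OF c(3) zero_carrier_mat c(4) zero_carrier_mat c(1,2) zero_carrier_mat zero_carrier_mat, of 0] c
    by simp
qed

text \<open>The row \<open>[A1 A2]\<close> times the column \<open>[B1; B2]\<close> is
  \<open>P\<close>, and the product in the other order is the diagonal sum of \<open>a\<close> and
  \<open>q\<close>.\<close>

lemma V_class_split:
  fixes P :: "'a::ring_1 mat"
  assumes P: "idem_carrier n P" and a: "idem_carrier k a" and q: "idem_carrier l q"
    and c: "A1 \<in> carrier_mat n k" "A2 \<in> carrier_mat n l" "B1 \<in> carrier_mat k n" "B2 \<in> carrier_mat l n"
    and sum: "A1 * B1 + A2 * B2 = P"
    and "B1 * A1 = a" "B1 * A2 = 0\<^sub>m k l" "B2 * A1 = 0\<^sub>m l k" "B2 * A2 = q"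
  shows "V_class P = V_class a + V_class q"
proof -
  have "dim_row a = k" "dim_col a = k" "dim_row q = l" "dim_col q = l"
    using a q by (auto simp: idem_carrier_def)
  then have d: "diag2 a q = four_block_mat (B1 * A1) (B1 * A2) (B2 * A1) (B2 * A2)"
    unfolding diag2_def by (simp add: assms(9-12))
  obtain A B where AB: "A \<in> carrier_mat n (k + l)" "B \<in> carrier_mat (k + l) n"
    "A * B = A1 * B1 + A2 * B2"
    "B * A = four_block_mat (B1 * A1) (B1 * A2) (B2 * A1) (B2 * A2)"
    using block_factorization[OF c] by blast
  show ?thesis unfolding V_class_add[OF a q]
    by (rule V_class_eqI[OF P idem_carrier_diag2[OF a q] AB(1,2)]) (simp_all add: AB(3,4) sum d)
qed

lemma mat_add_right_eq_self:
  fixes X Y :: "'a::ring_1 mat"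
  assumes "X \<in> carrier_mat n m" "Y \<in> carrier_mat n m" "X + Y = X"
  shows "Y = 0\<^sub>m n m"
proof (rule eq_matI)
  fix i j assume ij: "i < dim_row (0\<^sub>m n m)" "j < dim_col (0\<^sub>m n m)"
  have "(X + Y) $$ (i, j) = X $$ (i, j)" by (simp only: assms(3))
  then show "Y $$ (i, j) = 0\<^sub>m n m $$ (i, j)" using assms(1,2) ij by simp
qed (use assms in auto)

text \<open>The matrix \<open>P\<close> is block triangular and equivalent to its block diagonal part.\<close>
lemma V_class_triangular:
  fixes P e f :: "'a::ring_1 mat"
  assumes P: "idem_carrier n P" and e: "e \<in> carrier_mat n n" and f: "f \<in> carrier_mat n n"
    and ef: "e + f = 1\<^sub>m n" "e * e = e" "f * f = f" and fPe: "f * (P * e) = 0\<^sub>m n n"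
  shows "idem_carrier n (P * e)" "idem_carrier n (f * P)"
    "V_class P = V_class (P * e) + V_class (f * P)" "e * (P * e) = P * e"
proof -
  have Pc: "P \<in> carrier_mat n n" and PP: "P * P = P" and n: "n \<ge> 1"
    using P by (auto simp: idem_carrier_def)
  note mc = mult_carrier_mat[of _ n n _ n]
  note as = assoc_mult_mat[of _ n n _ n _ n]
  have split: "e * X + f * X = X" if "X \<in> carrier_mat n n" for X
    using add_mult_distrib_mat[OF e f that] ef(1) that by simp
  have splitr: "X * e + X * f = X" if "X \<in> carrier_mat n n" for X
    using mult_add_distrib_mat[OF that e f] ef(1) that by simp
  have ePe: "e * (P * e) = P * e"
    using split[OF mc[OF Pc e]] fPe mc[OF e mc[OF Pc e]] by simp
  have fPf: "f * (P * f) = f * P"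
  proof -
    have "f * P * e + f * P * f = f * P" by (rule splitr[OF mc[OF f Pc]])
    then show ?thesis using fPe as[OF f Pc e] as[OF f Pc f] mc[OF f mc[OF Pc f]] by simp
  qed
  have PPX: "P * (P * X) = P * X" if "X \<in> carrier_mat n n" for X
    using as[OF Pc Pc that] PP by simp
  have ePeX: "e * (P * (e * X)) = P * (e * X)" if "X \<in> carrier_mat n n" for X
    using ePe as[OF Pc e that] as[OF e mc[OF Pc e] that] by simp
  have fPfX: "f * (P * (f * X)) = f * (P * X)" if "X \<in> carrier_mat n n" for X
    using fPf as[OF Pc f that] as[OF f mc[OF Pc f] that] as[OF f Pc that] by simp
  have fPeX: "f * (P * (e * X)) = 0\<^sub>m n n" if "X \<in> carrier_mat n n" for X
    using fPe as[OF Pc e that] as[OF f mc[OF Pc e] that] that by simp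
  note simps = as mc Pc e f PP PPX ePe ePeX fPf fPfX fPe fPeX
  show ic: "idem_carrier n (P * e)" "idem_carrier n (f * P)"
    using n by (simp_all add: idem_carrier_def simps)
  show "e * (P * e) = P * e" by (rule ePe)
  \<comment> \<open>Multiplying \<open>P e P\<close> on the right by \<open>(e + f) P\<close> gives
    \<open>P e P = P e P + P e P f P\<close>.\<close>
  have B1A2: "P * (e * P) * (P * (f * P)) = 0\<^sub>m n n"
  proof -
    have c1: "P * (e * (P * (e * P))) \<in> carrier_mat n n" "P * (e * (P * (f * P))) \<in> carrier_mat n n"
      by (simp_all add: mc Pc e f)
    have "P * (e * P) * (e * P) + P * (e * P) * (f * P) = P * (e * P) * (e * P + f * P)"
      using mult_add_distrib_mat[of "P * (e * P)" n n "e * P" n "f * P"] by (simp add: mc Pc e f)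
    also have "\<dots> = P * (e * P)" by (simp add: split[OF Pc] simps)
    finally have eq: "P * (e * P) + P * (e * (P * (f * P))) = P * (e * P)" by (simp add: simps)
    then have "P * (e * (P * (f * P))) = 0\<^sub>m n n"
      by (intro mat_add_right_eq_self[OF _ c1(2), of "P * (e * P)"]) (simp_all add: mc Pc e)
    then show ?thesis by (simp add: simps)
  qed
  show "V_class P = V_class (P * e) + V_class (f * P)"
  \<comment> \<open>The outer factors \<open>P\<close> make the row times the column equal to
    \<open>P e P + P f P = P\<close>; the relations \<open>e P e = P e\<close>,
    \<open>f P f = f P\<close> and \<open>f P e = 0\<close> then yield the blocks in the other
    order.\<close>
  proof (rule V_class_split[OF P ic, of "P * e" "P * (f * P)" "P * (e * P)" "f * P"])
    show "P * e * (P * (e * P)) + P * (f * P) * (f * P) = P"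
    proof -
      have "P * e * (P * (e * P)) + P * (f * P) * (f * P) = P * (e * P) + P * (f * P)"
        by (simp add: simps)
      also have "\<dots> = P * (e * P + f * P)"
        using mult_add_distrib_mat[of P n n "e * P" n "f * P"] by (simp add: mc Pc e f)
      finally show ?thesis by (simp add: split[OF Pc] PP)
    qed
    show "P * (e * P) * (P * (f * P)) = 0\<^sub>m n n" by (rule B1A2)
  qed (simp_all add: simps)
qed

definition scalar_mat :: "nat \<Rightarrow> 'a::ring_1 \<Rightarrow> 'a mat"
  where "scalar_mat n x = mat n n (\<lambda>(i, j). if i = j then x else 0)"

lemma scalar_mat_carrier [simp]: "scalar_mat n x \<in> carrier_mat n n"
  by (simp add: scalar_mat_def)

lemma scalar_mat_mult:
  assumes "A \<in> carrier_mat n m" shows "scalar_mat n x * A = map_mat (\<lambda>a. x * a) A"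
proof (rule eq_matI)
  fix i j assume "i < dim_row (map_mat (\<lambda>a. x * a) A)" "j < dim_col (map_mat (\<lambda>a. x * a) A)"
  then have ij: "i < n" "j < m" using assms by auto
  have "(scalar_mat n x * A) $$ (i, j) = (\<Sum>k = 0..<n. (if i = k then x else 0) * A $$ (k, j))"
    using assms ij by (simp add: scalar_mat_def scalar_prod_def)
  also have "\<dots> = (\<Sum>k = 0..<n. if i = k then x * A $$ (k, j) else 0)"
    by (intro sum.cong) auto
  finally show "(scalar_mat n x * A) $$ (i, j) = map_mat (\<lambda>a. x * a) A $$ (i, j)"
    using assms ij by simp
qed (use assms in \<open>auto simp: scalar_mat_def\<close>)

lemma mult_scalar_mat:
  assumes "A \<in> carrier_mat n m" shows "A * scalar_mat m x = map_mat (\<lambda>a. a * x) A"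
proof (rule eq_matI)
  fix i j assume "i < dim_row (map_mat (\<lambda>a. a * x) A)" "j < dim_col (map_mat (\<lambda>a. a * x) A)"
  then have ij: "i < n" "j < m" using assms by auto
  have "(A * scalar_mat m x) $$ (i, j) = (\<Sum>k = 0..<m. A $$ (i, k) * (if k = j then x else 0))"
    using assms ij by (simp add: scalar_mat_def scalar_prod_def)
  also have "\<dots> = (\<Sum>k = 0..<m. if k = j then A $$ (i, k) * x else 0)"
    by (intro sum.cong) auto
  finally show "(A * scalar_mat m x) $$ (i, j) = map_mat (\<lambda>a. a * x) A $$ (i, j)"
    using assms ij by simp
qed (use assms in \<open>auto simp: scalar_mat_def\<close>)

lemma scalar_mat_ring:
  "scalar_mat n x * scalar_mat n y = scalar_mat n (x * y)"
  "scalar_mat n x + scalar_mat n y = scalar_mat n (x + y)"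
  "scalar_mat n 1 = 1\<^sub>m n" "scalar_mat n 0 = 0\<^sub>m n n"
proof -
  have "scalar_mat n x * scalar_mat n y = map_mat (\<lambda>a. x * a) (scalar_mat n y)"
    by (rule scalar_mat_mult[of _ n n]) simp
  also have "\<dots> = scalar_mat n (x * y)"
    by (rule eq_matI) (auto simp: scalar_mat_def)
  finally show "scalar_mat n x * scalar_mat n y = scalar_mat n (x * y)" .
qed (auto simp: scalar_mat_def intro!: eq_matI)

text \<open>Three maps are allowed because the amplifications multiply with changing indices. The
  product rule is required only at the entries that occur, where the idempotent \<open>e\<close> in
  that rule can be absorbed.\<close>

lemma mult_map_mat:
  fixes F G H :: "'a::ring_1 \<Rightarrow> 'b::ring_1"
  assumes c: "A \<in> carrier_mat n m" "B \<in> carrier_mat m k"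
    and FG: "\<And>i l j. i < n \<Longrightarrow> l < m \<Longrightarrow> j < k \<Longrightarrow>
      F (A $$ (i, l)) * G (B $$ (l, j)) = H (A $$ (i, l) * B $$ (l, j))"
    and H: "\<And>x y. H (x + y) = H x + H y"
  shows "map_mat F A * map_mat G B = map_mat H (A * B)"
proof (rule eq_matI)
  have H0: "H 0 = 0" using H[of 0 0] by simp
  have Hs: "H (sum g S) = (\<Sum>i\<in>S. H (g i))" for g and S :: "nat set"
    by (induction S rule: infinite_finite_induct) (simp_all add: H0 H)
  fix i j assume "i < dim_row (map_mat H (A * B))" "j < dim_col (map_mat H (A * B))"
  then have ij: "i < n" "j < k" using c by auto
  then show "(map_mat F A * map_mat G B) $$ (i, j) = map_mat H (A * B) $$ (i, j)"
    using c by (simp add: scalar_prod_def Hs FG)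
qed (use c in auto)

section \<open>Idempotent matrices over a field\<close>

lemma left_invertible_dim_le:
  fixes A B :: "'k::field mat"
  assumes A: "A \<in> carrier_mat n k" and B: "B \<in> carrier_mat k n" and BA: "B * A = 1\<^sub>m k"
  shows "k \<le> n"
proof (rule ccontr)
  assume nk: "\<not> k \<le> n"
  define A' where "A' = mat k k (\<lambda>(i, j). if i < n then A $$ (i, j) else 0)"
  define B' where "B' = mat k k (\<lambda>(i, j). if j < n then B $$ (i, j) else 0)"
  have c: "A' \<in> carrier_mat k k" "B' \<in> carrier_mat k k" by (simp_all add: A'_def B'_def)
  have "B' * A' = B * A"
  proof (rule eq_matI)
    fix i j assume "i < dim_row (B * A)" "j < dim_col (B * A)"
    then have ij: "i < k" "j < k" using A B by auto
    have "(B' * A') $$ (i, j) = (\<Sum>l = 0..<k. (if l < n then B $$ (i, l) else 0) * (if l < n then A $$ (l, j) else 0))"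
      using ij by (simp add: A'_def B'_def scalar_prod_def)
    also have "\<dots> = (\<Sum>l = 0..<n. B $$ (i, l) * A $$ (l, j))"
      using nk by (intro sum.mono_neutral_cong_right) auto
    also have "\<dots> = (B * A) $$ (i, j)"
      using ij A B by (simp add: scalar_prod_def)
    finally show "(B' * A') $$ (i, j) = (B * A) $$ (i, j)" .
  qed (use A B c in auto)
  then have "det B' * det A' = 1" using det_mult[OF c(2,1)] BA by simp
  moreover have "det A' = 0"
  proof -
    have "row A' n = 0\<^sub>v k" using nk by (intro eq_vecI) (auto simp: A'_def)
    \<comment> \<open>The padded square matrix has a zero row: multiplying that row by 0 changes
      nothing, yet multiplies the determinant by 0.\<close>
    then have "multrow n 0 A' = A'"
      using nk c by (intro eq_matI) (auto simp: A'_def)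
    then show ?thesis using det_multrow[of n k A' 0] nk c(1) by simp
  qed
  ultimately show False by simp
qed

text \<open>The remainder \<open>X = c - A * B\<close> is a nonzero idempotent orthogonal to
  \<open>A * B\<close>. A nonzero entry of \<open>X\<close> yields a rank-one idempotent below it,
  which supplies one more column and row.\<close>

lemma field_idempotent_factorization_step:
  fixes c A B :: "'k::field mat"
  assumes c: "c \<in> carrier_mat n n" "c * c = c"
    and A: "A \<in> carrier_mat n k" and B: "B \<in> carrier_mat k n" and BA: "B * A = 1\<^sub>m k"
    and cAB: "c * (A * B) = A * B" "A * B * c = A * B" and ne: "A * B \<noteq> c"
  shows "\<exists>A B. A \<in> carrier_mat n (k + 1) \<and> B \<in> carrier_mat (k + 1) n \<and> B * A = 1\<^sub>m (k + 1) \<and>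
    c * (A * B) = A * B \<and> A * B * c = A * B"
proof -
  let ?e = "A * B"
  have e: "?e \<in> carrier_mat n n" using A B by simp
  have ABA: "?e * A = A" using assoc_mult_mat[OF A B A] BA A by simp
  have BAB: "B * ?e = B" using assoc_mult_mat[OF B A B] BA B by simp
  have ee: "?e * ?e = ?e" using assoc_mult_mat[OF e A B] ABA by simp
  have cA: "c * A = A"
    using assoc_mult_mat[OF c(1) e A] cAB(1) ABA by simp
  have Bc: "B * c = B"
    using assoc_mult_mat[OF B e c(1)] cAB(2) BAB by simp
  define X where "X = c - ?e"
  have X: "X \<in> carrier_mat n n" unfolding X_def by (rule minus_carrier_mat[OF e])
  have cX: "c * X = X" unfolding X_def using mult_minus_distrib_mat[OF c(1) c(1) e] c cAB by simp
  have Xc: "X * c = X" unfolding X_def using minus_mult_distrib_mat[OF c(1) e c(1)] c cAB by simp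
  have XA: "X * A = 0\<^sub>m n k" unfolding X_def using minus_mult_distrib_mat[OF c(1) e A] cA ABA A by simp
  have BX: "B * X = 0\<^sub>m k n" unfolding X_def using mult_minus_distrib_mat[OF B c(1) e] Bc BAB B by simp
  have eX: "?e * X = 0\<^sub>m n n" using assoc_mult_mat[OF A B X] BX A by simp
  have XX: "X * X = X"
  proof -
    have "X * X = c * X - ?e * X" unfolding X_def[of] using minus_mult_distrib_mat[OF c(1) e X] by (simp add: X_def)
    also have "\<dots> = X" unfolding cX eX using X by (intro eq_matI) auto
    finally show ?thesis .
  qed
  have "X \<noteq> 0\<^sub>m n n"
  proof
    assume X0: "X = 0\<^sub>m n n"
    have "?e = c"
    proof (rule eq_matI)
      fix i j assume "i < dim_row c" "j < dim_col c"
      then have ij: "i < n" "j < n" using c by auto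
      then have "X $$ (i, j) = 0" using X0 by simp
      moreover have "(c - ?e) $$ (i, j) = c $$ (i, j) - ?e $$ (i, j)"
        using ij e by (intro index_minus_mat) auto
      ultimately show "?e $$ (i, j) = c $$ (i, j)" unfolding X_def by simp
    qed (use c e in auto)
    then show False using ne by simp
  qed
  then obtain i j where ij: "i < n" "j < n" "X $$ (i, j) \<noteq> 0"
    using X eq_matI[of X "0\<^sub>m n n"] by auto
  \<comment> \<open>\<open>E\<close> selects column \<open>j\<close> of \<open>X\<close> and
    \<open>F\<close> selects row \<open>i\<close>, scaled so that \<open>F * X * E\<close> is
    1.\<close>
  define E where "E = mat n 1 (\<lambda>(l, _). if l = j then 1 else 0 :: 'k)"
  define F where "F = mat 1 n (\<lambda>(_, l). if l = i then 1 / X $$ (i, j) else 0)"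
  have E: "E \<in> carrier_mat n 1" and F: "F \<in> carrier_mat 1 n" by (simp_all add: E_def F_def)
  have XE: "X * E \<in> carrier_mat n 1" and FX: "F * X \<in> carrier_mat 1 n" using X E F by simp_all
  have "F * (X * E) = 1\<^sub>m 1"
  proof (rule eq_matI)
    have "(X * E) $$ (l, 0) = X $$ (l, j)" if "l < n" for l
    proof -
      have "(X * E) $$ (l, 0) = (\<Sum>m = 0..<n. X $$ (l, m) * (if m = j then 1 else 0))"
        using that X by (simp add: E_def scalar_prod_def)
      also have "\<dots> = (\<Sum>m = 0..<n. if m = j then X $$ (l, m) else 0)" by (intro sum.cong) auto
      finally show ?thesis using ij by simp
    qed
    moreover have "(F * Y) $$ (0, 0) = (\<Sum>m = 0..<n. (if m = i then 1 / X $$ (i, j) else 0) * Y $$ (m, 0))"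
      if "Y \<in> carrier_mat n 1" for Y
      using that by (simp add: F_def scalar_prod_def)
    note this[OF XE]
    ultimately have "(F * (X * E)) $$ (0, 0) = (\<Sum>m = 0..<n. if m = i then 1 / X $$ (i, j) * X $$ (m, j) else 0)"
      by (simp only:) (rule sum.cong, auto)
    then have "(F * (X * E)) $$ (0, 0) = 1" using ij by (simp only: sum.delta[OF finite_atLeastLessThan]) simp
    then show "(F * (X * E)) $$ (a, b) = 1\<^sub>m 1 $$ (a, b)" if "a < dim_row (1\<^sub>m 1)" "b < dim_col (1\<^sub>m 1)" for a b
      using that by simp
  qed (use F XE in auto)
  then have yx: "(F * X) * (X * E) = 1\<^sub>m 1"
    using assoc_mult_mat[OF F X XE] assoc_mult_mat[OF X X E] XX by simp
  have Bx: "B * (X * E) = 0\<^sub>m k 1" using assoc_mult_mat[OF B X E] BX E by simp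
  have yA: "(F * X) * A = 0\<^sub>m 1 k" using assoc_mult_mat[OF F X A] XA F by simp
  obtain A' B' where A': "A' \<in> carrier_mat n (k + 1)" "B' \<in> carrier_mat (k + 1) n"
    and AB': "A' * B' = A * B + (X * E) * (F * X)"
    and BA': "B' * A' = four_block_mat (B * A) (B * (X * E)) ((F * X) * A) ((F * X) * (X * E))"
    using block_factorization[OF A XE B FX] by blast
  have "B' * A' = 1\<^sub>m (k + 1)" unfolding BA' BA Bx yA yx by (rule four_block_one_mat)
  moreover have "c * (A' * B') = A' * B'"
  proof -
    have "c * ((X * E) * (F * X)) = (X * E) * (F * X)"
      using assoc_mult_mat[OF c(1) XE FX] assoc_mult_mat[OF c(1) X E] cX by simp
    then show ?thesis unfolding AB'
      using mult_add_distrib_mat[OF c(1) e mult_carrier_mat[OF XE FX]] cAB by simp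
  qed
  moreover have "A' * B' * c = A' * B'"
  proof -
    have "((X * E) * (F * X)) * c = (X * E) * (F * X)"
      using assoc_mult_mat[OF XE FX c(1)] assoc_mult_mat[OF F X c(1)] Xc by simp
    then show ?thesis unfolding AB'
      using add_mult_distrib_mat[OF e mult_carrier_mat[OF XE FX] c(1)] cAB by simp
  qed
  ultimately show ?thesis using A' by blast
qed

text \<open>Without such a factorization the extension step, starting at size 0, would never stop
  and would violate the dimension bound at size \<open>Suc n\<close>.\<close>

lemma field_idempotent_factorization:
  fixes c :: "'k::field mat"
  assumes c: "c \<in> carrier_mat n n" "c * c = c"
  shows "\<exists>k A B. A \<in> carrier_mat n k \<and> B \<in> carrier_mat k n \<and> c = A * B \<and> B * A = 1\<^sub>m k"
proof (rule ccontr)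
  assume no: "\<not> ?thesis"
  define good where "good k \<longleftrightarrow> (\<exists>A B. A \<in> carrier_mat n k \<and> B \<in> carrier_mat k n \<and> B * A = 1\<^sub>m k \<and>
    c * (A * B) = A * B \<and> A * B * c = A * B)" for k
  have "good k" for k
  proof (induction k)
    case 0
    show ?case unfolding good_def
    proof (intro exI conjI)
      show "0\<^sub>m n 0 \<in> carrier_mat n 0" "0\<^sub>m 0 n \<in> carrier_mat 0 n" by simp_all
      show "0\<^sub>m 0 n * 0\<^sub>m n 0 = 1\<^sub>m 0" by (rule eq_matI) auto
      have z: "0\<^sub>m n 0 * 0\<^sub>m 0 n = 0\<^sub>m n n" by simp
      show "c * (0\<^sub>m n 0 * 0\<^sub>m 0 n) = 0\<^sub>m n 0 * 0\<^sub>m 0 n" "0\<^sub>m n 0 * 0\<^sub>m 0 n * c = 0\<^sub>m n 0 * 0\<^sub>m 0 n"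
        using c unfolding z by simp_all
    qed
  next
    case (Suc k)
    then obtain A B where AB: "A \<in> carrier_mat n k" "B \<in> carrier_mat k n" "B * A = 1\<^sub>m k"
      "c * (A * B) = A * B" "A * B * c = A * B" unfolding good_def by blast
    have "A * B \<noteq> c" using no AB(1-3) by metis
    then show ?case
      using field_idempotent_factorization_step[OF c AB] unfolding good_def by simp
  qed
  then have "good (Suc n)" .
  then show False unfolding good_def using left_invertible_dim_le[of _ n "Suc n"] by force
qed

section \<open>The group of a ring with a character\<close>

text \<open>The pair is \<open>(v + v, v)\<close> because an abelian semigroup need not have a zero
  to serve as second component.\<close>

definition K0_class :: "'a::ring_1 V_semigroup \<Rightarrow> 'a K0"
  where "K0_class v = abs_grothendieck (v + v, v)"

lemma K0_class_add: "K0_class (v + w) = K0_class v + K0_class w"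
  unfolding K0_class_def by (simp add: plus_grothendieck.abs_eq ac_simps)

lemma K0_class_zero:
  assumes "v + w = w" shows "K0_class v = 0"
proof -
  have "K0_class v + K0_class w = K0_class w" using K0_class_add[of v w] assms by simp
  then show ?thesis by simp
qed

lemma K0_cases: "\<exists>v w. x = K0_class v - K0_class w"
proof -
  obtain v w where x: "x = abs_grothendieck (v, w)"
    using grothendieck.abs_induct[of "\<lambda>x. \<exists>v w. x = abs_grothendieck (v, w)"] by (metis surj_pair)
  have "x + K0_class w = K0_class v"
    unfolding x K0_class_def plus_grothendieck.abs_eq grothendieck.abs_eq_iff groth_rel_def
    by (simp add: ac_simps)
  then show ?thesis by (metis add_diff_cancel_right')
qed

text \<open>Abstract form of the gap operators: \<open>u\<close> and \<open>v\<close> stand for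
  \<open>gap_embed 0\<close> and \<open>gap_restrict 0\<close>, and \<open>\<Phi> k l\<close> for
  \<open>replicate_op k l\<close>. The factor \<open>e\<close> in the product rule disappears for
  elements of the corner of \<open>e\<close>.\<close>

definition swindles :: "'a::ring_1 \<Rightarrow> bool"
  where "swindles e \<longleftrightarrow> (\<exists>u v (\<Phi> :: nat \<Rightarrow> nat \<Rightarrow> 'a \<Rightarrow> 'a). v * u = e \<and>
    (\<forall>k l m S T. \<Phi> k l S * \<Phi> l m T = \<Phi> k m (S * e * T)) \<and>
    (\<forall>k l S T. \<Phi> k l (S + T) = \<Phi> k l S + \<Phi> k l T) \<and>
    (\<forall>T. \<Phi> 0 0 T = u * T * v + \<Phi> 1 1 T) \<and> (\<forall>T. v * \<Phi> 1 0 T = 0) \<and> (\<forall>T. \<Phi> 0 1 T * u = 0))"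

text \<open>Eilenberg swindle: \<open>\<Phi> 0 0 a\<close> is the direct sum of infinitely many copies of \<open>a\<close>.\<close>
lemma swindles_absorb:
  fixes a :: "'a::ring_1 mat"
  assumes e: "swindles e" and a: "idem_carrier n a"
    and ea: "scalar_mat n e * a = a" and ae: "a * scalar_mat n e = a"
  shows "\<exists>w. V_class a + w = w"
proof -
  obtain u v and \<Phi> :: "nat \<Rightarrow> nat \<Rightarrow> 'a \<Rightarrow> 'a" where vu: "v * u = e"
    and mult: "\<And>k l m S T. \<Phi> k l S * \<Phi> l m T = \<Phi> k m (S * e * T)"
    and add: "\<And>k l S T. \<Phi> k l (S + T) = \<Phi> k l S + \<Phi> k l T"
    and split: "\<And>T. \<Phi> 0 0 T = u * T * v + \<Phi> 1 1 T"
    and z: "\<And>T. v * \<Phi> 1 0 T = 0" "\<And>T. \<Phi> 0 1 T * u = 0"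
    using e unfolding swindles_def by blast
  have ac: "a \<in> carrier_mat n n" and aa: "a * a = a" and n: "n \<ge> 1"
    using a by (auto simp: idem_carrier_def)
  let ?M = "\<lambda>k l. map_mat (\<Phi> k l) a"
  let ?u = "scalar_mat n u" and ?v = "scalar_mat n v"
  have Mc: "?M k l \<in> carrier_mat n n" for k l using ac by simp
  have entry: "a $$ (i, j) * e = a $$ (i, j)" if "i < n" "j < n" for i j
  proof -
    have "map_mat (\<lambda>x. x * e) a $$ (i, j) = a $$ (i, j)" using mult_scalar_mat[OF ac, of e] ae by simp
    then show ?thesis using that ac by simp
  qed
  have MM: "?M k l * ?M l m = ?M k m" for k l m
    using mult_map_mat[OF ac ac, of "\<Phi> k l" "\<Phi> l m" "\<Phi> k m"] by (simp add: mult entry add aa)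
  have P: "idem_carrier n (?M 0 0)" using n Mc MM by (simp add: idem_carrier_def)
  note mc = mult_carrier_mat[of _ n n _ n]
  note as = assoc_mult_mat[of _ n n _ n _ n]
  have aaX: "a * (a * X) = a * X" if "X \<in> carrier_mat n n" for X
    using as[OF ac ac that] aa by simp
  have "V_class (?M 0 0) = V_class a + V_class (?M 0 0)"
  \<comment> \<open>\<open>?u * a\<close> and \<open>a * ?v\<close> carry copy 0, while
    \<open>?M 1 0\<close> and \<open>?M 0 1\<close> shift all copies onto those from 1 on and
    back.\<close>
  proof (rule V_class_split[OF P a P, of "?u * a" "?M 1 0" "a * ?v" "?M 0 1"])
    have "?u * a * (a * ?v) = ?u * (a * ?v)" using ac by (simp add: as mc aaX)
    also have "\<dots> = map_mat (\<lambda>x. u * (x * v)) a"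
      using mult_scalar_mat[OF ac, of v] scalar_mat_mult[of "map_mat (\<lambda>x. x * v) a" n n u] ac
      by (auto intro!: eq_matI)
    finally have 1: "?u * a * (a * ?v) = map_mat (\<lambda>x. u * (x * v)) a" .
    show "?u * a * (a * ?v) + ?M 1 0 * ?M 0 1 = ?M 0 0"
      unfolding 1 MM using ac by (intro eq_matI) (simp_all add: split mult.assoc)
    have "a * ?v * (?u * a) = a * ((?v * ?u) * a)"
      using ac by (simp add: as mc)
    then show "a * ?v * (?u * a) = a" using ea aa by (simp add: scalar_mat_ring vu)
    have "?v * ?M 1 0 = 0\<^sub>m n n"
      using scalar_mat_mult[OF Mc, of v 1 0] ac by (auto intro!: eq_matI simp: z[unfolded One_nat_def])
    then show "a * ?v * ?M 1 0 = 0\<^sub>m n n" using ac Mc[of 1 0] by (simp add: as mc)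
    have "?M 0 1 * ?u = 0\<^sub>m n n"
      using mult_scalar_mat[OF Mc, of 0 1 u] ac by (auto intro!: eq_matI simp: z[unfolded One_nat_def])
    then show "?M 0 1 * (?u * a) = 0\<^sub>m n n"
      using as[OF Mc[of 0 1] scalar_mat_carrier[of n u] ac] ac by simp
    show "?M 0 1 * ?M 1 0 = ?M 0 0" by (rule MM)
  qed (use ac in \<open>simp_all add: mc\<close>)
  then show ?thesis by metis
qed

definition mat_char :: "('a::ring_1 \<Rightarrow> 'k::field_char_0) \<Rightarrow> 'a mat \<Rightarrow> 'k"
  where "mat_char \<phi> P = (\<Sum>i<dim_row P. \<phi> (P $$ (i, i)))"

definition multiples :: "'a::ab_group_add \<Rightarrow> nat \<Rightarrow> 'a"
  where "multiples g k = (\<Sum>i<k. g)"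

lemma multiples_simps:
  "multiples g 0 = 0" "multiples g (Suc k) = multiples g k + g"
  "multiples g (k + l) = multiples g k + multiples g l"
proof -
  show "multiples g (k + l) = multiples g k + multiples g l"
    by (induction l) (simp_all add: multiples_def add.assoc)
qed (simp_all add: multiples_def)

definition int_multiple :: "'a::ab_group_add \<Rightarrow> int \<Rightarrow> 'a"
  where "int_multiple g z = multiples g (nat z) - multiples g (nat (- z))"

lemma int_multiple_diff: "int_multiple g (int k - int l) = multiples g k - multiples g l"
proof (cases "l \<le> k")
  case True
  then obtain m where k: "k = l + m" using le_Suc_ex by blast
  have "nat (int k - int l) = m" "nat (- (int k - int l)) = 0" unfolding k by simp_all
  then show ?thesis unfolding int_multiple_def k by (simp add: multiples_simps(1,3))
next
  case False
  then have "k \<le> l" by simp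
  then obtain m where l: "l = k + m" using le_Suc_ex by blast
  have "nat (int k - int l) = 0" "nat (- (int k - int l)) = m" unfolding l by simp_all
  then show ?thesis unfolding int_multiple_def l by (simp add: multiples_simps(1,3))
qed

lemma int_multiple_add: "int_multiple g (x + y) = int_multiple g x + int_multiple g y"
proof -
  obtain k l where x: "x = int k - int l" by (rule int_diff_cases)
  obtain m n where y: "y = int m - int n" by (rule int_diff_cases)
  have "x + y = int (k + m) - int (l + n)" by (simp add: x y)
  then have "int_multiple g (x + y) = multiples g (k + m) - multiples g (l + n)"
    by (simp only: int_multiple_diff)
  then show ?thesis unfolding x y int_multiple_diff multiples_simps(3) by simp
qed

lemma int_multiple_hom:
  fixes g :: "'g::ab_group_add" and t :: "'g \<Rightarrow> 'k::field_char_0"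
  assumes t: "\<And>x y. t (x + y) = t x + t y" and tg: "t g = 1"
  shows "t (int_multiple g z) = of_int z"
proof -
  have t0: "t 0 = 0" using t[of 0 0] by simp
  have tm: "t (multiples g k) = of_nat k" for k
  proof (induction k)
    case (Suc k)
    then show ?case unfolding multiples_simps(2) t tg by simp
  qed (simp add: multiples_simps(1) t0)
  have td: "t (x - y) = t x - t y" for x y
    using t[of "x - y" y] by simp
  obtain k l where z: "z = int k - int l" by (rule int_diff_cases)
  show ?thesis unfolding z int_multiple_diff td tm by simp
qed

text \<open>Integer multiples of \<open>g\<close> exhaust the group by \<open>gen\<close>, and
  \<open>t\<close> recovers the integer in characteristic 0. The isomorphism is the inverse of
  forming multiples.\<close>

lemma infinite_cyclic_int_iso:
  fixes g :: "'g::ab_group_add" and t :: "'g \<Rightarrow> 'k::field_char_0"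
  assumes gen: "\<And>x. \<exists>k l. x = multiples g k - multiples g l"
    and t: "\<And>x y. t (x + y) = t x + t y" "t g = 1"
  shows "\<exists>f :: 'g \<Rightarrow> int. add_iso f"
proof -
  let ?h = "int_multiple g"
  have th: "t (?h z) = of_int z" for z using t by (rule int_multiple_hom)
  have inj: "inj ?h"
  proof (rule injI)
    fix x y assume "?h x = ?h y"
    then have "t (?h x) = t (?h y)" by (rule arg_cong)
    then show "x = y" unfolding th by simp
  qed
  have surj: "surj ?h"
    unfolding surj_def
  proof
    fix x
    obtain k l where x: "x = multiples g k - multiples g l" using gen[of x] by (elim exE)
    have "x = ?h (int k - int l)" unfolding x int_multiple_diff ..
    then show "\<exists>z. x = ?h z" by (rule exI)
  qed
  have bij: "bij (inv_into UNIV ?h)" by (rule bij_imp_bij_inv[OF bijI[OF inj surj]])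
  have inv_add: "inv_into UNIV ?h (x + y) = inv_into UNIV ?h x + inv_into UNIV ?h y" for x y
  proof (rule inv_f_eq[OF inj])
    show "?h (inv_into UNIV ?h x + inv_into UNIV ?h y) = x + y"
      unfolding int_multiple_add surj_f_inv_f[OF surj] ..
  qed
  have "add_iso (inv_into UNIV ?h)" unfolding add_iso_def using bij inv_add by (intro conjI allI)
  then show ?thesis by blast
qed

text \<open>The factors \<open>p P\<close> and \<open>P q\<close> multiply to \<open>p P q\<close>
  in one order and, because of \<open>q * p = 1\<close>, to \<open>P\<close> in the other.\<close>

lemma V_class_conjugate:
  fixes P :: "'a::ring_1 mat"
  assumes P: "idem_carrier n P" and qp: "q * p = 1"
  shows "idem_carrier n (scalar_mat n p * (P * scalar_mat n q))"
    "V_class (scalar_mat n p * (P * scalar_mat n q)) = V_class P"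
proof -
  let ?p = "scalar_mat n p" and ?q = "scalar_mat n q"
  have Pc: "P \<in> carrier_mat n n" and PP: "P * P = P" and n: "n \<ge> 1"
    using P by (auto simp: idem_carrier_def)
  note mc = mult_carrier_mat[of _ n n _ n]
  note as = assoc_mult_mat[of _ n n _ n _ n]
  have PPX: "P * (P * X) = P * X" if "X \<in> carrier_mat n n" for X
    using as[OF Pc Pc that] PP by simp
  have qpX: "?q * (?p * X) = X" if "X \<in> carrier_mat n n" for X
    using as[OF scalar_mat_carrier scalar_mat_carrier that, of q p] that by (simp add: scalar_mat_ring qp)
  show ic: "idem_carrier n (?p * (P * ?q))"
    using n Pc by (simp add: idem_carrier_def as mc qpX PPX)
  show "V_class (?p * (P * ?q)) = V_class P"
    by (rule V_class_eqI[OF ic P, of "?p * P" "P * ?q"]) (use Pc in \<open>simp_all add: as mc PPX qpX PP\<close>)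
qed

lemma map_mat_idem:
  fixes F :: "'a::ring_1 \<Rightarrow> 'b::ring_1"
  assumes "idem_carrier n P" "\<And>x y. F (x + y) = F x + F y" "\<And>x y. F (x * y) = F x * F y"
  shows "idem_carrier n (map_mat F P)"
  using assms mult_map_mat[of P n n P n F F F] by (simp add: idem_carrier_def)

text \<open>Conjugation by \<open>p\<close> and \<open>q\<close> prepares for \<open>absorb\<close>:
  one swindling idempotent \<open>e\<close>, which may depend on \<open>F\<close>, is a left unit
  for the products \<open>p * x\<close>. The condition \<open>p * q * e = e\<close> makes scalar
  matrices triangular after conjugation.\<close>

locale K0_character =
  fixes \<phi> :: "'a::ring_1 \<Rightarrow> 'k::field_char_0" and \<iota> :: "'k \<Rightarrow> 'a" and p q :: 'a
  assumes \<phi>_add: "\<phi> (x + y) = \<phi> x + \<phi> y" and \<phi>_mult: "\<phi> (x * y) = \<phi> x * \<phi> y"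
    and \<phi>_\<iota>: "\<phi> (\<iota> c) = c"
    and \<iota>_add: "\<iota> (c + d) = \<iota> c + \<iota> d" and \<iota>_mult: "\<iota> (c * d) = \<iota> c * \<iota> d" and \<iota>_one: "\<iota> 1 = 1"
    and \<iota>_central: "\<iota> c * x = x * \<iota> c"
    and qp: "q * p = 1"
    and absorb: "finite F \<Longrightarrow> (\<And>x. x \<in> F \<Longrightarrow> \<phi> x = 0) \<Longrightarrow>
      \<exists>e. e * e = e \<and> p * q * e = e \<and> (\<forall>x\<in>F. e * p * x = p * x) \<and> swindles e"
begin

lemma \<phi>_zero: "\<phi> 0 = 0" using \<phi>_add[of 0 0] by simp
lemma \<iota>_zero: "\<iota> 0 = 0" using \<iota>_add[of 0 0] by simp
lemma \<phi>_diff: "\<phi> (x - y) = \<phi> x - \<phi> y" using \<phi>_add[of "x - y" y] by simp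

text \<open>The ring is noncommutative but the values of \<open>\<phi>\<close> commute, so this is
  the trace identity over a field. It makes the trace invariant under equivalence.\<close>

lemma mat_char_comm:
  assumes "A \<in> carrier_mat m n" "B \<in> carrier_mat n m"
  shows "mat_char \<phi> (A * B) = mat_char \<phi> (B * A)"
proof -
  have \<phi>s: "\<phi> (sum g S) = (\<Sum>i\<in>S. \<phi> (g i))" for g and S :: "nat set"
    by (induction S rule: infinite_finite_induct) (simp_all add: \<phi>_zero \<phi>_add)
  have "mat_char \<phi> (A * B) = (\<Sum>i<m. \<Sum>k = 0..<n. \<phi> (A $$ (i, k)) * \<phi> (B $$ (k, i)))"
    using assms by (simp add: mat_char_def scalar_prod_def \<phi>s \<phi>_mult)
  also have "\<dots> = (\<Sum>k = 0..<n. \<Sum>i<m. \<phi> (A $$ (i, k)) * \<phi> (B $$ (k, i)))"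
    by (rule sum.swap)
  also have "\<dots> = (\<Sum>k<n. \<Sum>i = 0..<m. \<phi> (B $$ (k, i)) * \<phi> (A $$ (i, k)))"
    by (simp add: lessThan_atLeast0 mult.commute)
  also have "\<dots> = mat_char \<phi> (B * A)"
    using assms by (simp add: mat_char_def scalar_prod_def \<phi>s \<phi>_mult)
  finally show ?thesis .
qed

lemma mat_char_diag2:
  assumes "P \<in> carrier_mat m m" "Q \<in> carrier_mat n n"
  shows "mat_char \<phi> (diag2 P Q) = mat_char \<phi> P + mat_char \<phi> Q"
proof -
  have "mat_char \<phi> (diag2 P Q) = (\<Sum>i<m + n. \<phi> (if i < m then P $$ (i, i) else Q $$ (i - m, i - m)))"
    using assms by (auto simp: mat_char_def diag2_def intro!: sum.cong)
  also have "\<dots> = (\<Sum>i<m. \<phi> (P $$ (i, i))) + (\<Sum>i<n. \<phi> (Q $$ (i, i)))"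
    by (induction n) (simp_all add: add.assoc)
  finally show ?thesis using assms by (simp add: mat_char_def)
qed

section \<open>The trace as a homomorphism on \<open>K0\<close>\<close>

definition V_char :: "'a V_semigroup \<Rightarrow> 'k"
  where "V_char v = mat_char \<phi> (mat_of (rep_V_semigroup v))"

lemma V_char_abs: "V_char (abs_V_semigroup X) = mat_char \<phi> (mat_of X)"
proof -
  have "sim0 (rep_V_semigroup (abs_V_semigroup X)) X"
    using Quotient3_V_semigroup rep_abs_rsp_left[OF Quotient3_V_semigroup sim0_refl] by blast
  then show ?thesis unfolding V_char_def
    by (rule sim0E) (metis mat_char_comm)
qed

lemma V_char_class: "idem_carrier n P \<Longrightarrow> V_char (V_class P) = mat_char \<phi> P"
  unfolding V_class_def V_char_abs by (simp add: mat_of_Idem)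

lemma V_char_add: "V_char (v + w) = V_char v + V_char w"
proof -
  obtain m P where P: "idem_carrier m P" "v = V_class P" using V_class_cases by blast
  obtain n Q where Q: "idem_carrier n Q" "w = V_class Q" using V_class_cases by blast
  show ?thesis
    unfolding P(2) Q(2) V_class_add[OF P(1) Q(1)] V_char_class[OF P(1)] V_char_class[OF Q(1)]
      V_char_class[OF idem_carrier_diag2[OF P(1) Q(1)]]
    using P(1) Q(1) by (intro mat_char_diag2) (auto simp: idem_carrier_def)
qed

definition K0_char :: "'a K0 \<Rightarrow> 'k"
  where "K0_char x = V_char (fst (rep_grothendieck x)) - V_char (snd (rep_grothendieck x))"

lemma K0_char_abs: "K0_char (abs_grothendieck (v, w)) = V_char v - V_char w"
proof -
  let ?r = "rep_grothendieck (abs_grothendieck (v, w))"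
  have "abs_grothendieck ?r = abs_grothendieck (v, w)"
    by (rule Quotient3_abs_rep[OF Quotient3_grothendieck])
  then have "groth_rel ?r (v, w)" unfolding grothendieck.abs_eq_iff .
  \<comment> \<open>The additional summand \<open>e\<close> of the Grothendieck relation cancels in
    the field.\<close>
  then obtain e where "fst ?r + w + e = v + snd ?r + e" by (auto simp: groth_rel_def)
  then have "V_char (fst ?r + w + e) = V_char (v + snd ?r + e)" by simp
  then show ?thesis unfolding K0_char_def by (simp add: V_char_add algebra_simps)
qed

lemma K0_char_add: "K0_char (x + y) = K0_char x + K0_char y"
proof -
  obtain a b where x: "x = abs_grothendieck (a, b)"
    using grothendieck.abs_induct[of "\<lambda>x. \<exists>v w. x = abs_grothendieck (v, w)"] by (metis surj_pair)
  obtain c d where y: "y = abs_grothendieck (c, d)"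
    using grothendieck.abs_induct[of "\<lambda>x. \<exists>v w. x = abs_grothendieck (v, w)"] by (metis surj_pair)
  show ?thesis unfolding x y plus_grothendieck.abs_eq fst_conv snd_conv K0_char_abs V_char_add by simp
qed

lemma K0_char_class: "K0_char (K0_class v) = V_char v"
  by (simp add: K0_class_def K0_char_abs V_char_add)

section \<open>Every idempotent has the class of an identity matrix or of zero\<close>

lemma idem_carrier_one: "n \<ge> 1 \<Longrightarrow> idem_carrier n (1\<^sub>m n :: 'a mat)"
  by (simp add: idem_carrier_def)

lemma K0_class_one:
  "n \<ge> 1 \<Longrightarrow> K0_class (V_class (1\<^sub>m n :: 'a mat)) = multiples (K0_class (V_class (1\<^sub>m 1))) n"
proof (induction n rule: dec_induct)
  case base
  show ?case by (simp add: multiples_def)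
next
  case (step n)
  have "diag2 (1\<^sub>m n) (1\<^sub>m 1) = (1\<^sub>m (n + 1) :: 'a mat)"
    by (simp add: diag2_def)
  then have "V_class (1\<^sub>m (Suc n) :: 'a mat) = V_class (1\<^sub>m n) + V_class (1\<^sub>m 1)"
    using V_class_add[OF idem_carrier_one[OF step.hyps(1)] idem_carrier_one[OF order_refl]] by simp
  then show ?case using step.IH by (simp only: K0_class_add multiples_simps(2))
qed

lemma K0_class_zero_mat:
  assumes "n \<ge> 1" shows "K0_class (V_class (0\<^sub>m n n :: 'a mat)) = 0"
proof -
  have z: "idem_carrier n (0\<^sub>m n n :: 'a mat)" using assms by (simp add: idem_carrier_def)
  have "V_class (0\<^sub>m n n :: 'a mat) = V_class (0\<^sub>m n n) + V_class (0\<^sub>m n n)"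
    by (rule V_class_split[OF z z z, of "0\<^sub>m n n" "0\<^sub>m n n" "0\<^sub>m n n" "0\<^sub>m n n"]) simp_all
  then show ?thesis using K0_class_zero by metis
qed

text \<open>Over the field \<open>c\<close> factors through an identity matrix, and
  \<open>\<iota>\<close> transports the factorization to the ring.\<close>

lemma K0_class_scalar:
  assumes c: "idem_carrier n c"
  shows "\<exists>k. K0_class (V_class (map_mat \<iota> c)) = multiples (K0_class (V_class (1\<^sub>m 1))) k"
proof -
  have cc: "c \<in> carrier_mat n n" "c * c = c" and n: "n \<ge> 1" using c by (auto simp: idem_carrier_def)
  obtain k A B where AB: "A \<in> carrier_mat n k" "B \<in> carrier_mat k n" "c = A * B" "B * A = 1\<^sub>m k"
    using field_idempotent_factorization[OF cc] by blast
  show ?thesis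
  \<comment> \<open>Size 0 is not represented in the semigroup, so this case passes through the zero
    matrix.\<close>
  proof (cases "k = 0")
    case True
    have "map_mat \<iota> c = 0\<^sub>m n n"
      using AB True by (intro eq_matI) (auto simp: scalar_prod_def \<iota>_zero)
    then show ?thesis using K0_class_zero_mat[OF n] by (intro exI[of _ 0]) (simp add: multiples_def)
  next
    case False
    then have k: "k \<ge> 1" by simp
    have "V_class (map_mat \<iota> c) = V_class (1\<^sub>m k)"
    proof (rule V_class_eqI[of n _ k _ "map_mat \<iota> A" "map_mat \<iota> B"])
      show "idem_carrier n (map_mat \<iota> c)" by (rule map_mat_idem[OF c \<iota>_add \<iota>_mult])
      show "idem_carrier k (1\<^sub>m k :: 'a mat)" by (rule idem_carrier_one[OF k])
      show "map_mat \<iota> c = map_mat \<iota> A * map_mat \<iota> B"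
        unfolding AB(3) using AB(1,2) by (intro mult_map_mat[symmetric]) (simp_all add: \<iota>_add \<iota>_mult)
      have "map_mat \<iota> B * map_mat \<iota> A = map_mat \<iota> (B * A)"
        using AB(1,2) by (intro mult_map_mat) (simp_all add: \<iota>_add \<iota>_mult)
      also have "\<dots> = 1\<^sub>m k" unfolding AB(4) by (rule eq_matI) (auto simp: \<iota>_one \<iota>_zero)
      finally show "1\<^sub>m k = map_mat \<iota> B * map_mat \<iota> A" ..
    qed (use AB in simp_all)
    then show ?thesis using K0_class_one[OF k] by metis
  qed
qed

text \<open>The upper block \<open>P e\<close> lies in the corner of a swindling idempotent and so
  contributes nothing.\<close>

lemma K0_class_triangular:
  assumes P: "idem_carrier n P" and e: "e * e = e" "swindles e"
    and z: "scalar_mat n (1 - e) * (P * scalar_mat n e) = 0\<^sub>m n n"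
  shows "K0_class (V_class P) = K0_class (V_class (scalar_mat n (1 - e) * P))"
proof -
  let ?e = "scalar_mat n e" and ?f = "scalar_mat n (1 - e)"
  have ff: "(1 - e) * (1 - e) = 1 - e" using e(1) by (simp add: algebra_simps)
  have ef: "?e + ?f = 1\<^sub>m n" "?e * ?e = ?e" "?f * ?f = ?f"
    unfolding scalar_mat_ring e(1) ff by (simp_all add: scalar_mat_ring)
  note tri = V_class_triangular[OF P scalar_mat_carrier scalar_mat_carrier ef z]
  have Pc: "P \<in> carrier_mat n n" using P by (simp add: idem_carrier_def)
  have "P * ?e * ?e = P * ?e"
    using assoc_mult_mat[OF Pc scalar_mat_carrier scalar_mat_carrier, of e e] ef(2) by simp
  then obtain w where "V_class (P * ?e) + w = w"
    using swindles_absorb[OF e(2) tri(1,4)] by blast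
  then have "K0_class (V_class (P * ?e)) = 0" by (rule K0_class_zero)
  then show ?thesis unfolding tri(3) K0_class_add by simp
qed

lemma K0_class_multiple:
  assumes P: "idem_carrier n (P :: 'a mat)"
  shows "\<exists>k. K0_class (V_class P) = multiples (K0_class (V_class (1\<^sub>m 1))) k"
proof -
  have Pc: "P \<in> carrier_mat n n" using P by (simp add: idem_carrier_def)
  define c where "c = map_mat \<phi> P"
  have c: "idem_carrier n c" unfolding c_def by (rule map_mat_idem[OF P \<phi>_add \<phi>_mult])
  define Q where "Q = map_mat \<iota> c"
  have Q: "idem_carrier n Q" unfolding Q_def by (rule map_mat_idem[OF c \<iota>_add \<iota>_mult])
  have Qc: "Q \<in> carrier_mat n n" using Q by (simp add: idem_carrier_def)
  have Qij: "Q $$ (i, j) = \<iota> (\<phi> (P $$ (i, j)))" if "i < n" "j < n" for i j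
    using that Pc by (simp add: Q_def c_def)
  \<comment> \<open>The factor \<open>q\<close> is part of the conjugated entries and keeps them in
    the kernel of \<open>\<phi>\<close>.\<close>
  define F where "F = (\<lambda>(i, j). (P $$ (i, j) - Q $$ (i, j)) * q) ` ({..<n} \<times> {..<n})"
  have "finite F" unfolding F_def by simp
  moreover have "\<phi> x = 0" if "x \<in> F" for x
    using that by (auto simp: F_def Qij \<phi>_mult \<phi>_diff \<phi>_\<iota>)
  ultimately obtain e where e: "e * e = e" "p * q * e = e" "\<And>x. x \<in> F \<Longrightarrow> e * p * x = p * x" "swindles e"
    using absorb[of F] by blast
  let ?e = "scalar_mat n e" and ?f = "scalar_mat n (1 - e)"
  let ?P = "scalar_mat n p * (P * scalar_mat n q)" and ?Q = "scalar_mat n p * (Q * scalar_mat n q)"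
  have expand: "?f * (scalar_mat n p * (X * scalar_mat n q)) = map_mat (\<lambda>x. (1 - e) * (p * (x * q))) X"
    if X: "X \<in> carrier_mat n n" for X
  proof -
    have 1: "X * scalar_mat n q = map_mat (\<lambda>x. x * q) X" by (rule mult_scalar_mat[OF X])
    have 2: "scalar_mat n p * map_mat (\<lambda>x. x * q) X = map_mat (\<lambda>x. p * x) (map_mat (\<lambda>x. x * q) X)"
      using X by (intro scalar_mat_mult[of _ n n]) simp
    have 3: "?f * map_mat (\<lambda>x. p * x) (map_mat (\<lambda>x. x * q) X) =
        map_mat (\<lambda>x. (1 - e) * x) (map_mat (\<lambda>x. p * x) (map_mat (\<lambda>x. x * q) X))"
      using X by (intro scalar_mat_mult[of _ n n]) simp
    show ?thesis unfolding 1 2 3 by (rule eq_matI) auto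
  qed
  have fPQ: "?f * ?P = ?f * ?Q"
    unfolding expand[OF Pc] expand[OF Qc]
  proof (rule eq_matI)
    fix i j assume "i < dim_row (map_mat (\<lambda>x. (1 - e) * (p * (x * q))) Q)"
      "j < dim_col (map_mat (\<lambda>x. (1 - e) * (p * (x * q))) Q)"
    then have ij: "i < n" "j < n" using Qc by auto
    have "(P $$ (i, j) - Q $$ (i, j)) * q \<in> F" using ij unfolding F_def by force
    then have "e * p * ((P $$ (i, j) - Q $$ (i, j)) * q) = p * ((P $$ (i, j) - Q $$ (i, j)) * q)" by (rule e(3))
    \<comment> \<open>The relation \<open>e * p * x = p * x\<close> says that \<open>1 - e\<close>
      annihilates \<open>p * x\<close>.\<close>
    then have "(1 - e) * (p * (P $$ (i, j) * q)) = (1 - e) * (p * (Q $$ (i, j) * q))"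
      by (simp add: algebra_simps)
    then show "map_mat (\<lambda>x. (1 - e) * (p * (x * q))) P $$ (i, j) =
        map_mat (\<lambda>x. (1 - e) * (p * (x * q))) Q $$ (i, j)"
      using ij Pc Qc by simp
  qed (use Pc Qc in auto)
  \<comment> \<open>The entries of \<open>Q\<close> are central and \<open>p * q * e = e\<close>, so
    this reduces to \<open>(1 - e) * e = 0\<close>.\<close>
  have fQe: "?f * ?Q * ?e = 0\<^sub>m n n"
  proof -
    have "?f * ?Q * ?e = map_mat (\<lambda>x. x * e) (map_mat (\<lambda>x. (1 - e) * (p * (x * q))) Q)"
      unfolding expand[OF Qc] using Qc by (intro mult_scalar_mat[of _ n n]) simp
    also have "\<dots> = 0\<^sub>m n n"
    proof (rule eq_matI)
      fix i j assume "i < dim_row (0\<^sub>m n n :: 'a mat)" "j < dim_col (0\<^sub>m n n :: 'a mat)"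
      then have ij: "i < n" "j < n" by auto
      let ?c = "\<phi> (P $$ (i, j))"
      have "(1 - e) * (p * (\<iota> ?c * q)) * e = (1 - e) * (\<iota> ?c * (p * q * e))"
        using \<iota>_central[of ?c p] by (metis mult.assoc)
      also have "\<dots> = \<iota> ?c * ((1 - e) * e)"
        unfolding e(2) using \<iota>_central[of ?c "1 - e"] by (metis mult.assoc)
      also have "\<dots> = 0" by (simp add: algebra_simps e(1))
      finally show "map_mat (\<lambda>x. x * e) (map_mat (\<lambda>x. (1 - e) * (p * (x * q))) Q) $$ (i, j) = 0\<^sub>m n n $$ (i, j)"
        using ij Qc by (simp add: Qij)
    qed (use Qc in auto)
    finally show ?thesis .
  qed
  note conjP = V_class_conjugate[OF P qp] and conjQ = V_class_conjugate[OF Q qp]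
  have Pc': "?P \<in> carrier_mat n n" and Qc': "?Q \<in> carrier_mat n n"
    using conjP(1) conjQ(1) by (simp_all add: idem_carrier_def)
  have zQ: "?f * (?Q * ?e) = 0\<^sub>m n n"
    using assoc_mult_mat[OF scalar_mat_carrier Qc' scalar_mat_carrier, of "1 - e" e] fQe by simp
  \<comment> \<open>The entries of \<open>P\<close> need not be central; triangularity is inherited
    from \<open>Q\<close> through \<open>fPQ\<close>.\<close>
  have zP: "?f * (?P * ?e) = 0\<^sub>m n n"
    using assoc_mult_mat[OF scalar_mat_carrier Pc' scalar_mat_carrier, of "1 - e" e] fQe fPQ by simp
  have "K0_class (V_class P) = K0_class (V_class Q)"
    using K0_class_triangular[OF conjP(1) e(1,4) zP] K0_class_triangular[OF conjQ(1) e(1,4) zQ]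
    unfolding fPQ conjP(2) conjQ(2) by simp
  then show ?thesis using K0_class_scalar[OF c] unfolding Q_def by simp
qed

lemma K0_iso_int: "\<exists>f :: 'a K0 \<Rightarrow> int. add_iso f"
proof (rule infinite_cyclic_int_iso)
  fix x :: "'a K0"
  obtain v w where x: "x = K0_class v - K0_class w" using K0_cases by blast
  obtain m P where P: "idem_carrier m P" "v = V_class P" using V_class_cases by blast
  obtain n Q where Q: "idem_carrier n Q" "w = V_class Q" using V_class_cases by blast
  show "\<exists>k l. x = multiples (K0_class (V_class (1\<^sub>m 1))) k - multiples (K0_class (V_class (1\<^sub>m 1))) l"
    using K0_class_multiple[OF P(1)] K0_class_multiple[OF Q(1)] unfolding x P(2) Q(2) by metis
next
  show "K0_char (x + y) = K0_char x + K0_char y" for x y by (rule K0_char_add)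
  show "K0_char (K0_class (V_class (1\<^sub>m 1))) = 1"
    unfolding K0_char_class V_char_class[OF idem_carrier_one[OF order_refl]]
    using \<phi>_\<iota>[of 1] by (simp add: mat_char_def \<iota>_one)
qed

end

section \<open>Application to the operators on the ordinal interval\<close>

lemma (in based_club) swindles_gap_proj:
  "swindles (gap_proj :: (omega1_interval, 'k::{real_normed_field, banach}) bounded_op)"
  unfolding swindles_def
proof (intro exI conjI allI)
  show "gap_restrict 0 * gap_embed 0 = (gap_proj :: (omega1_interval, 'k) bounded_op)"
    by (simp add: gap_restrict_embed)
  fix k l m and S T :: "(omega1_interval, 'k) bounded_op"
  show "replicate_op k l S * replicate_op l m T = replicate_op k m (S * gap_proj * T)"
    by (rule replicate_op_mult)
  show "replicate_op k l (S + T) = replicate_op k l S + replicate_op k l T"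
    by (rule replicate_op_add)
  show "replicate_op 0 0 T = gap_embed 0 * T * gap_restrict 0 + replicate_op 1 1 T"
    by (rule replicate_op_split)
  show "gap_restrict 0 * replicate_op 1 0 T = 0"
    by (simp add: gap_restrict_replicate)
  show "replicate_op 0 1 T * gap_embed 0 = 0"
    by (rule replicate_op_embed)
qed

lemma club_insert: "club D \<Longrightarrow> club (insert x D)"
  unfolding club_def by (auto intro: closed_insert)

text \<open>The club is chosen for the operators \<open>p * T\<close>: their values vanish at
  \<open>omega1\<close>, so acting as 0 on \<open>D\<close> means vanishing there, and vanishing at
  \<open>x0\<close> allows \<open>x0\<close> to be added. Conversely, functions in the range of
  \<open>gap_proj\<close> vanish at \<open>x0\<close> and \<open>omega1\<close>, so
  \<open>p * q\<close> fixes them.\<close>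

lemma character_kernel_absorbed:
  fixes p q :: "(omega1_interval, 'k::{real_normed_field, banach}) bounded_op"
  assumes x0: "\<And>x. x0 \<le> x" and p: "\<And>f. app p f x0 = 0" "\<And>f. app p f omega1 = 0"
    and pq: "\<And>g. apply_bcontfun g x0 = 0 \<Longrightarrow> apply_bcontfun g omega1 = 0 \<Longrightarrow> app (p * q) g = g"
    and F: "finite F" "\<And>T. T \<in> F \<Longrightarrow> character T = 0"
  shows "\<exists>e. e * e = e \<and> p * q * e = e \<and> (\<forall>T\<in>F. e * p * T = p * T) \<and> swindles e"
proof -
  obtain D where D: "club D" "\<And>T. T \<in> (*) p ` F \<Longrightarrow> acts_as_scalar_on T (character T) D"
    using character_common_club[of "(*) p ` F"] F(1) by blast
  interpret based_club "insert x0 D" x0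
    by (unfold_locales) (simp_all add: club_insert D(1) x0)
  let ?e = "gap_proj :: (omega1_interval, 'k) bounded_op"
  have vanish: "app (p * T) f a = 0" if "T \<in> F" "a \<in> insert x0 D" for T f a
  proof (cases "a = x0")
    case False
    have "acts_as_scalar_on (p * T) (character (p * T)) D" using D(2) that(1) by blast
    then have "app (p * T) f a - app (p * T) f omega1 = 0"
      using that False F(2)[OF that(1)] unfolding acts_as_scalar_on_def by (simp add: character_mult)
    then show ?thesis by (simp add: p)
  qed (simp add: p)
  have "?e * p * T = p * T" if "T \<in> F" for T
  proof (intro bounded_op_eqI')
    fix f x
    have "app (p * T) f (up x) = 0" using that up_in by (rule vanish)
    then show "app (?e * p * T) f x = app (p * T) f x" by (simp add: app_gap_proj)
  qed
  moreover have "p * q * ?e = ?e"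
  proof (rule bounded_op_eqI)
    fix f :: "omega1_interval \<Rightarrow>\<^sub>C 'k"
    have "app (p * q) (app ?e f) = app ?e f"
      by (rule pq) (simp_all add: app_gap_proj up_id up_id[OF top_in])
    then show "app (p * q * ?e) f = app ?e f" by simp
  qed
  ultimately show ?thesis using gap_proj_idem swindles_gap_proj by blast
qed

text \<open>Completeness of the scalar field enters through the infinite sums in the
  swindle.\<close>

lemma K0_bounded_op_iso_int:
  "\<exists>f :: (omega1_interval, 'k::{real_normed_field, banach}) bounded_op K0 \<Rightarrow> int. add_iso f"
proof -
  obtain p q :: "(omega1_interval, 'k) bounded_op" and x0 where qp: "q * p = 1"
    and x0: "\<And>x. x0 \<le> x" and p: "\<And>f. app p f x0 = 0" "\<And>f. app p f omega1 = 0"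
    and pq: "\<And>g. apply_bcontfun g x0 = 0 \<Longrightarrow> apply_bcontfun g omega1 = 0 \<Longrightarrow> app (p * q) g = g"
    using hyperplane_isomorphism[where 'k = 'k] by blast
  interpret K0_character "character :: (omega1_interval, 'k) bounded_op \<Rightarrow> 'k" scalar_op p q
  proof
    show "scalar_op c * T = T * scalar_op c" for c and T :: "(omega1_interval, 'k) bounded_op"
      by (rule bounded_op_eqI) (simp add: app_scale)
    show "\<exists>e. e * e = e \<and> p * q * e = e \<and> (\<forall>T\<in>F. e * p * T = p * T) \<and> swindles e"
      if "finite F" "\<And>T. T \<in> F \<Longrightarrow> character T = 0" for F
      using x0 p pq that by (rule character_kernel_absorbed)
  qed (simp_all add: character_add character_mult character_scalar scalar_op_simps qp)
  show ?thesis by (rule K0_iso_int)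
qed

theorem mainTheorem2:
  shows "(\<exists>\<phi> :: (omega1_interval, real) bounded_op K0 \<Rightarrow> int. add_iso \<phi>) \<and>
         (\<exists>\<phi> :: (omega1_interval, complex) bounded_op K0 \<Rightarrow> int. add_iso \<phi>)"
  by (intro conjI K0_bounded_op_iso_int)

end
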